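(* Let $(R,|\cdot|)$ be a normed Dedekind domain of multimetric linear type, with respect to $|\cdot|=\prod_{j=1}^m|\cdot|_j$, with fraction field $K$. Suppose that $|R|$ is a discrete subset of $\mathbb{R}$. Let $f=\sum_{1\le i\le k\le n} m_{ik}t_it_k\in R[t_1,\ldots,t_n]$ be a nonzero isotropic quadratic form. (a) If the norm is of $q$-type, then $f$ admits an isotropic vector $a=(a_1,\ldots,a_n)\in R^n$ with $$\max_i \deg a_i\le mn-1-c_M(R,n)+\left(\frac{n-1}{2}\right)\deg f .$$ (b) Suppose that $|\cdot|_j$ is Archimedean for at least one $j$, and let $m'\geq 1$ be the number of such $j$. Let $0<\delta<C_M(R,n)$ and $0<\eta<1$. Then $f$ admits an isotropic vector $a=(a_1,\ldots,a_n)\in R^n$ with $$\max_i|a_i|\le\max\left(\frac{(1-\eta^{1/m'})^{-m'(n-1)}}{\eta\,(C_M(R,n)-\delta)},\ \frac{1}{\eta\,(C_M(R,n)-\delta)}\,|3f|^{\frac{n-1}{2}}\right).$$ (c) If $R=\mathbb{Z}$ (with its usual absolute value, $m=1$), then $f$ admits an isotropic vector $a\in\mathbb{Z}^n$ with $|a|\le(3|f|)^{\frac{n-1}{2}}$.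
   Context: Norms. A normed Dedekind domain $(R,|\cdot|)$ is a Dedekind domain $R$ with fraction field $K$ together with an ideal norm: a monoid homomorphism $|\cdot|$ from the nonzero ideals of $R$ under multiplication to $[1,\infty)$ with $|I|=1\iff I=R$. It extends to nonzero fractional ideals; for $x\in K^\times$ put $|x|=|xR|$, and $|0|=0$. For a set $X$ containing $0$, $X^\bullet=X\setminus\{0\}$. Covolumes. An $R$-lattice in $K^n$ is a finitely generated $R$-submodule $\Lambda\subset K^n$ spanning $K^n$ over $K$. For a finite length $R$-module $M\cong\bigoplus_i R/\mathfrak{p}_i^{n_i}$ put $\chi(M)=\prod_i\mathfrak{p}_i^{n_i}$. For a lattice $\Lambda$ choose $\alpha\in R^\bullet$ with $\alpha\Lambda\subset R^n$ and put $\chi(\Lambda)=\alpha^{-n}\chi(R^n/\alpha\Lambda)$ (independent of $\alpha$), $\operatorname{Covol}\Lambda=|\chi(\Lambda)|$. Multimetric norms. The norm is multimetric if $|x|=\prod_{j=1}^m|x|_j$ for all $x\in K$, where each $|\cdot|_j:K\to\mathbb{R}^{\ge0}$ is multiplicative, vanishes only at $0$, and is almost metric (for some $A$, $|x+y|_j\le A\max(|x|_j,|y|_j)$ for all $x,y$). The least such $A$ is the Artin constant; throughout the norms are normalized so that each Artin constant is at most $2$, so each $|\cdot|_j$ satisfies the triangle inequality. $|\cdot|_j$ is non-Archimedean if its Artin constant is $1$ and Archimedean otherwise. Put $\mathcal{N}=|K^\times|$, $\mathcal{N}_j=|K^\times|_j$, with closures $\overline{\mathcal{N}},\overline{\mathcal{N}_j}$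 in $\mathbb{R}^{>0}$. The norm is of $q$-type if a $q>1$ is given with $\mathcal{N}_j\subset q^{\mathbb{Z}}$ for all $j$; then $\deg=\log_q|\cdot|$, $\deg_j=\log_q|\cdot|_j$. Multimetric (multinormed) linear type. For $n\in\mathbb{Z}^+$ call $C\in\overline{\mathcal{N}}$ admissible if: for all $M=(m_{ik})\in GL_n(K)$, all $R$-lattices $\Lambda\subset K^n$ and all $\epsilon_{ij}\in\overline{\mathcal{N}_j}$ ($1\le i\le n$, $1\le j\le m$) with $|\det M|\operatorname{Covol}\Lambda\le C\prod_{i,j}\epsilon_{ij}$, there is $x\in\Lambda^\bullet$ with $|\sum_{k}m_{ik}x_k|_j\le\epsilon_{ij}$ for all $i,j$. When the norm is of $q$-type, $C$ and the $\epsilon_{ij}$ instead range over $q^{\mathbb{Z}}$. $R$ is of multimetric linear type if for every $n$ an admissible $C$ exists; $C_M(R,n)$ is the supremum of admissible $C$, and in $q$-type $c_M(R,n)=\log_qC_M(R,n)$. Sizes. For $x\in K^n$: $|x|_j=\max_i|x_i|_j$ and $|x|=\prod_j|x|_j$. For $f=\sum_{i\le k}m_{ik}t_it_k$: $|f|_j=\sum_{i\le k}|m_{ik}|_j$ if $|\cdot|_j$ is Archimedean, $|f|_j=\max_{i\le k}|m_{ik}|_j$ otherwise; $|f|=\prod_j|f|_j$ and, in $q$-type, $\deg f=\log_q|f|$. $|3f|$ denotes $|f|\prod_{j\text{ Archimedean}}|3|_j$. An isotropic vector for $f$ is a nonzero $v\in R^n$ with $f(v)=0$; $f$ is isotropic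 if it has one. *)

theory Defs
  imports
    "HOL-Analysis.Isolated"
    "HOL-Algebra.Ring_Divisibility"
    "HOL-Algebra.Subrings"
    "HOL-Algebra.Ideal_Product"
    "Jordan_Normal_Form.VS_Connect"
begin

unbundle no vec_syntax

text \<open>
  A domain \<open>R\<close> is given as a subset of its fraction field, which is the whole type \<open>'k\<close>.
  All indices are shifted to start at 0: coordinates are \<open>i < n\<close>, norms are \<open>j < m\<close>.
\<close>

abbreviation ring_on :: "'k::field set \<Rightarrow> 'k ring" where
  "ring_on R \<equiv> class_ring\<lparr>carrier := R\<rparr>"

definition integrally_closed :: "'k::field set \<Rightarrow> bool" where
  "integrally_closed R \<longleftrightarrow>
     (\<forall>x. (\<exists>p. lead_coeff p = 1 \<and> (\<forall>i. coeff p i \<in> R) \<and> poly p x = 0) \<longrightarrow> x \<in> R)"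

text \<open>Krull dimension at most one; in particular fields count as Dedekind domains.\<close>

definition dedekind_domain :: "'k::field set \<Rightarrow> bool" where
  "dedekind_domain R \<longleftrightarrow>
     subring R (class_ring :: 'k ring) \<and>
     (\<forall>x. \<exists>a\<in>R. \<exists>b\<in>R - {0}. x = a / b) \<and>
     noetherian_ring (ring_on R) \<and>
     integrally_closed R \<and>
     (\<forall>P. primeideal P (ring_on R) \<and> P \<noteq> {0} \<longrightarrow> maximalideal P (ring_on R))"

definition nonzero_ideals :: "'k::field set \<Rightarrow> 'k set set" where
  "nonzero_ideals R = {I. ideal I (ring_on R) \<and> I \<noteq> {0}}"

definition normed_dedekind_domain :: "'k::field set \<Rightarrow> ('k set \<Rightarrow> real) \<Rightarrow> bool" where
  "normed_dedekind_domain R N \<longleftrightarrow>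
     dedekind_domain R \<and>
     (\<forall>I\<in>nonzero_ideals R. \<forall>J\<in>nonzero_ideals R. N (I \<cdot>\<^bsub>ring_on R\<^esub> J) = N I * N J) \<and>
     (\<forall>I\<in>nonzero_ideals R. 1 \<le> N I \<and> (N I = 1 \<longleftrightarrow> I = R))"

text \<open>
  The multiplicative extension of the ideal norm to nonzero fractional ideals: if \<open>aJ\<close> is an
  ideal of \<open>R\<close>, then \<open>|J| = |aJ| / |aR|\<close>, whatever the choice of \<open>a\<close>.
\<close>

definition frac_ideal_norm :: "'k::field set \<Rightarrow> ('k set \<Rightarrow> real) \<Rightarrow> 'k set \<Rightarrow> real" where
  "frac_ideal_norm R N J =
     (THE v. \<exists>a\<in>R - {0}. (*) a ` J \<subseteq> R \<and> v = N ((*) a ` J) / N ((*) a ` R))"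

definition elem_norm :: "'k::field set \<Rightarrow> ('k set \<Rightarrow> real) \<Rightarrow> 'k \<Rightarrow> real" where
  "elem_norm R N x = (if x = 0 then 0 else frac_ideal_norm R N ((*) x ` R))"

subsection \<open>Lattices and covolumes\<close>

definition vecs_over :: "'k::field set \<Rightarrow> nat \<Rightarrow> 'k vec set" where
  "vecs_over R n = {v \<in> carrier_vec n. \<forall>i<n. v $ i \<in> R}"

definition is_lattice :: "'k::field set \<Rightarrow> nat \<Rightarrow> 'k vec set \<Rightarrow> bool" where
  "is_lattice R n L \<longleftrightarrow>
     (\<exists>S. finite S \<and> S \<subseteq> carrier_vec n \<and>
          L = LinearCombinations.module.span (ring_on R) (module_vec TYPE('k) n) S) \<and>
     LinearCombinations.module.span class_ring (module_vec TYPE('k) n) L = carrier_vec n"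

text \<open>
  For \<open>R\<close>-submodules \<open>L' \<subseteq> L\<close> of \<open>K\<^sup>n\<close>: the quotient \<open>L/L'\<close> is isomorphic to the direct sum of the
  \<open>R/P\<^sub>i\<^bsup>k\<^sub>i\<^esup>\<close> (\<open>i < r\<close>) for nonzero primes \<open>P\<^sub>i\<close>, and \<open>I\<close> is the product of the \<open>P\<^sub>i\<^bsup>k\<^sub>i\<^esup>\<close>, that is,
  \<open>I = \<chi>(L/L')\<close>. The columns of \<open>E\<close> represent the images of the standard generators under the
  isomorphism: the \<open>R\<close>-linear map \<open>c \<mapsto> Ec + L'\<close> from \<open>R\<^sup>r\<close> to \<open>L/L'\<close> is onto and has
  kernel \<open>\<Oplus>\<^sub>i P\<^sub>i\<^bsup>k\<^sub>i\<^esup>\<close>.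
\<close>

definition has_chi :: "'k::field set \<Rightarrow> nat \<Rightarrow> 'k vec set \<Rightarrow> 'k vec set \<Rightarrow> 'k set \<Rightarrow> bool" where
  "has_chi R n L L' I \<longleftrightarrow>
     (\<exists>r (P :: nat \<Rightarrow> 'k set) (k :: nat \<Rightarrow> nat). \<exists>E\<in>carrier_mat n r.
        (\<forall>i<r. primeideal (P i) (ring_on R) \<and> P i \<noteq> {0}) \<and>
        (\<forall>c\<in>vecs_over R r. E *\<^sub>v c \<in> L) \<and>
        (\<forall>v\<in>L. \<exists>c\<in>vecs_over R r. v - E *\<^sub>v c \<in> L') \<and>
        (\<forall>c\<in>vecs_over R r.
           E *\<^sub>v c \<in> L' \<longleftrightarrow> (\<forall>i<r. c $ i \<in> P i [^]\<^bsub>ideals_set (ring_on R)\<^esub> k i)) \<and>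
        I = finprod (ideals_set (ring_on R)) (\<lambda>i. P i [^]\<^bsub>ideals_set (ring_on R)\<^esub> k i) {..<r})"

text \<open>
  \<open>has_covol R N n L v\<close> says \<open>Covol L = v\<close>. It is a relation, in the style of \<open>has_integral\<close>;
  for a lattice there is exactly one such \<open>v\<close>, because \<open>\<alpha>\<^sup>-\<^sup>n \<chi>(R\<^sup>n/\<alpha>L)\<close> depends neither on \<open>\<alpha>\<close>
  nor on the chosen decomposition of \<open>R\<^sup>n/\<alpha>L\<close>.
\<close>

definition has_covol ::
    "'k::field set \<Rightarrow> ('k set \<Rightarrow> real) \<Rightarrow> nat \<Rightarrow> 'k vec set \<Rightarrow> real \<Rightarrow> bool" where
  "has_covol R N n L v \<longleftrightarrow>
     (\<exists>\<alpha>\<in>R - {0}. \<exists>I. (\<lambda>x. \<alpha> \<cdot>\<^sub>v x) ` L \<subseteq> vecs_over R n \<and>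
        has_chi R n (vecs_over R n) ((\<lambda>x. \<alpha> \<cdot>\<^sub>v x) ` L) I \<and>
        v = frac_ideal_norm R N ((*) (inverse \<alpha> ^ n) ` I))"

subsection \<open>Multimetric norms\<close>

definition almost_metric_with :: "('k::field \<Rightarrow> real) \<Rightarrow> real \<Rightarrow> bool" where
  "almost_metric_with f A \<longleftrightarrow> (\<forall>x y. f (x + y) \<le> A * max (f x) (f y))"

definition artin_constant :: "('k::field \<Rightarrow> real) \<Rightarrow> real" where
  "artin_constant f = (LEAST A. almost_metric_with f A)"

definition archimedean_norm :: "('k::field \<Rightarrow> real) \<Rightarrow> bool" where
  "archimedean_norm f \<longleftrightarrow> artin_constant f \<noteq> 1"

definition normalized_norm :: "('k::field \<Rightarrow> real) \<Rightarrow> bool" where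
  "normalized_norm f \<longleftrightarrow>
     (\<forall>x. 0 \<le> f x) \<and> (\<forall>x. f x = 0 \<longleftrightarrow> x = 0) \<and> (\<forall>x y. f (x * y) = f x * f y) \<and>
     (\<exists>A. almost_metric_with f A) \<and> artin_constant f \<le> 2"

definition multimetric ::
    "'k::field set \<Rightarrow> ('k set \<Rightarrow> real) \<Rightarrow> nat \<Rightarrow> (nat \<Rightarrow> 'k \<Rightarrow> real) \<Rightarrow> bool" where
  "multimetric R N m nrm \<longleftrightarrow>
     (\<forall>j<m. normalized_norm (nrm j)) \<and> (\<forall>x. elem_norm R N x = (\<Prod>j<m. nrm j x))"

definition value_group :: "('k::field \<Rightarrow> real) \<Rightarrow> real set" where
  "value_group f = f ` (UNIV - {0})"

definition int_powers :: "real \<Rightarrow> real set" where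
  "int_powers q = range (\<lambda>z::int. q powi z)"

text \<open>
  The optional base \<open>qo\<close> is part of the data: \<open>Some q\<close> if the norm is regarded as being of
  \<open>q\<close>-type, \<open>None\<close> if no \<open>q\<close> is given.
\<close>

definition valid_base :: "nat \<Rightarrow> (nat \<Rightarrow> 'k::field \<Rightarrow> real) \<Rightarrow> real option \<Rightarrow> bool" where
  "valid_base m nrm qo \<longleftrightarrow>
     (\<forall>q. qo = Some q \<longrightarrow> q > 1 \<and> (\<forall>j<m. value_group (nrm j) \<subseteq> int_powers q))"

definition target_values :: "real option \<Rightarrow> ('k::field \<Rightarrow> real) \<Rightarrow> real set" where
  "target_values qo f =
     (case qo of None \<Rightarrow> closure (value_group f) \<inter> {0<..} | Some q \<Rightarrow> int_powers q)"

definition admissible ::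
    "'k::field set \<Rightarrow> ('k set \<Rightarrow> real) \<Rightarrow> nat \<Rightarrow> (nat \<Rightarrow> 'k \<Rightarrow> real) \<Rightarrow> real option \<Rightarrow> nat \<Rightarrow> real \<Rightarrow> bool"
  where
  "admissible R N m nrm qo n C \<longleftrightarrow>
     C \<in> target_values qo (elem_norm R N) \<and>
     (\<forall>M L v \<epsilon>.
        M \<in> carrier_mat n n \<and> invertible_mat M \<and>
        is_lattice R n L \<and> has_covol R N n L v \<and>
        (\<forall>i<n. \<forall>j<m. \<epsilon> i j \<in> target_values qo (nrm j)) \<and>
        elem_norm R N (det M) * v \<le> C * (\<Prod>i<n. \<Prod>j<m. \<epsilon> i j) \<longrightarrow>
        (\<exists>x\<in>L. x \<noteq> 0\<^sub>v n \<and> (\<forall>i<n. \<forall>j<m. nrm j ((M *\<^sub>v x) $ i) \<le> \<epsilon> i j)))"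

definition multimetric_linear_type ::
    "'k::field set \<Rightarrow> ('k set \<Rightarrow> real) \<Rightarrow> nat \<Rightarrow> (nat \<Rightarrow> 'k \<Rightarrow> real) \<Rightarrow> real option \<Rightarrow> bool" where
  "multimetric_linear_type R N m nrm qo \<longleftrightarrow> (\<forall>n\<ge>1. \<exists>C. admissible R N m nrm qo n C)"

text \<open>
  The set of admissible constants is bounded above, so the supremum is a genuine one in \<open>\<real>\<close> as
  soon as an admissible constant exists: if arbitrarily large values of \<open>C\<close> are available, then
  so are \<open>\<epsilon>\<^sub>i\<^sub>j\<close> with \<open>\<Prod>\<^sub>j \<epsilon>\<^sub>i\<^sub>j < 1\<close> for all \<open>i\<close>, and these cannot be met for \<open>M = 1\<close> and
  \<open>L = R\<^sup>n\<close> because every nonzero element of \<open>R\<close> has norm at least 1.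
\<close>

definition C_M ::
    "'k::field set \<Rightarrow> ('k set \<Rightarrow> real) \<Rightarrow> nat \<Rightarrow> (nat \<Rightarrow> 'k \<Rightarrow> real) \<Rightarrow> real option \<Rightarrow> nat \<Rightarrow> real" where
  "C_M R N m nrm qo n = Sup {C. admissible R N m nrm qo n C}"

subsection \<open>Quadratic forms and sizes\<close>

text \<open>The form \<open>\<Sum>\<^bsub>i\<le>k\<^esub> c\<^sub>i\<^sub>k t\<^sub>i t\<^sub>k\<close> in \<open>n\<close> variables is given by \<open>c\<close>; only \<open>c i k\<close> with \<open>i \<le> k < n\<close> matter.\<close>

definition form_indices :: "nat \<Rightarrow> (nat \<times> nat) set" where
  "form_indices n = {(i, k). i \<le> k \<and> k < n}"

definition form_eval :: "nat \<Rightarrow> (nat \<Rightarrow> nat \<Rightarrow> 'k::field) \<Rightarrow> 'k vec \<Rightarrow> 'k" where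
  "form_eval n c v = (\<Sum>(i, k)\<in>form_indices n. c i k * v $ i * v $ k)"

definition isotropic_vector ::
    "'k::field set \<Rightarrow> nat \<Rightarrow> (nat \<Rightarrow> nat \<Rightarrow> 'k) \<Rightarrow> 'k vec \<Rightarrow> bool" where
  "isotropic_vector R n c v \<longleftrightarrow> v \<in> vecs_over R n \<and> v \<noteq> 0\<^sub>v n \<and> form_eval n c v = 0"

definition vec_size :: "nat \<Rightarrow> (nat \<Rightarrow> 'k::field \<Rightarrow> real) \<Rightarrow> nat \<Rightarrow> 'k vec \<Rightarrow> real" where
  "vec_size m nrm n v = (\<Prod>j<m. Max ((\<lambda>i. nrm j (v $ i)) ` {..<n}))"

definition form_size_at :: "('k::field \<Rightarrow> real) \<Rightarrow> nat \<Rightarrow> (nat \<Rightarrow> nat \<Rightarrow> 'k) \<Rightarrow> real" where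
  "form_size_at f n c =
     (if archimedean_norm f then \<Sum>(i, k)\<in>form_indices n. f (c i k)
      else Max ((\<lambda>(i, k). f (c i k)) ` form_indices n))"

definition form_size ::
    "nat \<Rightarrow> (nat \<Rightarrow> 'k::field \<Rightarrow> real) \<Rightarrow> nat \<Rightarrow> (nat \<Rightarrow> nat \<Rightarrow> 'k) \<Rightarrow> real" where
  "form_size m nrm n c = (\<Prod>j<m. form_size_at (nrm j) n c)"

definition archimedean_indices :: "nat \<Rightarrow> (nat \<Rightarrow> 'k::field \<Rightarrow> real) \<Rightarrow> nat set" where
  "archimedean_indices m nrm = {j. j < m \<and> archimedean_norm (nrm j)}"

definition triple_form_size ::
    "nat \<Rightarrow> (nat \<Rightarrow> 'k::field \<Rightarrow> real) \<Rightarrow> nat \<Rightarrow> (nat \<Rightarrow> nat \<Rightarrow> 'k) \<Rightarrow> real" where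
  "triple_form_size m nrm n c = form_size m nrm n c * (\<Prod>j\<in>archimedean_indices m nrm. nrm j 3)"

text \<open>
  The maximum of the degrees of the coordinates of a nonzero vector. Since \<open>deg 0 = -\<infinity>\<close> (whereas
  \<open>log q 0 = 0\<close>), zero coordinates do not contribute.
\<close>

definition max_deg ::
    "'k::field set \<Rightarrow> ('k set \<Rightarrow> real) \<Rightarrow> real \<Rightarrow> nat \<Rightarrow> 'k vec \<Rightarrow> real" where
  "max_deg R N q n v = Max ((\<lambda>i. log q (elem_norm R N (v $ i))) ` {i. i < n \<and> v $ i \<noteq> 0})"

definition max_norm :: "'k::field set \<Rightarrow> ('k set \<Rightarrow> real) \<Rightarrow> nat \<Rightarrow> 'k vec \<Rightarrow> real" where
  "max_norm R N n v = Max ((\<lambda>i. elem_norm R N (v $ i)) ` {..<n})"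

end

theory Submission
  imports Defs
begin

text \<open>
  The proof is Cassels' descent. Write \<open>f\<close> for the quadratic form and \<open>T\<close> for its polar form, let \<open>a\<close> be
  isotropic and let \<open>b \<in> R\<^sup>n\<close> be nonzero. The vector \<open>a* = f(b)a - T(a,b)b\<close> is, up to a scalar, the
  reflection of \<open>a\<close> in \<open>b\<close>; hence it is isotropic too, unless it vanishes, and then \<open>b\<close> itself is
  isotropic (lemma \<open>isotropic_reflection\<close>). The point is that \<open>a*\<close> does not change when \<open>b\<close> is replaced
  by \<open>d = b - \<mu>a\<close> for a scalar \<open>\<mu>\<close>, which may even be a different one for each of the norms. So if \<open>b\<close>
  is close to a multiple of \<open>a\<close>, then \<open>a*\<close> is short:
  \<open>|a*|\<^sub>j \<le> |3|\<^sub>j |f|\<^sub>j |a|\<^sub>j |d|\<^sub>j\<^sup>2\<close>, without the factor \<open>|3|\<^sub>j\<close> for non-Archimedean \<open>j\<close>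
  (lemma \<open>reflection_bound\<close>). The geometry of numbers supplies a vector \<open>b\<close> that is both shorter than
  \<open>a\<close> and close to multiples of \<open>a\<close>, as long as \<open>a\<close> is longer than the bound that is claimed. Either \<open>b\<close>
  or \<open>a*\<close> is then an isotropic vector shorter than \<open>a\<close>, and one descends.
  
  The length that goes down is \<open>|a| = \<Prod>\<^sub>j max\<^sub>i |a\<^sub>i|\<^sub>j\<close>. It bounds \<open>max\<^sub>i |a\<^sub>i|\<close> from above, and it is at
  least \<open>1\<close> because nonzero elements of \<open>R\<close> have norm at least \<open>1\<close>. Each step shrinks it by a fixed
  factor, so that finitely many steps suffice; over \<open>\<int>\<close> it is a natural number, and one starts from
  a shortest \<open>a\<close>.
  
  The coordinate \<open>k = k\<^sub>j\<close> at which \<open>|a\<^sub>i|\<^sub>j\<close> is largest depends on \<open>j\<close>, and so do the linear forms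
  \<open>x\<^sub>k\<close> and \<open>x\<^sub>i - (a\<^sub>i/a\<^sub>k)x\<^sub>k\<close> that one wants to make small in \<open>|\<cdot>|\<^sub>j\<close>, whereas admissibility speaks of a
  single matrix. Equivalent norms share the index \<open>k\<close>, and weak approximation for inequivalent norms
  produces one transvection over \<open>K\<close>, of determinant exactly \<open>1\<close>, that is as close as desired to
  the wanted forms in every nontrivial norm at once (lemma \<open>approximating_transvection\<close>). Trivial norms
  never exceed \<open>1\<close> and impose no condition. Together this gives lemma \<open>isotropic_descent\<close>, in which the
  targets for the linear forms are still free. The bounds for norms of \<open>q\<close>-type and for Archimedean norms
  differ only in the choice of these targets. Over \<open>\<int>\<close> the bound has to be reached without any
  knowledge of the admissible constants; there, since \<open>a\<close> is an integral vector, a pigeonhole argument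
  modulo \<open>|a|\<close> takes the place of Minkowski's theorem.
  
  What is used about a single norm is Ostrowski's dichotomy. A norm that is normalized by Artin constant
  at most \<open>2\<close> is either ultrametric or satisfies \<open>|n| = n\<^sup>\<sigma>\<close> on the natural numbers with \<open>0 < \<sigma> \<le> 1\<close>,
  in which case its power with exponent \<open>1/\<sigma>\<close> satisfies the triangle inequality. This yields the factor
  \<open>|3|\<^sub>j\<close>, shows that all positive reals are available as targets at an Archimedean norm, and
  excludes Archimedean norms from \<open>q\<close>-type.
\<close>


section \<open>Norms with Artin constant at most two\<close>

text \<open>
  An estimate of all \<open>k\<close>-th powers may lose a factor that is linear in \<open>k\<close>, because such a factor is
  invisible after taking \<open>k\<close>-th roots. All the passages below from a crude constant to the optimal one
  are of this kind.
\<close>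
lemma le_of_power_le_linear_mult_power:
  fixes x y c :: real
  assumes "0 \<le> x" "0 \<le> y" and le: "\<And>k::nat. x ^ k \<le> c * (real k + 1) * y ^ k"
  shows "x \<le> y"
proof (rule ccontr)
  assume "\<not> x \<le> y"
  then have yx: "y < x" by simp
  with assms have x: "0 < x" by linarith
  define z where "z = y / x"
  have z: "0 \<le> z" "z < 1" using yx x assms by (auto simp: z_def)
  have "(\<lambda>k. c * (real k * z ^ k + z ^ k)) \<longlonglongrightarrow> c * (0 + 0)"
    by (intro tendsto_intros powser_times_n_limit_0 LIMSEQ_power_zero) (use z in auto)
  then have "\<forall>\<^sub>F k in sequentially. c * (real k * z ^ k + z ^ k) < 1"
    by (intro order_tendstoD(2)) auto
  then obtain k where k: "c * (real k * z ^ k + z ^ k) < 1"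
    by (auto simp: eventually_sequentially)
  have "c * (real k + 1) * y ^ k = (c * (real k * z ^ k + z ^ k)) * x ^ k"
    using x by (simp add: z_def power_divide field_simps)
  also have "\<dots> < 1 * x ^ k"
    by (intro mult_strict_right_mono k) (use x in auto)
  finally show False using le[of k] by simp
qed

text \<open>
  The condition on \<open>A\<close> is closed, so the infimum of the admissible \<open>A\<close> is itself admissible; hence the
  \<open>LEAST\<close> in the definition of the Artin constant denotes a minimum.
\<close>
lemma almost_metric_with_artin_constant:
  fixes f :: "'k::field \<Rightarrow> real"
  assumes f0: "\<And>x. 0 \<le> f x" and "f 1 = 1" and "almost_metric_with f A"
  shows "almost_metric_with f (artin_constant f)"
proof -
  let ?S = "{A. almost_metric_with f A}"
  have lb: "0 \<le> B" if "B \<in> ?S" for B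
  proof (rule ccontr)
    assume "\<not> 0 \<le> B"
    moreover have "1 \<le> max (f 1) (f 0)" using \<open>f 1 = 1\<close> by simp
    ultimately have "B * max (f 1) (f 0) < 0" by (intro mult_neg_pos) auto
    moreover have "f (1 + 0) \<le> B * max (f 1) (f 0)" using that unfolding almost_metric_with_def by blast
    ultimately show False using \<open>f 1 = 1\<close> by simp
  qed
  have bdd: "bdd_below ?S" using lb by (meson bdd_belowI)
  have ne: "?S \<noteq> {}" using assms by auto
  have "\<forall>x y. f (x + y) \<le> Inf ?S * max (f x) (f y)"
  proof (intro allI)
    fix x y
    show "f (x + y) \<le> Inf ?S * max (f x) (f y)"
    proof (cases "max (f x) (f y) = 0")
      case True
      have "f (x + y) \<le> A * max (f x) (f y)" using assms(3) unfolding almost_metric_with_def by blast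
      with True show ?thesis by (simp only: True mult_zero_right)
    next
      case False
      then have pos: "max (f x) (f y) > 0" using f0[of x] f0[of y] by linarith
      have "f (x + y) / max (f x) (f y) \<le> Inf ?S"
        by (rule cInf_greatest[OF ne]) (use pos in \<open>auto simp: almost_metric_with_def divide_le_eq\<close>)
      then show ?thesis using pos by (simp add: divide_le_eq)
    qed
  qed
  then have in_S: "almost_metric_with f (Inf ?S)" by (simp add: almost_metric_with_def)
  have "artin_constant f = Inf ?S"
    unfolding artin_constant_def
    by (rule Least_equality) (use in_S bdd in \<open>auto intro: cInf_lower\<close>)
  with in_S show ?thesis by simp
qed

context
  fixes f :: "'k::field \<Rightarrow> real"
  assumes f: "normalized_norm f"
begin

lemma nrm_nonneg: "0 \<le> f x"
  and nrm_eq_0_iff: "f x = 0 \<longleftrightarrow> x = 0"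
  and nrm_mult: "f (x * y) = f x * f y"
  using f unfolding normalized_norm_def by auto

lemma nrm_0: "f 0 = 0" by (simp add: nrm_eq_0_iff)

lemma nrm_pos: "x \<noteq> 0 \<Longrightarrow> 0 < f x"
  using nrm_nonneg[of x] nrm_eq_0_iff[of x] by linarith

lemma nrm_1: "f 1 = 1"
  using nrm_mult[of 1 1] nrm_pos[of 1] by simp

lemma nrm_power: "f (x ^ k) = f x ^ k"
  by (induction k) (auto simp: nrm_1 nrm_mult)

lemma nrm_minus: "f (- x) = f x"
proof -
  have "f (- 1) ^ 2 = 1" by (metis nrm_power nrm_1 power2_minus power_one)
  then have "f (- 1) = 1" using nrm_nonneg[of "-1"] by (simp add: power2_eq_1_iff)
  then show ?thesis using nrm_mult[of "- 1" x] by simp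
qed

lemma nrm_minus_commute: "f (x - y) = f (y - x)"
  using nrm_minus[of "x - y"] by simp

lemma nrm_inverse: "f (inverse x) = inverse (f x)"
proof (cases "x = 0")
  case False
  then have "f x * f (inverse x) = 1" by (metis nrm_mult nrm_1 right_inverse)
  then show ?thesis by (metis inverse_unique)
qed (simp add: nrm_0)

lemma nrm_divide: "f (x / y) = f x / f y"
  by (simp add: divide_inverse nrm_mult nrm_inverse)

lemma nrm_add_le_2_max: "f (x + y) \<le> 2 * max (f x) (f y)"
proof -
  obtain A where "almost_metric_with f A" using f unfolding normalized_norm_def by blast
  then have "almost_metric_with f (artin_constant f)"
    by (intro almost_metric_with_artin_constant nrm_nonneg nrm_1)
  then have "f (x + y) \<le> artin_constant f * max (f x) (f y)"
    unfolding almost_metric_with_def by blast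
  also have "\<dots> \<le> 2 * max (f x) (f y)"
    using f nrm_nonneg unfolding normalized_norm_def by (intro mult_right_mono) (auto simp: le_max_iff_disj)
  finally show ?thesis .
qed

lemma nrm_sum_power2_le:
  assumes "\<And>i. f (g i) \<le> B"
  shows "f (\<Sum>i<(2::nat) ^ k. g i) \<le> 2 ^ k * B"
  using assms
proof (induction k arbitrary: g)
  case (Suc k g)
  have "(\<Sum>i<m + l. g i) = (\<Sum>i<m. g i) + (\<Sum>i<l. g (i + m))" for m l :: nat
  proof (induction l)
    case (Suc l)
    then show ?case by (simp add: add.assoc add.commute[of l m])
  qed simp
  from this[of "2 ^ k" "2 ^ k"]
  have "(\<Sum>i<2 ^ Suc k. g i) = (\<Sum>i<2 ^ k. g i) + (\<Sum>i<2 ^ k. g (i + 2 ^ k))"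
    by (simp add: mult_2)
  moreover have "f (\<Sum>i<2 ^ k. g i) \<le> 2 ^ k * B" "f (\<Sum>i<2 ^ k. g (i + 2 ^ k)) \<le> 2 ^ k * B"
    using Suc by auto
  ultimately show ?case
    using nrm_add_le_2_max[of "\<Sum>i<2 ^ k. g i" "\<Sum>i<2 ^ k. g (i + 2 ^ k)"] by (simp add: max_def split: if_splits)
qed simp

text \<open>
  Bisecting a sum of \<open>2\<^sup>k\<close> terms costs a factor \<open>2\<close> in each of \<open>k\<close> rounds. A sum of \<open>n\<close> terms is padded
  with zeros to the next power of two, which is less than \<open>2n\<close>.
\<close>
lemma nrm_sum_le_linear:
  assumes "\<And>i. i < n \<Longrightarrow> f (g i) \<le> B" "0 \<le> B"
  shows "f (\<Sum>i<n. g i) \<le> 2 * real n * B"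
proof (cases "n = 0")
  case False
  define k where "k = (LEAST k. n \<le> 2 ^ k)"
  have ex: "n \<le> 2 ^ n" by (simp add: less_imp_le)
  have k: "n \<le> 2 ^ k" unfolding k_def by (rule LeastI) (rule ex)
  have k2: "2 ^ k \<le> 2 * n"
  proof (cases k)
    case (Suc k')
    then have "\<not> n \<le> 2 ^ k'" using not_less_Least[of k' "\<lambda>k. n \<le> 2 ^ k"] unfolding k_def by simp
    then show ?thesis using Suc by simp
  qed (use False in auto)
  have "(\<Sum>i<n. g i) = (\<Sum>i<2 ^ k. if i < n then g i else 0)"
    using k by (intro sum.mono_neutral_cong_left) auto
  also have "f \<dots> \<le> 2 ^ k * B"
    using assms by (intro nrm_sum_power2_le) (auto simp: nrm_0)
  also have "\<dots> \<le> real (2 * n) * B"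
    using k2 assms(2) by (intro mult_right_mono) (metis of_nat_le_iff of_nat_numeral of_nat_power)+
  finally show ?thesis by simp
qed (simp add: nrm_0)

lemma nrm_of_nat_le: "f (of_nat n) \<le> 2 * real n"
  using nrm_sum_le_linear[of n "\<lambda>_. 1" 1] by (simp add: nrm_1)

text \<open>
  Ostrowski's comparison of two natural numbers: write \<open>x\<^sup>k\<close> in base \<open>y\<close>. There are about
  \<open>k ln x / ln y\<close> digits, and each digit and each power of \<open>y\<close> has controlled norm.
\<close>
lemma nrm_of_nat_le_powr:
  assumes x: "1 < x" and y: "1 < (y::nat)"
  shows "f (of_nat x) \<le> max 1 (f (of_nat y)) powr (ln x / ln y)"
proof -
  define G where "G = max 1 (f (of_nat y))"
  define L where "L = ln x / ln y"
  have L0: "0 < L" using x y by (simp add: L_def)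
  have G1: "1 \<le> G" by (simp add: G_def)
  have digits: "f (of_nat N) \<le> 2 * real r * (2 * real y * G ^ (r - 1))" if "N < y ^ r" for N r
  proof -
    have "(\<Sum>i<r. (N div y ^ i mod y) * y ^ i) = N mod y ^ r" for r
    proof (induction r)
      case (Suc r)
      have "N mod y ^ Suc r = y ^ r * (N div y ^ r mod y) + N mod y ^ r"
        unfolding power_Suc2 by (rule mod_mult2_eq)
      with Suc show ?case by simp
    qed simp
    then have "(of_nat N :: 'k) = of_nat (\<Sum>i<r. (N div y ^ i mod y) * y ^ i)"
      using that by simp
    also have "\<dots> = (\<Sum>i<r. of_nat (N div y ^ i mod y) * of_nat y ^ i)" by simp
    also have "f \<dots> \<le> 2 * real r * (2 * real y * G ^ (r - 1))"
    proof (rule nrm_sum_le_linear)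
      fix i assume i: "i < r"
      have "f (of_nat (N div y ^ i mod y) * of_nat y ^ i) = f (of_nat (N div y ^ i mod y)) * f (of_nat y) ^ i"
        by (simp add: nrm_mult nrm_power)
      also have "\<dots> \<le> (2 * real y) * G ^ (r - 1)"
      proof (rule mult_mono)
        have "N div y ^ i mod y \<le> y" using y by (simp add: less_imp_le)
        then show "f (of_nat (N div y ^ i mod y)) \<le> 2 * real y"
          using nrm_of_nat_le[of "N div y ^ i mod y"] by linarith
        have "f (of_nat y) ^ i \<le> G ^ i" by (intro power_mono nrm_nonneg) (simp add: G_def)
        also have "\<dots> \<le> G ^ (r - 1)" using i G1 by (intro power_increasing) auto
        finally show "f (of_nat y) ^ i \<le> G ^ (r - 1)" .
      qed (auto simp: nrm_nonneg)
      finally show "f (of_nat (N div y ^ i mod y) * of_nat y ^ i) \<le> (2 * real y) * G ^ (r - 1)" .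
    qed (use G1 in auto)
    finally show ?thesis .
  qed
  have "f (of_nat x) \<le> G powr L"
  proof (rule le_of_power_le_linear_mult_power)
    fix k :: nat
    define r where "r = nat \<lfloor>real k * L\<rfloor>"
    have r: "real r \<le> real k * L" "real k * L < real r + 1"
      using L0 unfolding r_def by auto
    have "real k * ln x < (real r + 1) * ln y"
      using r(2) y by (simp add: L_def field_simps)
    then have "ln (real x ^ k) < ln (real y ^ (r + 1))"
      by (simp only: ln_realpow of_nat_add of_nat_1)
    then have "real x ^ k < real y ^ (r + 1)" using x y by (subst (asm) ln_less_cancel_iff) auto
    then have "x ^ k < y ^ (r + 1)" by (metis of_nat_less_iff of_nat_power)
    from digits[OF this] have "f (of_nat x) ^ k \<le> 2 * real (r + 1) * (2 * real y * G ^ r)"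
      by (simp add: nrm_power)
    also have "\<dots> = 4 * real y * (real r + 1) * G powr (real r)"
      using G1 by (simp add: powr_realpow)
    also have "\<dots> \<le> 4 * real y * ((L + 1) * (real k + 1)) * G powr (real k * L)"
    proof (intro mult_mono powr_mono)
      show "real r + 1 \<le> (L + 1) * (real k + 1)" using r(1) L0 by (simp add: algebra_simps)
    qed (use r G1 L0 in auto)
    also have "G powr (real k * L) = (G powr L) ^ k"
      using G1 by (simp add: powr_realpow[symmetric] powr_powr mult.commute)
    finally show "f (of_nat x) ^ k \<le> (4 * real y * (L + 1)) * (real k + 1) * (G powr L) ^ k"
      by (simp add: mult.assoc)
  qed (auto simp: nrm_nonneg)
  then show ?thesis by (simp add: G_def L_def)
qed

text \<open>
  If some natural number has norm greater than \<open>1\<close>, then by the comparison all of \<open>2, 3, \<dots>\<close> do, and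
  comparing in both directions shows that \<open>ln |n| / ln n\<close> is a constant \<open>\<sigma>\<close>. The normalization enters
  as \<open>|2| \<le> 2\<close>, which is \<open>\<sigma> \<le> 1\<close>.
\<close>
lemma nrm_of_nat_dichotomy:
  "(\<forall>n. f (of_nat n) \<le> 1) \<or> (\<exists>\<sigma>. 0 < \<sigma> \<and> \<sigma> \<le> 1 \<and> (\<forall>n. f (of_nat n) = real n powr \<sigma>))"
proof (rule disjCI)
  assume "\<not> (\<exists>\<sigma>. 0 < \<sigma> \<and> \<sigma> \<le> 1 \<and> (\<forall>n. f (of_nat n) = real n powr \<sigma>))"
  then have no: "\<And>\<sigma>. 0 < \<sigma> \<Longrightarrow> \<sigma> \<le> 1 \<Longrightarrow> \<exists>n. f (of_nat n) \<noteq> real n powr \<sigma>" by blast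
  show "\<forall>n. f (of_nat n) \<le> 1"
  proof (rule ccontr)
    assume "\<not> (\<forall>n. f (of_nat n) \<le> 1)"
    then obtain N where N: "f (of_nat N) > 1" by (auto simp: not_le)
    have N1: "N > 1"
      using N by (cases "N = 0"; cases "N = 1") (auto simp: nrm_0 nrm_1)
    have gt1: "f (of_nat y) > 1" if "y > 1" for y
    proof (rule ccontr)
      assume "\<not> f (of_nat y) > 1"
      then have "max 1 (f (of_nat y)) = 1" by simp
      then show False using nrm_of_nat_le_powr[OF N1 that] N by simp
    qed
    have ln_le: "ln (f (of_nat x)) / ln x \<le> ln (f (of_nat y)) / ln y" if "x > 1" "y > 1" for x y
    proof -
      have "ln (f (of_nat x)) \<le> ln (f (of_nat y) powr (ln x / ln y))"
        using nrm_of_nat_le_powr[OF that] gt1[OF that(1)] gt1[OF that(2)] by (subst ln_le_cancel_iff) auto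
      also have "\<dots> = ln x / ln y * ln (f (of_nat y))" by (simp add: ln_powr)
      finally show ?thesis using that by (simp add: field_simps)
    qed
    define \<sigma> where "\<sigma> = ln (f (of_nat 2)) / ln 2"
    have eq: "ln (f (of_nat x)) = \<sigma> * ln x" if "x > 1" for x
      using ln_le[of x 2] ln_le[of 2 x] that by (simp add: \<sigma>_def field_simps)
    have "f (of_nat 2) \<le> 2"
      using nrm_add_le_2_max[of 1 1] by (simp add: nrm_1)
    then have "ln (f (of_nat 2)) \<le> ln 2" using gt1[of 2] by (subst ln_le_cancel_iff) auto
    then have "\<sigma> \<le> 1" by (simp add: \<sigma>_def)
    moreover have "0 < \<sigma>" using gt1[of 2] by (simp add: \<sigma>_def)
    moreover have "f (of_nat n) = real n powr \<sigma>" for n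
    proof -
      consider "n = 0" | "n = 1" | "n > 1" by linarith
      then show ?thesis
      proof cases
        case 3
        have "f (of_nat n) = exp (ln (f (of_nat n)))" using gt1[OF 3] by simp
        also have "\<dots> = real n powr \<sigma>" using eq[OF 3] 3 by (simp add: powr_def)
        finally show ?thesis .
      qed (use \<open>0 < \<sigma>\<close> in \<open>auto simp: nrm_0 nrm_1\<close>)
    qed
    ultimately show False using no by blast
  qed
qed

lemma nrm_binomial_le:
  assumes "\<And>n k. k \<le> n \<Longrightarrow> f (of_nat (n choose k)) * (f x ^ k * f y ^ (n - k)) \<le> B n" "\<And>n. 0 \<le> B n"
  shows "f (x + y) ^ n \<le> 2 * (real n + 1) * B n"
proof -
  have "f (x + y) ^ n = f (\<Sum>k<Suc n. of_nat (n choose k) * x ^ k * y ^ (n - k))"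
    by (simp only: nrm_power[symmetric] binomial_ring lessThan_Suc_atMost)
  also have "\<dots> \<le> 2 * real (Suc n) * B n"
    using assms by (intro nrm_sum_le_linear) (auto simp: nrm_mult nrm_power mult.assoc)
  finally show ?thesis by (simp add: add.commute)
qed

text \<open>
  In the binomial expansion of \<open>(x + y)\<^sup>n\<close> the coefficients have norm at most \<open>1\<close>, so every term is at
  most \<open>max(|x|,|y|)\<^sup>n\<close>.
\<close>
lemma ultrametric_if_bounded_on_nat:
  assumes "\<forall>n. f (of_nat n) \<le> 1"
  shows "f (x + y) \<le> max (f x) (f y)"
proof (rule le_of_power_le_linear_mult_power)
  fix n :: nat
  have "f (x + y) ^ n \<le> 2 * (real n + 1) * (max (f x) (f y)) ^ n"
  proof (rule nrm_binomial_le)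
    fix n k :: nat assume "k \<le> n"
    have "f (of_nat (n choose k)) * (f x ^ k * f y ^ (n - k))
        \<le> 1 * (max (f x) (f y) ^ k * max (f x) (f y) ^ (n - k))"
      using assms nrm_nonneg by (intro mult_mono power_mono) (auto simp: le_max_iff_disj)
    then show "f (of_nat (n choose k)) * (f x ^ k * f y ^ (n - k)) \<le> max (f x) (f y) ^ n"
      using \<open>k \<le> n\<close> by (simp add: power_add[symmetric])
  qed (use nrm_nonneg in \<open>auto simp: le_max_iff_disj\<close>)
  then show "f (x + y) ^ n \<le> 2 * (real n + 1) * (max (f x) (f y)) ^ n" .
qed (use nrm_nonneg in \<open>auto simp: le_max_iff_disj\<close>)

text \<open>
  With \<open>p = |x|\<^bsup>1/\<sigma>\<^esup>\<close> and \<open>q = |y|\<^bsup>1/\<sigma>\<^esup>\<close>, each term in the expansion of \<open>(x + y)\<^sup>n\<close> has norm equal to the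
  \<open>\<sigma>\<close>-th power of a term in the expansion of \<open>(p + q)\<^sup>n\<close>, because the binomial coefficients have norm
  \<open>C(n,k)\<^sup>\<sigma>\<close>.
\<close>
lemma root_triangle_if_powr_on_nat:
  assumes \<sigma>: "0 < \<sigma>" and nat: "\<forall>n. f (of_nat n) = real n powr \<sigma>"
  shows "f (x + y) powr (1 / \<sigma>) \<le> f x powr (1 / \<sigma>) + f y powr (1 / \<sigma>)"
proof -
  define p q where "p = f x powr (1 / \<sigma>)" and "q = f y powr (1 / \<sigma>)"
  have pq0: "0 \<le> p" "0 \<le> q" by (auto simp: p_def q_def)
  have fx: "f x = p powr \<sigma>" and fy: "f y = q powr \<sigma>"
    using \<sigma> nrm_nonneg by (auto simp: p_def q_def powr_powr)
  have powr_power: "(z powr \<sigma>) ^ k = (z ^ k) powr \<sigma>" if "0 \<le> z" for z :: real and k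
    using that by (induction k) (auto simp: powr_mult)
  have "f (x + y) \<le> (p + q) powr \<sigma>"
  proof (rule le_of_power_le_linear_mult_power)
    fix n :: nat
    have "f (x + y) ^ n \<le> 2 * (real n + 1) * ((p + q) ^ n) powr \<sigma>"
    proof (rule nrm_binomial_le)
      fix n k :: nat assume k: "k \<le> n"
      have "f (of_nat (n choose k)) * (f x ^ k * f y ^ (n - k))
          = (real (n choose k) * p ^ k * q ^ (n - k)) powr \<sigma>"
        using pq0 by (simp add: nat fx fy powr_power powr_mult)
      also have "\<dots> \<le> ((p + q) ^ n) powr \<sigma>"
      proof (rule powr_mono2)
        have "real (n choose k) * p ^ k * q ^ (n - k) \<le> (\<Sum>k\<le>n. real (n choose k) * p ^ k * q ^ (n - k))"
          using k pq0 by (intro member_le_sum) auto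
        then show "real (n choose k) * p ^ k * q ^ (n - k) \<le> (p + q) ^ n"
          by (simp add: binomial_ring)
      qed (use \<sigma> pq0 in auto)
      finally show "f (of_nat (n choose k)) * (f x ^ k * f y ^ (n - k)) \<le> ((p + q) ^ n) powr \<sigma>" .
    qed auto
    then show "f (x + y) ^ n \<le> 2 * (real n + 1) * ((p + q) powr \<sigma>) ^ n"
      using pq0 by (simp add: powr_power)
  qed (auto simp: nrm_nonneg)
  then have "f (x + y) powr (1 / \<sigma>) \<le> ((p + q) powr \<sigma>) powr (1 / \<sigma>)"
    using \<sigma> nrm_nonneg by (intro powr_mono2) auto
  then show ?thesis using \<sigma> pq0 by (simp add: powr_powr p_def q_def)
qed

lemma artin_constant_eq_1_if_ultrametric:
  assumes "\<And>x y. f (x + y) \<le> max (f x) (f y)"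
  shows "artin_constant f = 1"
  unfolding artin_constant_def
proof (rule Least_equality)
  show "almost_metric_with f 1" using assms by (simp add: almost_metric_with_def)
  fix A assume "almost_metric_with f A"
  then have "f (1 + 0) \<le> A * max (f 1) (f 0)" unfolding almost_metric_with_def by blast
  then show "1 \<le> A" by (simp add: nrm_1 nrm_0)
qed

lemma ultrametric_if_not_archimedean:
  assumes "\<not> archimedean_norm f"
  shows "f (x + y) \<le> max (f x) (f y)"
proof -
  obtain A where "almost_metric_with f A" using f unfolding normalized_norm_def by blast
  then have "almost_metric_with f (artin_constant f)"
    by (intro almost_metric_with_artin_constant nrm_nonneg nrm_1)
  then show ?thesis using assms by (simp add: archimedean_norm_def almost_metric_with_def)
qed

lemma archimedean_powr_on_nat:
  assumes "archimedean_norm f"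
  obtains \<sigma> where "0 < \<sigma>" "\<sigma> \<le> 1" "\<forall>n. f (of_nat n) = real n powr \<sigma>"
proof -
  have "\<not> (\<forall>n. f (of_nat n) \<le> 1)"
    using assms artin_constant_eq_1_if_ultrametric ultrametric_if_bounded_on_nat
    unfolding archimedean_norm_def by blast
  then show ?thesis using nrm_of_nat_dichotomy that by blast
qed

text \<open>
  The root satisfies the triangle inequality, and \<open>t \<mapsto> t\<^sup>\<sigma>\<close> is subadditive because \<open>\<sigma> \<le> 1\<close>.
\<close>
lemma nrm_triangle: "f (x + y) \<le> f x + f y"
proof (cases "archimedean_norm f")
  case True
  then obtain \<sigma> where \<sigma>: "0 < \<sigma>" "\<sigma> \<le> 1" and nat: "\<forall>n. f (of_nat n) = real n powr \<sigma>"
    by (rule archimedean_powr_on_nat)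
  define p q where "p = f x powr (1 / \<sigma>)" and "q = f y powr (1 / \<sigma>)"
  have pq0: "0 \<le> p" "0 \<le> q" by (auto simp: p_def q_def)
  have "f (x + y) = (f (x + y) powr (1 / \<sigma>)) powr \<sigma>"
    using \<sigma> nrm_nonneg by (simp add: powr_powr)
  also have "\<dots> \<le> (p + q) powr \<sigma>"
    using root_triangle_if_powr_on_nat[OF \<sigma>(1) nat, of x y] \<sigma>
    by (intro powr_mono2) (auto simp: p_def q_def)
  also have "\<dots> \<le> p powr \<sigma> + q powr \<sigma>"
  proof (cases "p + q = 0")
    case False
    then have pos: "0 < p + q" using pq0 by linarith
    have *: "z powr \<sigma> \<ge> z" if "0 \<le> z" "z \<le> 1" for z :: real
      using that \<sigma> powr_mono'[of \<sigma> 1 z] by (cases "z = 0") auto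
    have "1 = p / (p + q) + q / (p + q)" using pos by (simp add: add_divide_distrib[symmetric])
    also have "\<dots> \<le> (p / (p + q)) powr \<sigma> + (q / (p + q)) powr \<sigma>"
      using pos pq0 by (intro add_mono *) auto
    also have "\<dots> = (p powr \<sigma> + q powr \<sigma>) / (p + q) powr \<sigma>"
      using pos pq0 by (simp add: powr_divide add_divide_distrib)
    finally show ?thesis using pos by (simp add: field_simps)
  qed (use \<sigma> pq0 in auto)
  also have "\<dots> = f x + f y" using \<sigma> nrm_nonneg by (simp add: p_def q_def powr_powr)
  finally show ?thesis .
next
  case False
  then show ?thesis using ultrametric_if_not_archimedean[OF False, of x y] nrm_nonneg[of x] nrm_nonneg[of y] by linarith
qed

lemma nrm_sum_le: "f (sum g A) \<le> (\<Sum>i\<in>A. f (g i))"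
proof (induction A rule: infinite_finite_induct)
  case (insert x A)
  then show ?case using nrm_triangle[of "g x" "sum g A"] by simp
qed (auto simp: nrm_0)

lemma nrm_diff_triangle: "f x - f y \<le> f (x - y)"
  using nrm_triangle[of "x - y" y] by simp

text \<open>
  The triangle inequality for \<open>|\<cdot>|\<^bsup>1/\<sigma>\<^esup>\<close> bounds a sum of three terms by \<open>3\<^sup>\<sigma>\<close> times their maximum, and
  \<open>3\<^sup>\<sigma>\<close> is \<open>|3|\<close>. This is better than the factor \<open>3\<close> that comes from the triangle inequality for \<open>|\<cdot>|\<close>
  itself, and it is the source of \<open>|3f|\<close> in the main result.
\<close>
lemma nrm_add3_le:
  assumes "archimedean_norm f" and "f x \<le> B" "f y \<le> B" "f z \<le> B"
  shows "f (x + y + z) \<le> f 3 * B"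
proof -
  obtain \<sigma> where \<sigma>: "0 < \<sigma>" "\<sigma> \<le> 1" and nat: "\<forall>n. f (of_nat n) = real n powr \<sigma>"
    using assms(1) by (rule archimedean_powr_on_nat)
  have B0: "0 \<le> B" using assms(2) nrm_nonneg[of x] by linarith
  have le: "f w powr (1 / \<sigma>) \<le> B powr (1 / \<sigma>)" if "f w \<le> B" for w
    using that \<sigma> nrm_nonneg by (intro powr_mono2) auto
  have "f (x + y + z) powr (1 / \<sigma>) \<le> 3 * B powr (1 / \<sigma>)"
    using root_triangle_if_powr_on_nat[OF \<sigma>(1) nat, of "x + y" z]
      root_triangle_if_powr_on_nat[OF \<sigma>(1) nat, of x y] le[of x] le[of y] le[of z] assms by linarith
  then have "(f (x + y + z) powr (1 / \<sigma>)) powr \<sigma> \<le> (3 * B powr (1 / \<sigma>)) powr \<sigma>"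
    using \<sigma> by (intro powr_mono2) auto
  moreover have "f 3 = 3 powr \<sigma>" using nat[rule_format, of 3] by simp
  ultimately show ?thesis using \<sigma> nrm_nonneg B0 by (simp add: powr_powr powr_mult)
qed

lemma ultrametric_sum_le:
  assumes "\<not> archimedean_norm f" "\<And>i. i \<in> A \<Longrightarrow> f (g i) \<le> B" "0 \<le> B"
  shows "f (sum g A) \<le> B"
  using assms(2)
proof (induction A rule: infinite_finite_induct)
  case (insert x A)
  then show ?case using ultrametric_if_not_archimedean[OF assms(1), of "g x" "sum g A"] by fastforce
qed (use assms(3) in \<open>auto simp: nrm_0\<close>)

text \<open>
  The value group contains the \<open>\<sigma>\<close>-th powers of all positive rationals.
\<close>
lemma closure_value_group_archimedean:
  assumes "archimedean_norm f"
  shows "{0<..} \<subseteq> closure (value_group f)"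
proof
  fix r :: real assume "r \<in> {0<..}"
  then have r: "0 < r" by simp
  obtain \<sigma> where \<sigma>: "0 < \<sigma>" "\<sigma> \<le> 1" and nat: "\<forall>n. f (of_nat n) = real n powr \<sigma>"
    using assms(1) by (rule archimedean_powr_on_nat)
  define t where "t = r powr (1 / \<sigma>)"
  have t: "0 < t" "t powr \<sigma> = r" using r \<sigma> by (auto simp: t_def powr_powr)
  define p where "p k = nat \<lceil>t * (real k + 1)\<rceil>" for k :: nat
  have p: "t * (real k + 1) \<le> real (p k)" "real (p k) < t * (real k + 1) + 1" for k
    using t by (auto simp: p_def of_nat_nat) linarith+
  have lim: "(\<lambda>k. real (p k) / (real k + 1)) \<longlonglongrightarrow> t"
  proof (rule tendsto_sandwich)
    show "\<forall>\<^sub>F k in sequentially. t \<le> real (p k) / (real k + 1)"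
      using p(1) by (auto simp: field_simps)
    show "\<forall>\<^sub>F k in sequentially. real (p k) / (real k + 1) \<le> t + 1 / real (Suc k)"
    proof (intro always_eventually allI)
      fix k show "real (p k) / (real k + 1) \<le> t + 1 / real (Suc k)"
      proof -
        have "real (p k) / (real k + 1) \<le> (t * (real k + 1) + 1) / (real k + 1)"
          using p(2)[of k] by (intro divide_right_mono) auto
        also have "\<dots> = t + 1 / real (Suc k)" by (simp add: add_divide_distrib add.commute)
        finally show ?thesis .
      qed
    qed
    show "(\<lambda>k. t + 1 / real (Suc k)) \<longlonglongrightarrow> t"
      using tendsto_add[OF tendsto_const LIMSEQ_Suc[OF lim_1_over_n]] by fastforce
  qed auto
  have "(\<lambda>k. (real (p k) / (real k + 1)) powr \<sigma>) \<longlonglongrightarrow> t powr \<sigma>"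
    by (intro tendsto_intros lim) (use t in auto)
  moreover have "(real (p k) / (real k + 1)) powr \<sigma> \<in> value_group f" for k
  proof -
    have "0 < t * (real k + 1)" using t by simp
    then have "0 < real (p k)" using p(1)[of k] by linarith
    then have "f (of_nat (p k) / of_nat (Suc k)) > 0"
      unfolding nrm_divide nat[rule_format] by simp
    then have "of_nat (p k) / of_nat (Suc k) \<noteq> (0::'k)" using nrm_0 by force
    moreover have "f (of_nat (p k) / of_nat (Suc k)) = (real (p k) / (real k + 1)) powr \<sigma>"
      unfolding nrm_divide nat[rule_format] by (simp add: powr_divide add.commute)
    ultimately show ?thesis unfolding value_group_def by (metis Diff_iff UNIV_I empty_iff imageI insert_iff)
  qed
  ultimately show "r \<in> closure (value_group f)" unfolding closure_sequential t(2)
    by (intro exI[of _ "\<lambda>k. (real (p k) / (real k + 1)) powr \<sigma>"]) blast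
qed

lemma not_archimedean_if_discrete_values:
  assumes q: "1 < q" and "value_group f \<subseteq> int_powers q"
  shows "\<not> archimedean_norm f"
proof
  assume "archimedean_norm f"
  then have "sqrt q \<in> closure (value_group f)"
    using closure_value_group_archimedean q by auto
  moreover have "1 < sqrt q" using q by simp
  then have "1 * sqrt q < sqrt q * sqrt q" by (intro mult_strict_right_mono) auto
  with \<open>1 < sqrt q\<close> have "1 < sqrt q" "sqrt q < sqrt q * sqrt q" by auto
  then have "open {1<..<q}" "sqrt q \<in> {1<..<q}" using q by auto
  ultimately obtain x where x: "x \<in> value_group f" "1 < x" "x < q"
    unfolding closure_iff_nhds_not_empty by (metis disjoint_iff greaterThanLessThan_iff order_refl)
  then obtain z :: int where z: "x = q powi z" using assms by (auto simp: int_powers_def)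
  have "z > 0"
  proof (rule ccontr)
    assume "\<not> z > 0"
    then have "q powi z \<le> q powi 0" using q by (intro power_int_increasing) auto
    then show False using x z by simp
  qed
  then have "q powi 1 \<le> q powi z" using q by (intro power_int_increasing) auto
  then show False using x z by simp
qed

end

section \<open>Weak approximation\<close>

definition trivial_norm :: "('k::field \<Rightarrow> real) \<Rightarrow> bool" where
  "trivial_norm f \<longleftrightarrow> (\<forall>x. x \<noteq> 0 \<longrightarrow> f x = 1)"

text \<open>
  For nontrivial norms, having the same open unit ball means being powers of each other; only the unit
  balls matter here.
\<close>
definition equivalent_norms :: "('k::field \<Rightarrow> real) \<Rightarrow> ('k \<Rightarrow> real) \<Rightarrow> bool" where
  "equivalent_norms f g \<longleftrightarrow> (\<forall>x. f x < 1 \<longleftrightarrow> g x < 1)"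

lemma equivalent_norms_refl: "equivalent_norms f f"
  by (simp add: equivalent_norms_def)

lemma equivalent_norms_sym: "equivalent_norms f g \<Longrightarrow> equivalent_norms g f"
  unfolding equivalent_norms_def by metis

lemma equivalent_norms_trans: "equivalent_norms f g \<Longrightarrow> equivalent_norms g h \<Longrightarrow> equivalent_norms f h"
  unfolding equivalent_norms_def by metis

lemma ex_norm_gt_1:
  assumes f: "normalized_norm f" and "\<not> trivial_norm f"
  shows "\<exists>x. f x > 1"
proof -
  obtain x where x: "x \<noteq> 0" "f x \<noteq> 1" using assms(2) by (auto simp: trivial_norm_def)
  then have "f x > 1 \<or> f (inverse x) > 1"
    using nrm_pos[OF f x(1)] by (auto simp: nrm_inverse[OF f] one_less_inverse_iff)
  then show ?thesis by blast
qed

text \<open>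
  If \<open>|\<alpha>|\<^sub>f < 1 \<le> |\<alpha>|\<^sub>g\<close>, take \<open>c\<close> with \<open>|c|\<^sub>g > 1\<close>. Then \<open>c\<alpha>\<^sup>k\<close> lies outside the unit ball of \<open>g\<close> for every
  \<open>k\<close>, hence outside that of \<open>f\<close>, although its norm \<open>|c|\<^sub>f |\<alpha>|\<^sub>f\<^sup>k\<close> tends to \<open>0\<close>. So an inclusion between
  unit balls is already an equality, and two inequivalent norms can be separated in either direction.
\<close>
lemma unit_ball_inclusion_converse:
  assumes f: "normalized_norm f" and g: "normalized_norm g" "\<not> trivial_norm g"
    and sub: "\<And>x. g x < 1 \<Longrightarrow> f x < 1" and \<alpha>: "f \<alpha> < 1"
  shows "g \<alpha> < 1"
proof (rule ccontr)
  assume "\<not> g \<alpha> < 1"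
  then have g\<alpha>: "1 \<le> g \<alpha>" by simp
  obtain c where c: "1 < g c" using ex_norm_gt_1[OF g] by blast
  have gt: "1 < f c * f \<alpha> ^ k" for k
  proof -
    have "1 * 1 < g c * g \<alpha> ^ k"
      by (rule mult_less_le_imp_less) (use c g\<alpha> in \<open>auto simp: one_le_power\<close>)
    then have "inverse (g c * g \<alpha> ^ k) < 1" by (simp only: inverse_less_1_iff) simp
    then have "g (inverse (c * \<alpha> ^ k)) < 1"
      by (simp only: nrm_inverse[OF g(1)] nrm_mult[OF g(1)] nrm_power[OF g(1)])
    from sub[OF this] have "inverse (f c * f \<alpha> ^ k) < 1"
      by (simp only: nrm_inverse[OF f] nrm_mult[OF f] nrm_power[OF f])
    moreover have "c \<noteq> 0" "\<alpha> \<noteq> 0" using c g\<alpha> nrm_0[OF g(1)] by auto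
    then have "0 < f c * f \<alpha> ^ k" using nrm_pos[OF f] by simp
    ultimately show ?thesis by (simp only: inverse_less_1_iff) simp
  qed
  have "(\<lambda>k. f c * f \<alpha> ^ k) \<longlonglongrightarrow> f c * 0"
    by (intro tendsto_intros LIMSEQ_power_zero) (use \<alpha> nrm_nonneg[OF f, of \<alpha>] in auto)
  then have "\<forall>\<^sub>F k in sequentially. f c * f \<alpha> ^ k < 1"
    by (intro order_tendstoD(2)) auto
  then obtain k where "f c * f \<alpha> ^ k < 1" by (auto simp: eventually_sequentially)
  with gt[of k] show False by simp
qed

lemma inequivalent_norms_separated:
  assumes f: "normalized_norm f" "\<not> trivial_norm f" and g: "normalized_norm g" "\<not> trivial_norm g"
    and ne: "\<not> equivalent_norms f g"
  shows "\<exists>y. 1 < f y \<and> g y < 1"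
proof -
  have "\<not> (\<forall>x. f x < 1 \<longrightarrow> g x < 1)" "\<not> (\<forall>x. g x < 1 \<longrightarrow> f x < 1)"
    using unit_ball_inclusion_converse[OF f(1) g] unit_ball_inclusion_converse[OF g(1) f] ne
    unfolding equivalent_norms_def by blast+
  then obtain \<alpha> \<beta> where ab: "f \<alpha> < 1" "1 \<le> g \<alpha>" "g \<beta> < 1" "1 \<le> f \<beta>" by (auto simp: not_less)
  then have "\<alpha> \<noteq> 0" using nrm_0[OF g(1)] by auto
  then have "0 < f \<alpha>" using nrm_pos[OF f(1)] by simp
  then have "1 < f (\<beta> / \<alpha>)" "g (\<beta> / \<alpha>) < 1"
    using ab by (auto simp: nrm_divide[OF f(1)] nrm_divide[OF g(1)] less_divide_eq divide_less_eq)
  then show ?thesis by blast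
qed

lemma tendsto_inverse_1_plus_power_small:
  assumes f: "normalized_norm f" and u: "f u < 1"
  shows "(\<lambda>k. f (1 / (1 + u ^ k) - 1)) \<longlonglongrightarrow> 0"
proof (rule tendsto_sandwich[where f = "\<lambda>_. 0"])
  have lim: "(\<lambda>k. f u ^ k) \<longlonglongrightarrow> 0"
    by (rule LIMSEQ_power_zero) (use u nrm_nonneg[OF f, of u] in auto)
  then have ev: "\<forall>\<^sub>F k in sequentially. f u ^ k < 1"
    by (intro order_tendstoD(2)) auto
  show "\<forall>\<^sub>F k in sequentially. f (1 / (1 + u ^ k) - 1) \<le> f u ^ k / (1 - f u ^ k)"
    using ev
  proof eventually_elim
    case (elim k)
    have ge: "1 - f u ^ k \<le> f (1 + u ^ k)"
      using nrm_diff_triangle[OF f, of 1 "- (u ^ k)"] by (simp add: nrm_1[OF f] nrm_minus[OF f] nrm_power[OF f])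
    then have "1 + u ^ k \<noteq> 0" using elim nrm_0[OF f] by auto
    then have "1 / (1 + u ^ k) - 1 = - (u ^ k / (1 + u ^ k))" by (simp add: field_simps)
    then have "f (1 / (1 + u ^ k) - 1) = f u ^ k / f (1 + u ^ k)"
      by (simp only: nrm_minus[OF f] nrm_divide[OF f] nrm_power[OF f])
    also have "\<dots> \<le> f u ^ k / (1 - f u ^ k)"
      using ge elim nrm_nonneg[OF f] by (intro divide_left_mono mult_pos_pos) auto
    finally show ?case .
  qed
  have "(\<lambda>k. f u ^ k / (1 - f u ^ k)) \<longlonglongrightarrow> 0 / (1 - 0)"
    by (intro tendsto_intros lim) auto
  then show "(\<lambda>k. f u ^ k / (1 - f u ^ k)) \<longlonglongrightarrow> 0" by simp
  show "\<forall>\<^sub>F k in sequentially. 0 \<le> f (1 / (1 + u ^ k) - 1)" by (simp add: nrm_nonneg[OF f])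
qed simp

lemma tendsto_inverse_1_plus_power_large:
  assumes f: "normalized_norm f" and u: "1 < f u"
  shows "(\<lambda>k. f (1 / (1 + u ^ k))) \<longlonglongrightarrow> 0"
proof -
  have u0: "u \<noteq> 0" using u nrm_0[OF f] by auto
  have "f (inverse u) < 1" using u by (simp add: nrm_inverse[OF f] inverse_less_1_iff)
  from tendsto_inverse_1_plus_power_small[OF f this]
  have lim: "(\<lambda>k. f (1 / (1 + inverse u ^ k) - 1)) \<longlonglongrightarrow> 0" .
  have "\<forall>\<^sub>F k in sequentially. 1 < f u ^ k"
    using u by (auto simp: eventually_sequentially intro!: exI[of _ 1] one_less_power)
  then have "\<forall>\<^sub>F k in sequentially. f (1 / (1 + inverse u ^ k) - 1) = f (1 / (1 + u ^ k))"
  proof eventually_elim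
    case (elim k)
    have "u ^ k \<noteq> - 1"
      using elim nrm_power[OF f, of u k] nrm_minus[OF f, of 1] nrm_1[OF f] by auto
    then have "1 + u ^ k \<noteq> 0" by (metis add.commute add_eq_0_iff)
    moreover from this u0 have "1 + inverse u ^ k \<noteq> 0"
      by (simp add: power_inverse field_simps)
    ultimately have "1 / (1 + inverse u ^ k) - 1 = - (1 / (1 + u ^ k))"
      using u0 by (simp add: power_inverse field_simps)
    then show ?case by (simp only: nrm_minus[OF f])
  qed
  from Lim_transform_eventually[OF lim this] show ?thesis .
qed

lemma tendsto_norm_1:
  assumes f: "normalized_norm f" and lim: "(\<lambda>k. f (h k - 1)) \<longlonglongrightarrow> 0"
  shows "(\<lambda>k. f (h k)) \<longlonglongrightarrow> 1"
proof (rule LIM_zero_cancel, rule Lim_null_comparison[OF _ lim], intro always_eventually allI)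
  fix k
  show "Real_Vector_Spaces.norm (f (h k) - 1) \<le> f (h k - 1)"
    using nrm_diff_triangle[OF f, of "h k" 1] nrm_diff_triangle[OF f, of 1 "h k"] nrm_minus_commute[OF f, of 1 "h k"]
    by (simp add: nrm_1[OF f] abs_le_iff)
qed

text \<open>
  Induction on the set of norms. An element \<open>x\<close> that works for \<open>Q\<close> and an element \<open>y\<close> that works for the
  new norm \<open>g\<close> are combined to \<open>x\<^sup>ky\<close> if \<open>|x|\<^sub>g \<le> 1\<close>; otherwise to \<open>y/(1 + x\<^bsup>-k\<^esup>)\<close>, where the denominator
  tends to \<open>1\<close> at \<open>f\<close> and \<open>g\<close> and to infinity on \<open>Q\<close>.
\<close>
lemma inequivalent_norms_separated_finite:
  assumes f: "normalized_norm f" "\<not> trivial_norm f" and "finite Q"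
    and "\<And>g. g \<in> Q \<Longrightarrow> normalized_norm g \<and> \<not> trivial_norm g \<and> \<not> equivalent_norms f g"
  shows "\<exists>y. 1 < f y \<and> (\<forall>g\<in>Q. g y < 1)"
  using assms(3,4)
proof (induction Q rule: finite_induct)
  case empty
  then show ?case using ex_norm_gt_1[OF f] by auto
next
  case (insert g Q)
  then have g: "normalized_norm g" "\<not> trivial_norm g" "\<not> equivalent_norms f g"
    and Q: "\<And>h. h \<in> Q \<Longrightarrow> normalized_norm h" by auto
  obtain x where x: "1 < f x" "\<forall>h\<in>Q. h x < 1" using insert by auto
  obtain y where y: "1 < f y" "g y < 1" using inequivalent_norms_separated[OF f g(1,2) g(3)] by blast
  show ?case
  proof (cases "g x \<le> 1")
    case True
    have "(\<lambda>k. h (x ^ k * y)) \<longlonglongrightarrow> 0 * h y" if "h \<in> Q" for h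
      unfolding nrm_mult[OF Q[OF that]] nrm_power[OF Q[OF that]]
      by (intro tendsto_intros LIMSEQ_power_zero) (use x that nrm_nonneg[OF Q[OF that]] in auto)
    then have "\<forall>\<^sub>F k in sequentially. h (x ^ k * y) < 1" if "h \<in> Q" for h
      using that by (intro order_tendstoD(2)) auto
    then have "\<forall>\<^sub>F k in sequentially. \<forall>h\<in>Q. h (x ^ k * y) < 1"
      using insert.hyps by (intro eventually_ball_finite) auto
    then obtain k where k: "\<forall>h\<in>Q. h (x ^ k * y) < 1" by (auto simp: eventually_sequentially)
    have "1 * 1 < f y * f x ^ k"
      by (rule mult_less_le_imp_less) (use x y in \<open>auto intro: one_le_power\<close>)
    then have "1 < f (x ^ k * y)" by (simp add: nrm_mult[OF f(1)] nrm_power[OF f(1)] mult.commute)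
    moreover have "g x ^ k * g y \<le> 1 * g y"
      using True nrm_nonneg[OF g(1)] by (intro mult_right_mono power_le_one) auto
    then have "g (x ^ k * y) < 1" using y by (simp add: nrm_mult[OF g(1)] nrm_power[OF g(1)])
    ultimately show ?thesis using k by auto
  next
    case False
    define u where "u = inverse x"
    have x0: "x \<noteq> 0" using x nrm_0[OF f(1)] by auto
    define z where "z k = 1 / (1 + u ^ k) * y" for k
    have "(\<lambda>k. f (1 / (1 + u ^ k))) \<longlonglongrightarrow> 1"
      using x by (intro tendsto_norm_1 tendsto_inverse_1_plus_power_small f)
        (auto simp: u_def nrm_inverse[OF f(1)] inverse_less_1_iff)
    then have "(\<lambda>k. f (z k)) \<longlonglongrightarrow> 1 * f y"
      unfolding z_def nrm_mult[OF f(1)] by (intro tendsto_intros)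
    then have 1: "\<forall>\<^sub>F k in sequentially. 1 < f (z k)"
      using y by (intro order_tendstoD(1)) auto
    have "(\<lambda>k. g (1 / (1 + u ^ k))) \<longlonglongrightarrow> 1"
      using False by (intro tendsto_norm_1 tendsto_inverse_1_plus_power_small g)
        (auto simp: u_def nrm_inverse[OF g(1)] inverse_less_1_iff)
    then have "(\<lambda>k. g (z k)) \<longlonglongrightarrow> 1 * g y"
      unfolding z_def nrm_mult[OF g(1)] by (intro tendsto_intros)
    then have 2: "\<forall>\<^sub>F k in sequentially. g (z k) < 1"
      using y by (intro order_tendstoD(2)) auto
    have "\<forall>\<^sub>F k in sequentially. h (z k) < 1" if "h \<in> Q" for h
    proof (cases "u = 0 \<or> h u = 0")
      case True
      then show ?thesis using x0 nrm_eq_0_iff[OF Q[OF that]] by (auto simp: u_def)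
    next
      case False
      then have "0 < h x" "h x < 1" using x that x0 nrm_pos[OF Q[OF that]] by auto
      then have "1 < h u" by (simp add: u_def nrm_inverse[OF Q[OF that]] one_less_inverse_iff)
      then have "(\<lambda>k. h (z k)) \<longlonglongrightarrow> 0 * h y"
        unfolding z_def nrm_mult[OF Q[OF that]]
        by (intro tendsto_intros tendsto_inverse_1_plus_power_large Q that)
      then show ?thesis by (intro order_tendstoD(2)) auto
    qed
    then have "\<forall>\<^sub>F k in sequentially. \<forall>h\<in>Q. h (z k) < 1"
      using insert.hyps by (intro eventually_ball_finite) auto
    with 1 2 have "\<forall>\<^sub>F k in sequentially. 1 < f (z k) \<and> (\<forall>h\<in>insert g Q. h (z k) < 1)"
      by eventually_elim auto
    then show ?thesis by (auto simp: eventually_sequentially)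
  qed
qed

lemma class_indicator_sequence:
  assumes F: "finite F" "\<And>g. g \<in> F \<Longrightarrow> normalized_norm g \<and> \<not> trivial_norm g" and f: "f \<in> F"
  shows "\<exists>h. \<forall>g\<in>F. (\<lambda>k. g (h k - (if equivalent_norms f g then 1 else 0))) \<longlonglongrightarrow> 0"
proof -
  have "\<exists>y. 1 < f y \<and> (\<forall>g\<in>{g \<in> F. \<not> equivalent_norms f g}. g y < 1)"
    using F f by (intro inequivalent_norms_separated_finite) auto
  then obtain y where y: "1 < f y" "\<And>g. g \<in> F \<Longrightarrow> \<not> equivalent_norms f g \<Longrightarrow> g y < 1" by auto
  have y0: "y \<noteq> 0" using y(1) nrm_0 F f by fastforce
  have "(\<lambda>k. g (1 / (1 + inverse y ^ k) - (if equivalent_norms f g then 1 else 0))) \<longlonglongrightarrow> 0" if g: "g \<in> F" for g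
  proof (cases "equivalent_norms f g")
    case True
    have "f (inverse y) < 1" using y F f by (simp add: nrm_inverse inverse_less_1_iff)
    then have "g (inverse y) < 1" using True by (simp add: equivalent_norms_def)
    then show ?thesis using True tendsto_inverse_1_plus_power_small F g by auto
  next
    case False
    then have "g y < 1" "0 < g y" using y(2)[OF g] y0 nrm_pos F g by auto
    then have "1 < g (inverse y)" using F g by (simp add: nrm_inverse one_less_inverse_iff)
    then show ?thesis using False tendsto_inverse_1_plus_power_large F g by auto
  qed
  then show ?thesis by (intro exI[of _ "\<lambda>k. 1 / (1 + inverse y ^ k)"] ballI)
qed

text \<open>
  Approximate indicators of the equivalence classes are multiplied by the targets and added up over a
  system of representatives. Equivalent norms must have the same target, since an element close to \<open>t\<close>
  for one of them is close to \<open>t\<close> for the other as well.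
\<close>
theorem weak_approximation:
  fixes t :: "('k::field \<Rightarrow> real) \<Rightarrow> 'k"
  assumes F: "finite F" "\<And>g. g \<in> F \<Longrightarrow> normalized_norm g \<and> \<not> trivial_norm g"
    and t: "\<And>f g. f \<in> F \<Longrightarrow> g \<in> F \<Longrightarrow> equivalent_norms f g \<Longrightarrow> t f = t g"
    and "0 < \<tau>"
  shows "\<exists>z. \<forall>g\<in>F. g (z - t g) < \<tau>"
proof -
  define r where "r g = (SOME f. f \<in> F \<and> equivalent_norms f g)" for g
  have r: "r g \<in> F \<and> equivalent_norms (r g) g" if "g \<in> F" for g
    unfolding r_def by (rule someI[of _ g]) (use that in \<open>auto simp: equivalent_norms_refl\<close>)
  have r_eq: "r f = r g" if "equivalent_norms f g" for f g
    unfolding r_def using that equivalent_norms_trans equivalent_norms_sym by metis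
  have "\<forall>f\<in>F. \<exists>h. \<forall>g\<in>F. (\<lambda>k. g (h k - (if equivalent_norms f g then 1 else 0))) \<longlonglongrightarrow> 0"
    using class_indicator_sequence[OF F] by blast
  then obtain h where h: "\<And>f g. f \<in> F \<Longrightarrow> g \<in> F \<Longrightarrow>
      (\<lambda>k. g (h f k - (if equivalent_norms f g then 1 else 0))) \<longlonglongrightarrow> 0" by metis
  define z where "z k = (\<Sum>p\<in>r ` F. h p k * t p)" for k
  have "\<forall>\<^sub>F k in sequentially. g (z k - t g) < \<tau>" if g: "g \<in> F" for g
  proof -
    have ng: "normalized_norm g" using F g by blast
    have eq_iff: "equivalent_norms p g \<longleftrightarrow> p = r g" if "p \<in> r ` F" for p
      using that r g r_eq by (metis imageE)
    have "t g = t (r g)" using t[of "r g" g] r g by simp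
    also have "\<dots> = (\<Sum>p\<in>r ` F. (if p = r g then 1 else 0) * t p)"
      using F(1) g by (simp add: if_distrib[of "\<lambda>c. c * _"] sum.delta cong: if_cong)
    also have "\<dots> = (\<Sum>p\<in>r ` F. (if equivalent_norms p g then 1 else 0) * t p)"
      using eq_iff by (intro sum.cong) auto
    finally have diff: "z k - t g = (\<Sum>p\<in>r ` F. (h p k - (if equivalent_norms p g then 1 else 0)) * t p)" for k
      by (simp add: z_def sum_subtractf[symmetric] algebra_simps)
    have "(\<lambda>k. \<Sum>p\<in>r ` F. g (h p k - (if equivalent_norms p g then 1 else 0)) * g (t p)) \<longlonglongrightarrow> (\<Sum>p\<in>r ` F. 0 * g (t p))"
      by (intro tendsto_intros h g) (use r in auto)
    then have "\<forall>\<^sub>F k in sequentially. (\<Sum>p\<in>r ` F. g (h p k - (if equivalent_norms p g then 1 else 0)) * g (t p)) < \<tau>"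
      by (intro order_tendstoD(2)) (use \<open>0 < \<tau>\<close> in auto)
    then show ?thesis
    proof eventually_elim
      case (elim k)
      then show ?case unfolding diff
        using nrm_sum_le[OF ng, of "\<lambda>p. (h p k - (if equivalent_norms p g then 1 else 0)) * t p" "r ` F"]
        by (simp add: nrm_mult[OF ng])
    qed
  qed
  then have "\<forall>\<^sub>F k in sequentially. \<forall>g\<in>F. g (z k - t g) < \<tau>"
    using F(1) by (intro eventually_ball_finite) auto
  then show ?thesis by (auto simp: eventually_sequentially)
qed

text \<open>
  Taking the least index makes the choice depend only on how \<open>f\<close> orders the coordinates. Therefore
  equivalent norms have the same pivot.
\<close>
definition pivot :: "nat \<Rightarrow> (nat \<Rightarrow> 'k) \<Rightarrow> ('k::field \<Rightarrow> real) \<Rightarrow> nat" where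
  "pivot n a f = (LEAST k. k < n \<and> (\<forall>i<n. f (a i) \<le> f (a k)))"

lemma pivot:
  assumes "0 < n"
  shows "pivot n a f < n" "i < n \<Longrightarrow> f (a i) \<le> f (a (pivot n a f))"
proof -
  have "finite ((\<lambda>i. f (a i)) ` {..<n})" "(\<lambda>i. f (a i)) ` {..<n} \<noteq> {}" using assms by auto
  then obtain k where k: "k < n" "Max ((\<lambda>i. f (a i)) ` {..<n}) = f (a k)"
    using Max_in by (metis (no_types, lifting) imageE lessThan_iff)
  then have "\<forall>i<n. f (a i) \<le> f (a k)" by (auto simp: k(2)[symmetric])
  with k(1) have "\<exists>k<n. \<forall>i<n. f (a i) \<le> f (a k)" by blast
  then have "pivot n a f < n \<and> (\<forall>i<n. f (a i) \<le> f (a (pivot n a f)))"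
    unfolding pivot_def by (rule LeastI_ex)
  then show "pivot n a f < n" "i < n \<Longrightarrow> f (a i) \<le> f (a (pivot n a f))" by auto
qed

lemma equivalent_norms_le_iff:
  assumes "normalized_norm f" "normalized_norm g" "equivalent_norms f g"
  shows "f x \<le> f y \<longleftrightarrow> g x \<le> g y"
proof (cases "x = 0 \<or> y = 0")
  case True
  have "h x \<le> h y \<longleftrightarrow> x = 0" if h: "normalized_norm h" for h
    using True nrm_0[OF h] nrm_nonneg[OF h, of x] nrm_nonneg[OF h, of y] nrm_eq_0_iff[OF h, of x]
    by (cases "x = 0") auto
  from this[OF assms(1)] this[OF assms(2)] show ?thesis by simp
next
  case False
  then have pos: "0 < f x" "0 < g x" using assms nrm_pos by auto
  have "f x \<le> f y \<longleftrightarrow> \<not> f (y / x) < 1" using pos assms by (simp add: nrm_divide not_less)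
  also have "\<dots> \<longleftrightarrow> \<not> g (y / x) < 1" using assms by (simp add: equivalent_norms_def)
  also have "\<dots> \<longleftrightarrow> g x \<le> g y" using pos assms by (simp add: nrm_divide not_less)
  finally show ?thesis .
qed

lemma pivot_cong:
  assumes "normalized_norm f" "normalized_norm g" "equivalent_norms f g"
  shows "pivot n a f = pivot n a g"
  unfolding pivot_def using equivalent_norms_le_iff[OF assms] by simp

text \<open>
  Weak approximation of the indicator of the pivot, coordinate by coordinate. The coordinate \<open>i0\<close> absorbs
  the error in the sum, since an exact partition of unity is needed to get determinant exactly \<open>1\<close> below.
\<close>
lemma approximate_pivot_indicators:
  fixes a :: "nat \<Rightarrow> 'k::field"
  assumes F: "finite F" "\<And>g. g \<in> F \<Longrightarrow> normalized_norm g \<and> \<not> trivial_norm g"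
    and a: "i0 < n" "a i0 \<noteq> 0" and "0 < \<tau>"
  shows "\<exists>\<theta>. (\<Sum>i<n. \<theta> i) = 1 \<and> (\<forall>i<n. a i = 0 \<longrightarrow> \<theta> i = 0) \<and>
    (\<forall>f\<in>F. \<forall>i<n. f (\<theta> i - (if i = pivot n a f then 1 else 0)) < \<tau>)"
proof -
  define t where "t i f = (if i = pivot n a f then 1 else 0 :: 'k)" for i f
  have t_cong: "t i f = t i g" if "f \<in> F" "g \<in> F" "equivalent_norms f g" for i f g
    using pivot_cong[OF _ _ that(3), of n a] that F(2) by (simp add: t_def)
  have "\<exists>z. \<forall>g\<in>F. g (z - t i g) < \<tau> / real n" for i
    by (rule weak_approximation[OF F, of "t i"]) (use a \<open>0 < \<tau>\<close> t_cong in auto)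
  then have "\<forall>i. \<exists>z. \<forall>g\<in>F. g (z - t i g) < \<tau> / real n" by blast
  from choice[OF this] obtain z where z: "\<And>i g. g \<in> F \<Longrightarrow> g (z i - t i g) < \<tau> / real n" by blast
  have n: "0 < n" using a by simp
  have tn: "\<tau> / real n \<le> \<tau>" using n \<open>0 < \<tau>\<close> by (simp add: divide_le_eq)
  define S where "S = {i. i < n \<and> i \<noteq> i0 \<and> a i \<noteq> 0}"
  define \<theta> where "\<theta> i = (if i = i0 then 1 - (\<Sum>i\<in>S. z i) else if a i = 0 then 0 else z i)" for i
  have S: "finite S" "S \<subseteq> {..<n} - {i0}" by (auto simp: S_def)
  have sum: "(\<Sum>i<n. \<theta> i) = 1"
  proof -
    have "(\<Sum>i<n. \<theta> i) = \<theta> i0 + (\<Sum>i\<in>{..<n} - {i0}. \<theta> i)"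
      using a by (intro sum.remove) auto
    also have "(\<Sum>i\<in>{..<n} - {i0}. \<theta> i) = (\<Sum>i\<in>S. z i)"
      by (intro sum.mono_neutral_cong_right) (auto simp: S_def \<theta>_def)
    finally show ?thesis by (simp add: \<theta>_def)
  qed
  have pivot_nz: "a (pivot n a f) \<noteq> 0" if "f \<in> F" for f
  proof
    assume "a (pivot n a f) = 0"
    then have "f (a i0) \<le> 0" using pivot(2)[OF n a(1), of f a] that F nrm_0[of f] by simp
    then show False using nrm_pos[of f "a i0"] that F a by simp
  qed
  have "f (\<theta> i - t i f) < \<tau>" if f: "f \<in> F" and i: "i < n" for f i
  proof -
    have nf: "normalized_norm f" using f F by blast
    consider "i = i0" | "i \<noteq> i0" "a i = 0" | "i \<noteq> i0" "a i \<noteq> 0" by blast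
    then show ?thesis
    proof cases
      case 1
      have "1 = (\<Sum>i<n. t i f)" using pivot(1)[OF n, of a f] by (simp add: t_def)
      also have "\<dots> = t i0 f + (\<Sum>i\<in>{..<n} - {i0}. t i f)"
        using a by (intro sum.remove) auto
      also have "(\<Sum>i\<in>{..<n} - {i0}. t i f) = (\<Sum>i\<in>S. t i f)"
        using pivot_nz[OF f] by (intro sum.mono_neutral_cong_right) (auto simp: S_def t_def)
      finally have "\<theta> i - t i f = - (\<Sum>i\<in>S. z i - t i f)"
        using 1 by (simp add: \<theta>_def sum_subtractf algebra_simps)
      then have "f (\<theta> i - t i f) \<le> (\<Sum>i\<in>S. f (z i - t i f))"
        by (simp only: nrm_minus[OF nf] nrm_sum_le[OF nf])
      also have "\<dots> \<le> (\<Sum>i\<in>S. \<tau> / real n)"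
        using z[OF f] by (intro sum_mono) (auto intro: less_imp_le)
      also have "\<dots> = real (card S) * (\<tau> / real n)" by simp
      also have "card S < n"
      proof -
        have "card S \<le> card ({..<n} - {i0})" using S by (intro card_mono) auto
        also have "\<dots> < n" using a by simp
        finally show ?thesis .
      qed
      then have "real (card S) * (\<tau> / real n) < real n * (\<tau> / real n)"
        using n \<open>0 < \<tau>\<close> by (intro mult_strict_right_mono) auto
      finally show ?thesis using n by simp
    next
      case 2
      then have "t i f = 0" using pivot_nz[OF f] by (auto simp: t_def)
      with 2 show ?thesis using \<open>0 < \<tau>\<close> by (simp add: \<theta>_def nrm_0[OF nf])
    next
      case 3
      then show ?thesis using z[OF f, of i] tn by (simp add: \<theta>_def)
    qed
  qed
  moreover have "\<forall>i<n. a i = 0 \<longrightarrow> \<theta> i = 0" using a by (auto simp: \<theta>_def)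
  ultimately show ?thesis using sum unfolding t_def by blast
qed

section \<open>Norms of ring elements and the standard lattice\<close>

lemma dedekind_subring:
  assumes "normed_dedekind_domain R N"
  shows "subring R (class_ring :: 'k::field ring)"
  using assms unfolding normed_dedekind_domain_def dedekind_domain_def by blast

lemma subring_class_ring_closed:
  assumes "subring R (class_ring :: 'k::field ring)"
  shows "0 \<in> R" "1 \<in> R" "\<And>x. x \<in> R \<Longrightarrow> - x \<in> R"
    "\<And>x y. x \<in> R \<Longrightarrow> y \<in> R \<Longrightarrow> x * y \<in> R" "\<And>x y. x \<in> R \<Longrightarrow> y \<in> R \<Longrightarrow> x + y \<in> R"
    "\<And>x y. x \<in> R \<Longrightarrow> y \<in> R \<Longrightarrow> x - y \<in> R"
    "\<And>(g :: 'i \<Rightarrow> 'k) A. (\<And>i. i \<in> A \<Longrightarrow> g i \<in> R) \<Longrightarrow> sum g A \<in> R"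
proof -
  have neg: "\<ominus>\<^bsub>class_ring\<^esub> x = - x" for x :: 'k
    by (simp add: class_ring_simps)
  note E = subringE[OF assms, unfolded class_ring_simps]
  show 0: "0 \<in> R" and "1 \<in> R" using E by auto
  show m: "- x \<in> R" if "x \<in> R" for x using subringE(5)[OF assms that] by (simp add: neg)
  show "x * y \<in> R" if "x \<in> R" "y \<in> R" for x y using E(6) that by auto
  show a: "x + y \<in> R" if "x \<in> R" "y \<in> R" for x y using E(7) that by auto
  show "x - y \<in> R" if "x \<in> R" "y \<in> R" for x y using a[OF that(1) m[OF that(2)]] by simp
  show "sum g A \<in> R" if "\<And>i. i \<in> A \<Longrightarrow> g i \<in> R" for g :: "'i \<Rightarrow> 'k" and A
    using that by (induction A rule: infinite_finite_induct) (auto intro: 0 a)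
qed

lemma cring_ring_on:
  assumes "subring R (class_ring :: 'k::field ring)"
  shows "cring (ring_on R)"
proof -
  have cr: "cring (class_ring :: 'k ring)"
    using class_field[where 'a='k] by (simp add: Ring.field_def Ring.domain_def)
  show ?thesis
    using ring.subcring_iff[OF cring.axioms(1)[OF cr] subringE(1)[OF assms]] cring.subcringI'[OF cr assms] by simp
qed

lemma principal_ideal:
  assumes R: "subring R (class_ring :: 'k::field ring)" and "a \<in> R"
  shows "ideal ((*) a ` R) (ring_on R)"
proof -
  interpret c: cring "ring_on R" by (rule cring_ring_on[OF R])
  have "PIdl\<^bsub>ring_on R\<^esub> a = (*) a ` R"
    by (auto simp: cgenideal_def class_ring_simps mult.commute image_iff)
  then show ?thesis using c.cgenideal_ideal[of a] \<open>a \<in> R\<close> by simp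
qed

lemma principal_ideal_prod:
  assumes R: "subring R (class_ring :: 'k::field ring)" and "a \<in> R" "b \<in> R"
  shows "(*) a ` R \<cdot>\<^bsub>ring_on R\<^esub> (*) b ` R = (*) (a * b) ` R"
proof
  note closed = subring_class_ring_closed[OF R]
  show "(*) a ` R \<cdot>\<^bsub>ring_on R\<^esub> (*) b ` R \<subseteq> (*) (a * b) ` R"
  proof
    fix x assume "x \<in> (*) a ` R \<cdot>\<^bsub>ring_on R\<^esub> (*) b ` R"
    then show "x \<in> (*) (a * b) ` R"
    proof (induction x rule: ideal_prod.induct)
      case (prod i j)
      then obtain r s where "r \<in> R" "s \<in> R" "i = a * r" "j = b * s" by auto
      then have "i \<otimes>\<^bsub>ring_on R\<^esub> j = (a * b) * (r * s)" "r * s \<in> R"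
        using closed by (auto simp: class_ring_simps)
      then show ?case by blast
    next
      case (sum s1 s2)
      then obtain r s where "r \<in> R" "s \<in> R" "s1 = a * b * r" "s2 = a * b * s" by auto
      then have "s1 \<oplus>\<^bsub>ring_on R\<^esub> s2 = (a * b) * (r + s)" "r + s \<in> R"
        using closed by (auto simp: class_ring_simps algebra_simps)
      then show ?case by blast
    qed
  qed
  show "(*) (a * b) ` R \<subseteq> (*) a ` R \<cdot>\<^bsub>ring_on R\<^esub> (*) b ` R"
  proof
    fix x assume "x \<in> (*) (a * b) ` R"
    then obtain r where r: "r \<in> R" "x = (a * 1) * (b * r)" by auto
    have "(a * 1) \<otimes>\<^bsub>ring_on R\<^esub> (b * r) \<in> (*) a ` R \<cdot>\<^bsub>ring_on R\<^esub> (*) b ` R"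
      by (rule ideal_prod.prod) (use r closed in blast)+
    then show "x \<in> (*) a ` R \<cdot>\<^bsub>ring_on R\<^esub> (*) b ` R" using r by (simp add: class_ring_simps)
  qed
qed

lemma principal_ideal_nonzero:
  assumes R: "subring R (class_ring :: 'k::field ring)" and "a \<in> R" "a \<noteq> 0"
  shows "(*) a ` R \<in> nonzero_ideals R"
proof -
  have "a * 1 \<in> (*) a ` R" using subring_class_ring_closed[OF R] by blast
  then have "(*) a ` R \<noteq> {0}" using assms by auto
  then show ?thesis using principal_ideal[OF R] assms by (simp add: nonzero_ideals_def)
qed

text \<open>
  On \<open>R\<close> the norm of an element is the given norm of the principal ideal, because ideal norms are
  multiplicative and the quotient that defines \<open>|xR|\<close> does not depend on the denominator.
\<close>
lemma elem_norm_ge_1: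
  assumes nd: "normed_dedekind_domain R N" and x: "x \<in> R" "x \<noteq> 0"
  shows "1 \<le> elem_norm R N x"
proof -
  note R = dedekind_subring[OF nd]
  note closed = subring_class_ring_closed[OF R]
  note ideals = principal_ideal_nonzero[OF R]
  have ge1: "1 \<le> N I" if "I \<in> nonzero_ideals R" for I
    using nd that unfolding normed_dedekind_domain_def by blast
  have quot: "N ((*) a ` (*) x ` R) / N ((*) a ` R) = N ((*) x ` R)" if "a \<in> R - {0}" for a
  proof -
    have "(*) a ` (*) x ` R = (*) (a * x) ` R" by (auto simp: image_image mult.assoc)
    also have "\<dots> = (*) a ` R \<cdot>\<^bsub>ring_on R\<^esub> (*) x ` R"
      using principal_ideal_prod[OF R] that x by auto
    also have "N \<dots> = N ((*) a ` R) * N ((*) x ` R)"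
      using nd ideals that x unfolding normed_dedekind_domain_def by auto
    finally show ?thesis using ge1[OF ideals[of a]] that by (auto simp: field_simps)
  qed
  have "frac_ideal_norm R N ((*) x ` R) = N ((*) x ` R)"
    unfolding frac_ideal_norm_def
  proof (rule the_equality)
    have "(*) 1 ` (*) x ` R \<subseteq> R" using closed x by auto
    then show "\<exists>a\<in>R - {0}. (*) a ` (*) x ` R \<subseteq> R \<and> N ((*) x ` R) = N ((*) a ` (*) x ` R) / N ((*) a ` R)"
      using quot[of 1] closed by (intro bexI[of _ 1]) auto
  qed (use quot in auto)
  then show ?thesis using ge1[OF ideals[OF x]] x by (simp add: elem_norm_def)
qed

lemma frac_ideal_norm_whole:
  assumes nd: "normed_dedekind_domain R N"
  shows "frac_ideal_norm R N R = 1"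
  unfolding frac_ideal_norm_def
proof (rule the_equality)
  note R = dedekind_subring[OF nd]
  note closed = subring_class_ring_closed[OF R]
  have "N ((*) a ` R) \<noteq> 0" if "a \<in> R - {0}" for a
    using principal_ideal_nonzero[OF R, of a] nd that unfolding normed_dedekind_domain_def by fastforce
  then have quot: "N ((*) a ` R) / N ((*) a ` R) = 1" if "a \<in> R - {0}" for a
    using that by auto
  show "\<exists>a\<in>R - {0}. (*) a ` R \<subseteq> R \<and> 1 = N ((*) a ` R) / N ((*) a ` R)"
    using quot[of 1] closed by (intro bexI[of _ 1]) auto
  show "v = 1" if "\<exists>a\<in>R - {0}. (*) a ` R \<subseteq> R \<and> v = N ((*) a ` R) / N ((*) a ` R)" for v
    using that quot by auto
qed

lemma has_covol_standard_lattice: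
  assumes nd: "normed_dedekind_domain R N"
  shows "has_covol R N n (vecs_over R n) 1"
  unfolding has_covol_def
proof (intro bexI exI conjI)
  note R = dedekind_subring[OF nd]
  note closed = subring_class_ring_closed[OF R]
  interpret c: cring "ring_on R" by (rule cring_ring_on[OF R])
  interpret ids: comm_monoid "ideals_set (ring_on R)" by (rule c.ideals_set_is_comm_monoid)
  show "1 \<in> R - {0}" using closed by auto
  have id: "(\<lambda>x. 1 \<cdot>\<^sub>v x) ` vecs_over R n = vecs_over R n"
    by (simp add: image_def)
  then show "(\<lambda>x. 1 \<cdot>\<^sub>v x) ` vecs_over R n \<subseteq> vecs_over R n" by simp
  show "1 = frac_ideal_norm R N ((*) (inverse 1 ^ n) ` R)"
    using frac_ideal_norm_whole[OF nd] by (simp add: image_def)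
  show "has_chi R n (vecs_over R n) ((\<lambda>x. 1 \<cdot>\<^sub>v x) ` vecs_over R n) R"
    unfolding has_chi_def id
  \<comment> \<open>The quotient of the standard lattice by itself is zero, an empty direct sum.\<close>
  proof (intro exI[of _ 0] exI[of _ "\<lambda>_. R"] exI[of _ "\<lambda>_. 0"] bexI[of _ "0\<^sub>m n 0"] conjI ballI allI impI)
    have zero: "0\<^sub>m n 0 *\<^sub>v c = 0\<^sub>v n" if "c \<in> vecs_over R 0" for c :: "'a vec"
      using that by (auto simp: vecs_over_def scalar_prod_def intro!: eq_vecI)
    have zero_in: "0\<^sub>v n \<in> vecs_over R n" using closed by (simp add: vecs_over_def)
    show "0\<^sub>m n 0 *\<^sub>v c \<in> vecs_over R n" if "c \<in> vecs_over R 0" for c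
      using zero[OF that] zero_in by simp
    show "0\<^sub>m n 0 *\<^sub>v c \<in> vecs_over R n \<longleftrightarrow> (\<forall>i<0. c $ i \<in> R [^]\<^bsub>ideals_set (ring_on R)\<^esub> (0::nat))"
      if "c \<in> vecs_over R 0" for c
      using zero[OF that] zero_in by simp
    show "\<exists>c\<in>vecs_over R 0. v - 0\<^sub>m n 0 *\<^sub>v c \<in> vecs_over R n" if "v \<in> vecs_over R n" for v
    proof (intro bexI)
      show 1: "0\<^sub>v 0 \<in> vecs_over R 0" by (simp add: vecs_over_def)
      have "v \<in> carrier_vec n" using that by (simp add: vecs_over_def)
      then show "v - 0\<^sub>m n 0 *\<^sub>v 0\<^sub>v 0 \<in> vecs_over R n" unfolding zero[OF 1] using that by simp
    qed
    show "R = finprod (ideals_set (ring_on R)) (\<lambda>i. R [^]\<^bsub>ideals_set (ring_on R)\<^esub> (0::nat)) {..<0::nat}"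
      by (simp only: lessThan_0 ids.finprod_empty) (simp add: ideals_set_def)

  qed auto
qed

lemma span_unit_vecs:
  assumes R: "subring R (class_ring :: 'k::field ring)"
  shows "LinearCombinations.module.span (ring_on R) (module_vec TYPE('k) n) (unit_vec n ` {..<n}) = vecs_over R n"
    and "Module.module (ring_on R) (module_vec TYPE('k) n)"
proof -
  note closed = subring_class_ring_closed[OF R]
  interpret V: vec_module "TYPE('k)" n .
  have ag: "abelian_group (module_vec TYPE('k) n)"
    using vec_module[of n, where 'a='k] by (simp add: Module.module_def)
  show mod: "Module.module (ring_on R) (module_vec TYPE('k) n)"
    by (rule moduleI[OF cring_ring_on[OF R] ag])
      (auto simp: class_ring_simps module_vec_simps add_smult_distrib_vec smult_add_distrib_vec smult_smult_assoc)
  let ?S = "unit_vec n ` {..<n} :: 'k vec set"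
  have S: "finite ?S" "?S \<subseteq> carrier_vec n" by auto
  have lin: "LinearCombinations.module.lincomb (module_vec TYPE('k) n) a ?S \<in> carrier_vec n \<and>
    (\<forall>i<n. LinearCombinations.module.lincomb (module_vec TYPE('k) n) a ?S $ i = a (unit_vec n i))" for a
  proof (intro conjI allI impI)
    have eq: "LinearCombinations.module.lincomb (module_vec TYPE('k) n) a ?S
        = finsum (module_vec TYPE('k) n) (\<lambda>v. a v \<cdot>\<^sub>v v) ?S"
      by (simp add: LinearCombinations.module.lincomb_def[OF mod] module_vec_simps)
    have f: "(\<lambda>v. a v \<cdot>\<^sub>v v) \<in> ?S \<rightarrow> carrier_vec n" by auto
    show "LinearCombinations.module.lincomb (module_vec TYPE('k) n) a ?S \<in> carrier_vec n"
      unfolding eq by (rule V.finsum_closed[OF f])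
    fix i assume i: "i < n"
    have inj: "inj_on (unit_vec n :: nat \<Rightarrow> 'k vec) {..<n}"
      by (rule inj_onI) (metis index_unit_vec(1) lessThan_iff zero_neq_one)
    have "LinearCombinations.module.lincomb (module_vec TYPE('k) n) a ?S $ i = (\<Sum>v\<in>?S. (a v \<cdot>\<^sub>v v) $ i)"
      unfolding eq by (rule V.finsum_index[OF i f S(2)])
    also have "\<dots> = (\<Sum>k<n. (a (unit_vec n k) \<cdot>\<^sub>v unit_vec n k) $ i)"
      by (simp add: sum.reindex[OF inj])
    also have "\<dots> = (\<Sum>k<n. if k = i then a (unit_vec n k) else 0)"
      using i by (intro sum.cong) (auto simp: index_unit_vec)
    also have "\<dots> = a (unit_vec n i)" using i by simp
    finally show "LinearCombinations.module.lincomb (module_vec TYPE('k) n) a ?S $ i = a (unit_vec n i)" .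
  qed
  have span: "LinearCombinations.module.span (ring_on R) (module_vec TYPE('k) n) ?S
      = {LinearCombinations.module.lincomb (module_vec TYPE('k) n) a ?S | a. a \<in> ?S \<rightarrow> R}"
    using LinearCombinations.module.finite_span[OF mod S(1)] S(2) by (simp add: module_vec_simps)
  show "LinearCombinations.module.span (ring_on R) (module_vec TYPE('k) n) ?S = vecs_over R n"
  proof
    show "LinearCombinations.module.span (ring_on R) (module_vec TYPE('k) n) ?S \<subseteq> vecs_over R n"
      unfolding span using lin by (auto simp: vecs_over_def)
    show "vecs_over R n \<subseteq> LinearCombinations.module.span (ring_on R) (module_vec TYPE('k) n) ?S"
    proof
      fix v assume v: "v \<in> vecs_over R n"
      define a where "a u = v \<bullet> u" for u
      have a: "a (unit_vec n i) = v $ i" if "i < n" for i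
        using v that by (auto simp: a_def vecs_over_def)
      have "v = LinearCombinations.module.lincomb (module_vec TYPE('k) n) a ?S"
        using lin[of a] v a by (intro eq_vecI) (auto simp: vecs_over_def)
      moreover have "a \<in> ?S \<rightarrow> R" using a v by (auto simp: vecs_over_def)
      ultimately show "v \<in> LinearCombinations.module.span (ring_on R) (module_vec TYPE('k) n) ?S"
        unfolding span by blast
    qed
  qed
qed

lemma is_lattice_standard:
  assumes R: "subring R (class_ring :: 'k::field ring)"
  shows "is_lattice R n (vecs_over R n)"
  unfolding is_lattice_def
proof (intro conjI exI[of _ "unit_vec n ` {..<n}"])
  show "vecs_over R n = LinearCombinations.module.span (ring_on R) (module_vec TYPE('k) n) (unit_vec n ` {..<n})"
    by (rule span_unit_vecs(1)[OF R, symmetric])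
  have "cring (class_ring :: 'k ring)"
    using class_field[where 'a='k] by (simp add: Ring.field_def Ring.domain_def)
  then have sub: "subring UNIV (class_ring :: 'k ring)"
    using ring.carrier_is_subring[OF cring.axioms(1)] by fastforce
  have whole: "ring_on UNIV = (class_ring :: 'k ring)" by simp
  note span_UNIV = span_unit_vecs[OF sub, unfolded whole]
  let ?span = "LinearCombinations.module.span class_ring (module_vec TYPE('k) n)"
  have "unit_vec n ` {..<n} \<subseteq> vecs_over R n"
    using subring_class_ring_closed[OF R] by (auto simp: vecs_over_def)
  then have "?span (unit_vec n ` {..<n}) \<subseteq> ?span (vecs_over R n)"
    by (rule LinearCombinations.module.span_is_monotone[OF span_UNIV(2)])
  moreover have "?span (vecs_over R n) \<subseteq> carrier_vec n"
    using LinearCombinations.module.span_is_subset2[OF span_UNIV(2), of "vecs_over R n"]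
    by (auto simp: module_vec_simps vecs_over_def)
  ultimately show "?span (vecs_over R n) = carrier_vec n"
    unfolding span_UNIV(1) by (auto simp: vecs_over_def)
qed auto

section \<open>One transvection for all norms\<close>

text \<open>
  The matrix \<open>I - v u\<^sup>T\<close>. It is a transvection in the usual sense if \<open>u\<^sup>Tv = 0\<close>.
\<close>
definition transvection :: "nat \<Rightarrow> (nat \<Rightarrow> 'k) \<Rightarrow> (nat \<Rightarrow> 'k) \<Rightarrow> 'k::field mat" where
  "transvection n v u = mat n n (\<lambda>(i, k). (if i = k then 1 else 0) - v i * u k)"

lemma transvection_carrier: "transvection n v u \<in> carrier_mat n n"
  by (simp add: transvection_def)

lemma transvection_mult_vec:
  assumes "x \<in> carrier_vec n" "i < n"
  shows "(transvection n v u *\<^sub>v x) $ i = x $ i - v i * (\<Sum>k<n. u k * x $ k)"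
proof -
  have "(transvection n v u *\<^sub>v x) $ i = (\<Sum>k<n. ((if i = k then 1 else 0) - v i * u k) * x $ k)"
    using assms by (simp add: transvection_def scalar_prod_def atLeast0LessThan)
  also have "\<dots> = (\<Sum>k<n. (if i = k then x $ k else 0)) - (\<Sum>k<n. v i * (u k * x $ k))"
    by (simp only: sum_subtractf[symmetric]) (auto intro!: sum.cong simp: algebra_simps)
  also have "\<dots> = x $ i - v i * (\<Sum>k<n. u k * x $ k)"
    using assms by (simp add: sum_distrib_left)
  finally show ?thesis .
qed

text \<open>
  Sylvester's determinant identity: the block matrix with rows \<open>(I, v)\<close> and \<open>(u\<^sup>T, 1)\<close> can be factored by
  eliminating its lower left block either by column operations or by row operations, which gives
  \<open>det(I - v u\<^sup>T) = 1 - u\<^sup>Tv\<close>.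
\<close>
lemma det_transvection:
  assumes "(\<Sum>k<n. u k * v k) = 0"
  shows "det (transvection n v u) = 1"
proof -
  define V U where "V = mat n 1 (\<lambda>(i, _). v i)" and "U = mat 1 n (\<lambda>(_, k). u k)"
  have carr: "V \<in> carrier_mat n 1" "U \<in> carrier_mat 1 n" by (auto simp: V_def U_def)
  have T: "transvection n v u \<in> carrier_mat n n" by (rule transvection_carrier)
  let ?W = "four_block_mat (1\<^sub>m n) (0\<^sub>m n 1) U (1\<^sub>m 1)"
  let ?X = "four_block_mat (transvection n v u) V (0\<^sub>m 1 n) (1\<^sub>m 1)"
  let ?Y = "four_block_mat (1\<^sub>m n) V (0\<^sub>m 1 n) (1\<^sub>m 1)"
  have UV: "U * V = 0\<^sub>m 1 1"
    using assms by (auto simp: U_def V_def scalar_prod_def atLeast0LessThan)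
  have TVU: "transvection n v u + V * U = 1\<^sub>m n"
    by (rule eq_matI) (auto simp: transvection_def U_def V_def scalar_prod_def)
  have W: "?W \<in> carrier_mat (n + 1) (n + 1)" and X: "?X \<in> carrier_mat (n + 1) (n + 1)"
    and Y: "?Y \<in> carrier_mat (n + 1) (n + 1)"
    using T carr by auto
  have "?X * ?W = four_block_mat (1\<^sub>m n) V U (1\<^sub>m 1)"
    by (subst mult_four_block_mat[OF T carr(1) zero_carrier_mat one_carrier_mat one_carrier_mat zero_carrier_mat carr(2) one_carrier_mat])
      (use T carr TVU in simp)
  also have "\<dots> = ?W * ?Y"
    by (subst mult_four_block_mat[OF one_carrier_mat zero_carrier_mat carr(2) one_carrier_mat one_carrier_mat carr(1) zero_carrier_mat one_carrier_mat])
      (use carr UV in simp)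
  finally have "det ?X * det ?W = det ?W * det ?Y"
    by (simp only: det_mult[OF X W, symmetric] det_mult[OF W Y, symmetric])
  moreover have "det ?W = det (1\<^sub>m n) * det (1\<^sub>m 1)"
    by (rule det_four_block_mat_upper_right_zero) (use carr in auto)
  moreover have "det ?X = det (transvection n v u) * det (1\<^sub>m 1)"
    by (rule det_four_block_mat_lower_left_zero) (use carr T in auto)
  moreover have "det ?Y = det (1\<^sub>m n) * det (1\<^sub>m 1)"
    by (rule det_four_block_mat_lower_left_zero) (use carr T in auto)
  ultimately show ?thesis by simp
qed

lemma invertible_mat_if_det_nonzero:
  fixes M :: "'k::field mat"
  assumes M: "M \<in> carrier_mat n n" and "det M \<noteq> 0"
  shows "invertible_mat M"
proof -
  have "M \<in> Units (ring_mat TYPE('k) n ())" using assms by (rule det_non_zero_imp_unit)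
  then obtain B where "B \<in> carrier_mat n n" "B * M = 1\<^sub>m n" "M * B = 1\<^sub>m n"
    unfolding Units_def ring_mat_def by auto
  then show ?thesis using M
    by (auto simp: invertible_mat_def inverts_mat_def intro!: exI[of _ B])
qed

text \<open>
  This is the norm computation behind the next lemma, for one norm with pivot \<open>k\<close>. There \<open>y\<close> is the image
  of \<open>x\<close> under the transvection, \<open>\<mu>\<close> is the multiple of \<open>a\<close> that is subtracted from \<open>x\<close>, and
  \<open>y\<^sub>i - \<mu>(\<theta>\<^sub>i + \<rho>)a\<^sub>i\<close> turns out to be \<open>x\<^sub>i - \<mu>a\<^sub>i\<close>. In the limit \<open>\<tau> \<rightarrow> 0\<close>, where \<open>\<theta>\<close> is the indicator of \<open>k\<close>
  and \<open>\<rho> = 0\<close>, the two bounds become \<open>B\<close> and \<open>\<epsilon>\<close> (or \<open>0\<close> for \<open>i = k\<close>).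
\<close>
lemma pivot_estimate:
  fixes f :: "'k::field \<Rightarrow> real" and a \<theta> y :: "nat \<Rightarrow> 'k"
  assumes f: "normalized_norm f" and k: "k < n" "a k \<noteq> 0" "\<And>i. i < n \<Longrightarrow> f (a i) \<le> f (a k)"
    and near: "\<And>i. i < n \<Longrightarrow> f (\<theta> i - (if i = k then 1 else 0)) < \<tau>" and \<tau>: "0 < \<tau>"
    and y: "\<And>i. i < n \<Longrightarrow> f (y i) \<le> (if i = k then B else \<epsilon>)" and B: "0 < B" "0 < \<epsilon>"
  defines "\<rho> \<equiv> (\<Sum>i<n. \<theta> i * (1 - \<theta> i))" and "\<mu> \<equiv> (\<Sum>i<n. \<theta> i / a i * y i)"
    and "W \<equiv> (\<Sum>i<n. \<epsilon> / f (a i))" and "\<alpha> \<equiv> f (a k)"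
  defines "L \<equiv> (1 + \<tau>) * B + \<tau> * W * \<alpha>" and "P \<equiv> real n * ((1 + \<tau>) * \<tau>)"
  shows "f \<mu> * \<alpha> \<le> L"
    and "i < n \<Longrightarrow> f (y i - \<mu> * (\<theta> i + \<rho>) * a i) \<le>
      (if i = k then B * (\<tau> * (2 + \<tau>)) + \<tau> * W * (1 + \<tau>) * \<alpha> + L * P else \<epsilon> + L * (\<tau> + P))"
proof -
  note nn = nrm_nonneg[OF f] and nm = nrm_mult[OF f] and nd = nrm_divide[OF f] and tri = nrm_triangle[OF f]
  have \<alpha>: "0 < \<alpha>" unfolding \<alpha>_def using k nrm_pos[OF f] by blast
  have W0: "0 \<le> W" unfolding W_def using B nn by (intro sum_nonneg) auto
  have \<theta>k: "f (1 - \<theta> k) < \<tau>" using near[OF k(1)] nrm_minus_commute[OF f, of "\<theta> k" 1] by simp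
  have "f (\<theta> k) \<le> f (\<theta> k - 1) + f 1" using tri[of "\<theta> k - 1" 1] by simp
  then have \<theta>k1: "f (\<theta> k) \<le> 1 + \<tau>" using near[OF k(1)] nrm_1[OF f] by simp
  have \<theta>i: "f (\<theta> i) < \<tau>" if "i < n" "i \<noteq> k" for i using near[OF that(1)] that by simp
  define \<kappa> where "\<kappa> = (\<Sum>i\<in>{..<n} - {k}. \<theta> i / a i * y i)"
  have \<mu>: "\<mu> = \<theta> k / a k * y k + \<kappa>"
    unfolding \<mu>_def \<kappa>_def using k by (intro sum.remove) auto
  have \<kappa>: "f \<kappa> \<le> \<tau> * W"
  proof -
    have "f \<kappa> \<le> (\<Sum>i\<in>{..<n} - {k}. f (\<theta> i / a i * y i))" unfolding \<kappa>_def by (rule nrm_sum_le[OF f])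
    also have "\<dots> \<le> (\<Sum>i\<in>{..<n} - {k}. \<tau> * (\<epsilon> / f (a i)))"
    proof (rule sum_mono)
      fix i assume i: "i \<in> {..<n} - {k}"
      have "f (\<theta> i / a i * y i) = f (\<theta> i) * (f (y i) / f (a i))" by (simp add: nm nd)
      also have "\<dots> \<le> \<tau> * (\<epsilon> / f (a i))"
        using i \<theta>i[of i] y[of i] nn \<tau> by (intro mult_mono divide_right_mono) auto
      finally show "f (\<theta> i / a i * y i) \<le> \<tau> * (\<epsilon> / f (a i))" .
    qed
    also have "\<dots> \<le> (\<Sum>i<n. \<tau> * (\<epsilon> / f (a i)))"
      using \<tau> B nn by (intro sum_mono2) auto
    finally show ?thesis by (simp add: W_def sum_distrib_left)
  qed
  have "f \<mu> \<le> f (\<theta> k / a k * y k) + f \<kappa>" unfolding \<mu> by (rule tri)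
  also have "f (\<theta> k / a k * y k) = f (\<theta> k) * f (y k) / \<alpha>" by (simp add: nm nd \<alpha>_def)
  also have "\<dots> \<le> (1 + \<tau>) * B / \<alpha>"
    using \<theta>k1 y[OF k(1)] nn \<alpha> \<tau> by (intro divide_right_mono mult_mono) auto
  finally have "f \<mu> \<le> (1 + \<tau>) * B / \<alpha> + \<tau> * W" using \<kappa> by simp
  then have "f \<mu> * \<alpha> \<le> ((1 + \<tau>) * B / \<alpha> + \<tau> * W) * \<alpha>" using \<alpha> by (intro mult_right_mono) auto
  also have "\<dots> = L" using \<alpha> by (simp add: L_def field_simps)
  finally show L: "f \<mu> * \<alpha> \<le> L" .
  have L0: "0 \<le> L" unfolding L_def using \<tau> B W0 \<alpha> by simp
  have P0: "0 \<le> P" unfolding P_def using \<tau> by simp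
  have \<rho>: "f \<rho> \<le> P"
  proof -
    have "f \<rho> \<le> (\<Sum>i<n. f (\<theta> i * (1 - \<theta> i)))" unfolding \<rho>_def by (rule nrm_sum_le[OF f])
    also have "\<dots> \<le> (\<Sum>i<n. (1 + \<tau>) * \<tau>)"
    proof (rule sum_mono)
      fix i assume i: "i \<in> {..<n}"
      show "f (\<theta> i * (1 - \<theta> i)) \<le> (1 + \<tau>) * \<tau>"
      proof (cases "i = k")
        case True
        then show ?thesis unfolding nm using \<theta>k \<theta>k1 nn \<tau> by (intro mult_mono) auto
      next
        case False
        have "f (1 - \<theta> i) \<le> 1 + f (\<theta> i)"
          using tri[of 1 "- \<theta> i"] by (simp add: nrm_1[OF f] nrm_minus[OF f])
        then have "f (1 - \<theta> i) * f (\<theta> i) \<le> (1 + \<tau>) * \<tau>"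
          using \<theta>i[of i] False i nn \<tau> by (intro mult_mono) auto
        then show ?thesis by (simp add: nm mult.commute)
      qed
    qed
    finally show ?thesis by (simp add: P_def)
  qed
  assume i: "i < n"
  have \<mu>a: "f (\<mu> * a i) \<le> L"
  proof -
    have "f \<mu> * f (a i) \<le> f \<mu> * \<alpha>" unfolding \<alpha>_def by (intro mult_left_mono k(3)[OF i] nn)
    with L show ?thesis by (simp add: nm)
  qed
  show "f (y i - \<mu> * (\<theta> i + \<rho>) * a i) \<le>
      (if i = k then B * (\<tau> * (2 + \<tau>)) + \<tau> * W * (1 + \<tau>) * \<alpha> + L * P else \<epsilon> + L * (\<tau> + P))"
  proof (cases "i = k")
    case False
    have "f (y i - \<mu> * (\<theta> i + \<rho>) * a i) \<le> f (y i) + f (\<mu> * a i) * f (\<theta> i + \<rho>)"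
      using tri[of "y i" "- (\<mu> * (\<theta> i + \<rho>) * a i)"] by (simp add: nrm_minus[OF f] nm mult_ac)
    also have "\<dots> \<le> \<epsilon> + L * (\<tau> + P)"
    proof (intro add_mono mult_mono \<mu>a L0 nn)
      show "f (\<theta> i + \<rho>) \<le> \<tau> + P" using tri[of "\<theta> i" \<rho>] \<theta>i[OF i False] \<rho> by linarith
    qed (use y[OF i] False in auto)
    finally show ?thesis using False by simp
  next
    case True
    have "y k - \<mu> * (\<theta> k + \<rho>) * a k = y k * ((1 - \<theta> k) * (1 + \<theta> k)) + (- (\<kappa> * \<theta> k * a k)) + (- (\<mu> * a k * \<rho>))"
      unfolding \<mu> using k by (simp add: field_simps)
    then have "f (y k - \<mu> * (\<theta> k + \<rho>) * a k) \<le> f (y k * ((1 - \<theta> k) * (1 + \<theta> k))) + f (\<kappa> * \<theta> k * a k) + f (\<mu> * a k * \<rho>)"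
      using tri[of "y k * ((1 - \<theta> k) * (1 + \<theta> k)) + (- (\<kappa> * \<theta> k * a k))" "- (\<mu> * a k * \<rho>)"]
        tri[of "y k * ((1 - \<theta> k) * (1 + \<theta> k))" "- (\<kappa> * \<theta> k * a k)"]
      by (simp only: nrm_minus[OF f]) 
    also have "\<dots> \<le> B * (\<tau> * (2 + \<tau>)) + \<tau> * W * (1 + \<tau>) * \<alpha> + L * P"
    proof (intro add_mono)
      have "f (1 + \<theta> k) \<le> 2 + \<tau>" using tri[of 1 "\<theta> k"] \<theta>k1 nrm_1[OF f] by simp
      then show "f (y k * ((1 - \<theta> k) * (1 + \<theta> k))) \<le> B * (\<tau> * (2 + \<tau>))"
        unfolding nm using y[OF k(1)] \<theta>k nn \<tau> B by (intro mult_mono) auto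
      show "f (\<kappa> * \<theta> k * a k) \<le> \<tau> * W * (1 + \<tau>) * \<alpha>"
        unfolding nm \<alpha>_def using \<kappa> \<theta>k1 nn \<tau> W0 by (intro mult_mono) auto
      show "f (\<mu> * a k * \<rho>) \<le> L * P"
        unfolding nm[of "\<mu> * a k"] using \<mu>a True \<rho> nn L0 by (intro mult_mono) auto
    qed
    finally show ?thesis using True by simp
  qed
qed

text \<open>
  For a single norm with pivot \<open>k\<close> one would use the linear forms \<open>x\<^sub>k\<close> and \<open>x\<^sub>i - (a\<^sub>i/a\<^sub>k)x\<^sub>k\<close>, whose matrix is
  \<open>I - v u\<^sup>T\<close> with \<open>u = e\<^sub>k/a\<^sub>k\<close> and \<open>v = a - a\<^sub>ke\<^sub>k\<close>. Replacing the indicator of \<open>k\<close> by a partition of unity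
  \<open>\<theta>\<close> that approximates it simultaneously for all norms gives vectors \<open>u\<close> and \<open>v\<close> that are independent of
  the norm. The factor \<open>s > 1\<close> is the room for the error of approximation.
\<close>
lemma approximating_transvection:
  fixes a :: "nat \<Rightarrow> 'k::field"
  assumes J: "finite J" "\<And>j. j \<in> J \<Longrightarrow> normalized_norm (nrm j) \<and> \<not> trivial_norm (nrm j)"
    and a: "i0 < n" "a i0 \<noteq> 0" and B: "\<And>j. j \<in> J \<Longrightarrow> 0 < B j \<and> 0 < \<epsilon> j" and s: "1 < s"
  shows "\<exists>M\<in>carrier_mat n n. det M = 1 \<and> (\<forall>j\<in>J. \<forall>x\<in>carrier_vec n.
    (\<forall>i<n. nrm j ((M *\<^sub>v x) $ i) \<le> (if i = pivot n a (nrm j) then B j else \<epsilon> j)) \<longrightarrow>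
    (\<exists>\<mu>. nrm j \<mu> * nrm j (a (pivot n a (nrm j))) \<le> s * B j \<and> (\<forall>i<n. nrm j (x $ i - \<mu> * a i) \<le> s * \<epsilon> j)))"
proof -
  have n: "0 < n" using a by simp
  define W where "W j = (\<Sum>i<n. \<epsilon> j / nrm j (a i))" for j
  define \<alpha> where "\<alpha> j = nrm j (a (pivot n a (nrm j)))" for j
  define L where "L j \<tau> = (1 + \<tau>) * B j + \<tau> * W j * \<alpha> j" for j \<tau>
  define P where "P \<tau> = real n * ((1 + \<tau>) * \<tau>)" for \<tau>
  define D where "D j \<tau> = B j * (\<tau> * (2 + \<tau>)) + \<tau> * W j * (1 + \<tau>) * \<alpha> j + L j \<tau> * P \<tau>" for j \<tau>
  define D' where "D' j \<tau> = \<epsilon> j + L j \<tau> * (\<tau> + P \<tau>)" for j \<tau>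
  have L_lim: "((\<lambda>\<tau>. L j \<tau>) \<longlongrightarrow> (1 + 0) * B j + 0 * W j * \<alpha> j) (at_right 0)" for j
    unfolding L_def by (intro tendsto_intros)
  have P_lim: "((\<lambda>\<tau>. P \<tau>) \<longlongrightarrow> real n * ((1 + 0) * 0)) (at_right 0)"
    unfolding P_def by (intro tendsto_intros)
  have D_lim: "((\<lambda>\<tau>. D j \<tau>) \<longlongrightarrow> B j * (0 * (2 + 0)) + 0 * W j * (1 + 0) * \<alpha> j
      + ((1 + 0) * B j + 0 * W j * \<alpha> j) * (real n * ((1 + 0) * 0))) (at_right 0)" for j
    unfolding D_def by (intro tendsto_intros L_lim P_lim)
  have D'_lim: "((\<lambda>\<tau>. D' j \<tau>) \<longlongrightarrow> \<epsilon> j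
      + ((1 + 0) * B j + 0 * W j * \<alpha> j) * (0 + real n * ((1 + 0) * 0))) (at_right 0)" for j
    unfolding D'_def by (intro tendsto_intros L_lim P_lim)
  have "\<forall>\<^sub>F \<tau> in at_right 0. \<forall>j\<in>J. L j \<tau> < s * B j \<and> D j \<tau> < s * \<epsilon> j \<and> D' j \<tau> < s * \<epsilon> j"
  proof (intro eventually_ball_finite J ballI eventually_conj)
    fix j assume "j \<in> J"
    then have pos: "0 < B j" "0 < \<epsilon> j" using B by auto
    show "\<forall>\<^sub>F \<tau> in at_right 0. L j \<tau> < s * B j"
      by (rule order_tendstoD(2)[OF L_lim]) (use pos s in auto)
    show "\<forall>\<^sub>F \<tau> in at_right 0. D j \<tau> < s * \<epsilon> j"
      by (rule order_tendstoD(2)[OF D_lim]) (use pos s in auto)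
    show "\<forall>\<^sub>F \<tau> in at_right 0. D' j \<tau> < s * \<epsilon> j"
      by (rule order_tendstoD(2)[OF D'_lim]) (use pos s in auto)
  qed
  then have "\<forall>\<^sub>F \<tau> in at_right 0. 0 < \<tau> \<and> (\<forall>j\<in>J. L j \<tau> < s * B j \<and> D j \<tau> < s * \<epsilon> j \<and> D' j \<tau> < s * \<epsilon> j)"
    by (intro eventually_conj eventually_at_right_less)
  then obtain \<tau> :: real where \<tau>: "0 < \<tau>"
    and small: "\<And>j. j \<in> J \<Longrightarrow> L j \<tau> < s * B j \<and> D j \<tau> < s * \<epsilon> j \<and> D' j \<tau> < s * \<epsilon> j"
    using eventually_happens'[OF trivial_limit_at_right_real] by blast
  have "\<exists>\<theta>. (\<Sum>i<n. \<theta> i) = 1 \<and> (\<forall>i<n. a i = 0 \<longrightarrow> \<theta> i = 0) \<and>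
      (\<forall>f\<in>nrm ` J. \<forall>i<n. f (\<theta> i - (if i = pivot n a f then 1 else 0)) < \<tau>)"
    by (rule approximate_pivot_indicators[of "nrm ` J" i0 n a \<tau>]) (use J a \<tau> in auto)
  then obtain \<theta> where \<theta>: "(\<Sum>i<n. \<theta> i) = 1" "\<And>i. i < n \<Longrightarrow> a i = 0 \<Longrightarrow> \<theta> i = 0"
    "\<And>j i. j \<in> J \<Longrightarrow> i < n \<Longrightarrow> nrm j (\<theta> i - (if i = pivot n a (nrm j) then 1 else 0)) < \<tau>"
    by blast
  \<comment> \<open>The natural choice of \<open>v\<close> is \<open>(1 - \<theta>\<^sub>i)a\<^sub>i\<close>, with \<open>u\<^sup>Tv = \<rho>\<close>. Since \<open>u\<^sup>Ta = 1\<close>, subtracting \<open>\<rho>a\<close>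
    makes \<open>u\<^sup>Tv\<close> vanish exactly; \<open>\<rho>\<close> is small because each \<open>\<theta>\<^sub>i\<close> is close to \<open>0\<close> or \<open>1\<close>.\<close>
  define \<rho> where "\<rho> = (\<Sum>i<n. \<theta> i * (1 - \<theta> i))"
  define u where "u i = \<theta> i / a i" for i
  define v where "v i = (1 - \<theta> i - \<rho>) * a i" for i
  have uv: "(\<Sum>i<n. u i * v i) = 0"
  proof -
    have "(\<Sum>i<n. u i * v i) = (\<Sum>i<n. \<theta> i * (1 - \<theta> i) - \<rho> * \<theta> i)"
    proof (intro sum.cong refl)
      fix i assume "i \<in> {..<n}"
      then have "u i * v i = \<theta> i * (1 - \<theta> i - \<rho>)"
        using \<theta>(2)[of i] by (cases "a i = 0") (simp_all add: u_def v_def)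
      then show "u i * v i = \<theta> i * (1 - \<theta> i) - \<rho> * \<theta> i" by (simp add: algebra_simps)
    qed
    also have "\<dots> = \<rho> - \<rho> * (\<Sum>i<n. \<theta> i)" by (simp add: sum_subtractf sum_distrib_left \<rho>_def)
    finally show ?thesis using \<theta>(1) by simp
  qed
  show ?thesis
  proof (intro bexI[of _ "transvection n v u"] conjI det_transvection uv transvection_carrier ballI impI)
    fix j and x :: "'k vec" assume j: "j \<in> J" and x: "x \<in> carrier_vec n"
    assume y: "\<forall>i<n. nrm j ((transvection n v u *\<^sub>v x) $ i) \<le> (if i = pivot n a (nrm j) then B j else \<epsilon> j)"
    define k where "k = pivot n a (nrm j)"
    define y where "y i = (transvection n v u *\<^sub>v x) $ i" for i
    have nj: "normalized_norm (nrm j)" using J j by blast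
    have k: "k < n" "\<And>i. i < n \<Longrightarrow> nrm j (a i) \<le> nrm j (a k)"
      unfolding k_def using pivot[OF n] by auto
    have ak: "a k \<noteq> 0" using k(2)[OF a(1)] nrm_pos[OF nj a(2)] nrm_0[OF nj] by auto
    define \<mu> where "\<mu> = (\<Sum>i<n. u i * x $ i)"
    have yx: "y i = x $ i - v i * \<mu>" if "i < n" for i
      using transvection_mult_vec[OF x that] by (simp add: y_def \<mu>_def)
    have "(\<Sum>i<n. \<theta> i / a i * y i) = (\<Sum>i<n. u i * x $ i - \<mu> * (u i * v i))"
      by (intro sum.cong) (auto simp: yx u_def algebra_simps)
    also have "\<dots> = \<mu> - \<mu> * (\<Sum>i<n. u i * v i)"
      by (simp add: sum_subtractf sum_distrib_left \<mu>_def)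
    finally have \<mu>: "(\<Sum>i<n. \<theta> i / a i * y i) = \<mu>" using uv by simp
    have y': "nrm j (y i) \<le> (if i = k then B j else \<epsilon> j)" if "i < n" for i
      using y that by (simp add: y_def k_def)
    have Bj: "0 < B j" "0 < \<epsilon> j" using B[OF j] by auto
    note est = pivot_estimate[where f = "nrm j" and a = a and k = k and \<theta> = \<theta> and y = y and B = "B j" and \<epsilon> = "\<epsilon> j", OF nj k(1) ak k(2) \<theta>(3)[OF j, folded k_def] \<tau> y' Bj]
    have "nrm j \<mu> * \<alpha> j \<le> L j \<tau>"
      using est(1) by (simp only: \<mu> L_def W_def \<alpha>_def k_def)
    then have 1: "nrm j \<mu> * nrm j (a (pivot n a (nrm j))) \<le> s * B j"
      using small[OF j] by (simp add: \<alpha>_def)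
    have 2: "nrm j (x $ i - \<mu> * a i) \<le> s * \<epsilon> j" if i: "i < n" for i
    proof -
      have "x $ i - \<mu> * a i = y i - \<mu> * (\<theta> i + \<rho>) * a i"
        using yx[OF i] by (simp add: v_def algebra_simps)
      moreover have "nrm j (y i - \<mu> * (\<theta> i + \<rho>) * a i) \<le> (if i = k then D j \<tau> else D' j \<tau>)"
        using est(2)[OF _ _ _ i] by (simp only: \<mu> \<rho>_def D_def D'_def L_def P_def W_def \<alpha>_def k_def)
      ultimately show ?thesis using small[OF j] by (auto split: if_splits)
    qed
    show "\<exists>\<mu>. nrm j \<mu> * nrm j (a (pivot n a (nrm j))) \<le> s * B j \<and> (\<forall>i<n. nrm j (x $ i - \<mu> * a i) \<le> s * \<epsilon> j)"
      using 1 2 by blast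
  qed
qed

section \<open>Reflections of an isotropic vector\<close>

text \<open>
  The form as a function of coordinate functions instead of vectors of fixed dimension, so that linear
  combinations of arguments can be written down directly.
\<close>
definition quad_form :: "nat \<Rightarrow> (nat \<Rightarrow> nat \<Rightarrow> 'k) \<Rightarrow> (nat \<Rightarrow> 'k) \<Rightarrow> 'k::field" where
  "quad_form n c v = (\<Sum>(i, k)\<in>form_indices n. c i k * v i * v k)"

definition polar_form :: "nat \<Rightarrow> (nat \<Rightarrow> nat \<Rightarrow> 'k) \<Rightarrow> (nat \<Rightarrow> 'k) \<Rightarrow> (nat \<Rightarrow> 'k) \<Rightarrow> 'k::field" where
  "polar_form n c v w = (\<Sum>(i, k)\<in>form_indices n. c i k * (v i * w k + v k * w i))"

lemma form_eval_eq_quad_form: "form_eval n c v = quad_form n c (\<lambda>i. v $ i)"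
  by (simp add: form_eval_def quad_form_def)

lemma finite_form_indices: "finite (form_indices n)"
  by (rule finite_subset[of _ "{..<n} \<times> {..<n}"]) (auto simp: form_indices_def)

lemma quad_form_cong: "(\<And>i. i < n \<Longrightarrow> v i = w i) \<Longrightarrow> quad_form n c v = quad_form n c w"
  unfolding quad_form_def by (intro sum.cong) (auto simp: form_indices_def)

lemma polar_form_cong:
  "(\<And>i. i < n \<Longrightarrow> v i = v' i) \<Longrightarrow> (\<And>i. i < n \<Longrightarrow> w i = w' i) \<Longrightarrow> polar_form n c v w = polar_form n c v' w'"
  unfolding polar_form_def by (intro sum.cong) (auto simp: form_indices_def)

lemma quad_form_lincomb:
  "quad_form n c (\<lambda>i. s * v i + t * w i)
    = s\<^sup>2 * quad_form n c v + s * t * polar_form n c v w + t\<^sup>2 * quad_form n c w"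
  unfolding quad_form_def polar_form_def sum_distrib_left sum.distrib[symmetric]
  by (intro sum.cong) (auto simp: algebra_simps power2_eq_square)

lemma polar_form_sym: "polar_form n c v w = polar_form n c w v"
  unfolding polar_form_def by (intro sum.cong) (auto simp: algebra_simps)

lemma polar_form_lincomb: "polar_form n c v (\<lambda>i. w i + t * v i) = polar_form n c v w + 2 * t * quad_form n c v"
  unfolding quad_form_def polar_form_def sum_distrib_left sum.distrib[symmetric]
  by (intro sum.cong) (auto simp: algebra_simps)

text \<open>
  Both \<open>f(b)\<close> and \<open>T(a,b)\<close> are affine in the translation of \<open>b\<close> by multiples of the isotropic vector \<open>a\<close>,
  and the terms containing \<open>t\<close> cancel.
\<close>
lemma reflection_translate:
  assumes "quad_form n c a = 0" and b: "\<And>i. i < n \<Longrightarrow> b i = d i + t * a i" and "l < n"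
  shows "quad_form n c b * a l - polar_form n c a b * b l = quad_form n c d * a l - polar_form n c a d * d l"
proof -
  have "quad_form n c b = quad_form n c (\<lambda>i. 1 * d i + t * a i)"
    by (intro quad_form_cong) (simp add: b)
  then have "quad_form n c b = quad_form n c d + t * polar_form n c a d"
    unfolding quad_form_lincomb using assms(1) polar_form_sym[of n c a d] by simp
  moreover have "polar_form n c a b = polar_form n c a (\<lambda>i. d i + t * a i)"
    by (intro polar_form_cong) (simp_all add: b)
  then have "polar_form n c a b = polar_form n c a d"
    unfolding polar_form_lincomb using assms(1) by simp
  ultimately show ?thesis using b[OF \<open>l < n\<close>] by (simp add: algebra_simps)
qed

lemma quad_form_reflection:
  assumes "quad_form n c a = 0"
  shows "quad_form n c (\<lambda>l. quad_form n c b * a l - polar_form n c a b * b l) = 0"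
proof -
  have "quad_form n c (\<lambda>l. quad_form n c b * a l + (- polar_form n c a b) * b l) = 0"
    unfolding quad_form_lincomb using assms by (simp add: power2_eq_square)
  then show ?thesis by simp
qed

text \<open>
  If \<open>f(b) \<noteq> 0\<close>, then \<open>a\<close> would be a multiple \<open>tb\<close>, so that \<open>0 = f(a) = t\<^sup>2f(b)\<close> forces \<open>t = 0\<close> and \<open>a = 0\<close>.
\<close>
lemma isotropic_if_reflection_zero:
  assumes "quad_form n c a = 0" and a: "i < n" "a i \<noteq> 0"
    and zero: "\<And>l. l < n \<Longrightarrow> quad_form n c b * a l - polar_form n c a b * b l = 0"
  shows "quad_form n c b = 0"
proof (rule ccontr)
  assume Q: "quad_form n c b \<noteq> 0"
  define t where "t = polar_form n c a b / quad_form n c b"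
  have al: "a l = 0 * b l + t * b l" if "l < n" for l
    using zero[OF that] Q by (simp add: t_def field_simps)
  have "quad_form n c a = quad_form n c (\<lambda>l. 0 * b l + t * b l)"
    using al by (rule quad_form_cong)
  then have "t\<^sup>2 * quad_form n c b = 0" unfolding quad_form_lincomb using assms(1) by simp
  then have "t = 0" using Q by simp
  then show False using al a by simp
qed

lemma form_size_at_bounds:
  assumes f: "normalized_norm f" and "0 < n"
  shows "0 \<le> form_size_at f n c" "i \<le> k \<Longrightarrow> k < n \<Longrightarrow> f (c i k) \<le> form_size_at f n c"
proof -
  have le: "f (c i k) \<le> form_size_at f n c" if "(i, k) \<in> form_indices n" for i k
  proof (cases "archimedean_norm f")
    case True
    have "(case (i, k) of (i, k) \<Rightarrow> f (c i k)) \<le> (\<Sum>(i, k)\<in>form_indices n. f (c i k))"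
      using that finite_form_indices nrm_nonneg[OF f] by (intro member_le_sum) auto
    then show ?thesis using True by (simp add: form_size_at_def)
  next
    case False
    have "f (c i k) \<in> (\<lambda>(i, k). f (c i k)) ` form_indices n"
      using imageI[OF that, of "\<lambda>(i, k). f (c i k)"] by simp
    then have "f (c i k) \<le> Max ((\<lambda>(i, k). f (c i k)) ` form_indices n)"
      using finite_form_indices by (intro Max_ge) auto
    then show ?thesis using False by (simp add: form_size_at_def)
  qed
  have "(0, 0) \<in> form_indices n" using assms by (simp add: form_indices_def)
  then show "0 \<le> form_size_at f n c" using le[of 0 0] nrm_nonneg[OF f, of "c 0 0"] by linarith
  show "f (c i k) \<le> form_size_at f n c" if "i \<le> k" "k < n"
    using that by (intro le) (simp add: form_indices_def)
qed

text \<open>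
  Each coefficient of the form contributes three products of one entry of \<open>a\<close> and two of \<open>d\<close>, each
  of norm at most \<open>\<alpha>\<omega>\<^sup>2\<close>.
\<close>
lemma reflection_bound:
  assumes f: "normalized_norm f"
    and a: "\<And>i. i < n \<Longrightarrow> f (a i) \<le> \<alpha>" and d: "\<And>i. i < n \<Longrightarrow> f (d i) \<le> \<omega>" and l: "l < n"
  shows "f (quad_form n c d * a l - polar_form n c a d * d l)
    \<le> (if archimedean_norm f then f 3 else 1) * form_size_at f n c * \<alpha> * \<omega>\<^sup>2"
proof -
  note nn = nrm_nonneg[OF f] and nm = nrm_mult[OF f]
  define T where "T i k = d i * d k * a l + (- (a i * d k * d l)) + (- (a k * d i * d l))" for i k
  have \<alpha>0: "0 \<le> \<alpha>" and \<omega>0: "0 \<le> \<omega>" using a[OF l] d[OF l] nn[of "a l"] nn[of "d l"] by linarith+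
  have n: "0 < n" using l by simp
  have expand: "quad_form n c d * a l - polar_form n c a d * d l = (\<Sum>(i, k)\<in>form_indices n. c i k * T i k)"
    unfolding quad_form_def polar_form_def sum_distrib_right sum_subtractf[symmetric]
    by (intro sum.cong) (auto simp: T_def algebra_simps)
  have parts: "f (d i * d k * a l) \<le> \<alpha> * \<omega>\<^sup>2" "f (- (a i * d k * d l)) \<le> \<alpha> * \<omega>\<^sup>2" "f (- (a k * d i * d l)) \<le> \<alpha> * \<omega>\<^sup>2"
    if "i < n" "k < n" for i k
  proof -
    have 1: "f x * f y * f z \<le> \<alpha> * \<omega> * \<omega>" if "f x \<le> \<alpha>" "f y \<le> \<omega>" "f z \<le> \<omega>" for x y z
      using that nn \<alpha>0 \<omega>0 by (intro mult_mono) auto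
    show "f (d i * d k * a l) \<le> \<alpha> * \<omega>\<^sup>2" "f (- (a i * d k * d l)) \<le> \<alpha> * \<omega>\<^sup>2" "f (- (a k * d i * d l)) \<le> \<alpha> * \<omega>\<^sup>2"
      using 1[of "a l" "d i" "d k"] 1[of "a i" "d k" "d l"] 1[of "a k" "d i" "d l"] a d l that
      by (simp_all add: nm nrm_minus[OF f] power2_eq_square mult_ac)
  qed
  show ?thesis
  proof (cases "archimedean_norm f")
    case True
    have "f (\<Sum>(i, k)\<in>form_indices n. c i k * T i k) \<le> (\<Sum>p\<in>form_indices n. f (case p of (i, k) \<Rightarrow> c i k * T i k))"
      by (rule nrm_sum_le[OF f])
    also have "\<dots> \<le> (\<Sum>p\<in>form_indices n. (case p of (i, k) \<Rightarrow> f (c i k)) * (f 3 * (\<alpha> * \<omega>\<^sup>2)))"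
    proof (rule sum_mono, clarsimp simp: nm)
      fix i k assume "(i, k) \<in> form_indices n"
      then have ik: "i < n" "k < n" by (auto simp: form_indices_def)
      show "f (c i k) * f (T i k) \<le> f (c i k) * (f 3 * (\<alpha> * \<omega>\<^sup>2))"
        unfolding T_def by (intro mult_left_mono nrm_add3_le[OF f True] parts ik nn)
    qed
    also have "\<dots> = form_size_at f n c * (f 3 * (\<alpha> * \<omega>\<^sup>2))"
      using True by (simp add: form_size_at_def sum_distrib_right)
    finally show ?thesis unfolding expand using True by (simp add: mult_ac)
  next
    case False
    have ultra: "f (x + y) \<le> B" if "f x \<le> B" "f y \<le> B" for x y B
      using ultrametric_if_not_archimedean[OF f False, of x y] that by linarith
    have "f (\<Sum>(i, k)\<in>form_indices n. c i k * T i k) \<le> form_size_at f n c * (\<alpha> * \<omega>\<^sup>2)"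
    proof (rule ultrametric_sum_le[OF f False], clarsimp simp: nm)
      fix i k assume "(i, k) \<in> form_indices n"
      then have ik: "i \<le> k" "i < n" "k < n" by (auto simp: form_indices_def)
      have "f (T i k) \<le> \<alpha> * \<omega>\<^sup>2"
        unfolding T_def by (intro ultra parts ik)
      then show "f (c i k) * f (T i k) \<le> form_size_at f n c * (\<alpha> * \<omega>\<^sup>2)"
        using form_size_at_bounds[OF f n] ik nn by (intro mult_mono) auto
    qed (use form_size_at_bounds[OF f n] \<alpha>0 in auto)
    then show ?thesis unfolding expand using False by (simp add: mult_ac)
  qed
qed

section \<open>The descent step\<close>

lemma multimetric_norm:
  assumes "multimetric R N m nrm" "j < m"
  shows "normalized_norm (nrm j)"
  using assms unfolding multimetric_def by blast

lemma vec_size_eq_prod_pivot: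
  assumes "0 < n"
  shows "vec_size m nrm n v = (\<Prod>j<m. nrm j (v $ pivot n (vec_index v) (nrm j)))"
  unfolding vec_size_def
proof (rule prod.cong[OF refl])
  fix j
  show "Max ((\<lambda>i. nrm j (v $ i)) ` {..<n}) = nrm j (v $ pivot n (vec_index v) (nrm j))"
    by (rule Max_eqI) (use pivot[OF assms, where a = "vec_index v" and f = "nrm j"] in auto)
qed

lemma vec_size_le_prod:
  assumes "multimetric R N m nrm" "0 < n" and "\<And>j i. j < m \<Longrightarrow> i < n \<Longrightarrow> nrm j (v $ i) \<le> b j"
  shows "vec_size m nrm n v \<le> (\<Prod>j<m. b j)"
  unfolding vec_size_eq_prod_pivot[OF assms(2)]
proof (rule prod_mono, intro conjI)
  fix j assume "j \<in> {..<m}"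
  then have j: "j < m" by simp
  show "0 \<le> nrm j (v $ pivot n (vec_index v) (nrm j))"
    by (rule nrm_nonneg[OF multimetric_norm[OF assms(1) j]])
  show "nrm j (v $ pivot n (vec_index v) (nrm j)) \<le> b j"
    by (rule assms(3)[OF j pivot(1)[OF assms(2)]])
qed

lemma elem_norm_le_vec_size:
  assumes mm: "multimetric R N m nrm" and i: "i < n"
  shows "elem_norm R N (v $ i) \<le> vec_size m nrm n v"
proof -
  have n: "0 < n" using i by simp
  have "elem_norm R N (v $ i) = (\<Prod>j<m. nrm j (v $ i))" using mm unfolding multimetric_def by blast
  also have "\<dots> \<le> (\<Prod>j<m. nrm j (v $ pivot n (vec_index v) (nrm j)))"
    by (rule prod_mono) (use nrm_nonneg[OF multimetric_norm[OF mm]] pivot(2)[OF n i] in auto)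
  finally show ?thesis by (simp add: vec_size_eq_prod_pivot[OF n])
qed

lemma isotropic_vector_nonzero_entry:
  assumes "isotropic_vector R n c a"
  obtains i where "i < n" "a $ i \<noteq> 0" "a $ i \<in> R"
proof -
  have "a \<in> carrier_vec n" "a \<noteq> 0\<^sub>v n" "\<forall>i<n. a $ i \<in> R"
    using assms by (auto simp: isotropic_vector_def vecs_over_def)
  moreover from this have "\<exists>i<n. a $ i \<noteq> 0" by (metis carrier_vecD eq_vecI index_zero_vec)
  ultimately show ?thesis using that by blast
qed

lemma vec_size_isotropic_ge_1:
  assumes nd: "normed_dedekind_domain R N" and mm: "multimetric R N m nrm" and a: "isotropic_vector R n c a"
  shows "1 \<le> vec_size m nrm n a"
proof -
  obtain i where i: "i < n" "a $ i \<noteq> 0" "a $ i \<in> R" using isotropic_vector_nonzero_entry[OF a] .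
  show ?thesis using elem_norm_ge_1[OF nd i(3,2)] elem_norm_le_vec_size[OF mm i(1), of a] by linarith
qed

lemma trivial_norm_not_archimedean:
  assumes f: "normalized_norm f" and triv: "trivial_norm f"
  shows "\<not> archimedean_norm f"
proof -
  have "f (x + y) \<le> max (f x) (f y)" for x y
    using triv nrm_0[OF f] unfolding trivial_norm_def
    by (cases "x = 0"; cases "y = 0"; cases "x + y = 0") auto
  from artin_constant_eq_1_if_ultrametric[OF f this] show ?thesis by (simp add: archimedean_norm_def)
qed

lemma triple_form_size_eq_prod:
  "triple_form_size m nrm n c = (\<Prod>j<m. (if archimedean_norm (nrm j) then nrm j 3 else 1) * form_size_at (nrm j) n c)"
proof -
  have "(\<Prod>j\<in>archimedean_indices m nrm. nrm j 3) = (\<Prod>j<m. if archimedean_norm (nrm j) then nrm j 3 else 1)"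
    by (simp add: prod.inter_filter[symmetric] archimedean_indices_def)
  then show ?thesis by (simp add: triple_form_size_def form_size_def prod.distrib mult.commute)
qed

lemma isotropic_reflection:
  assumes R: "subring R (class_ring :: 'k::field ring)"
    and c: "\<And>i k. i \<le> k \<Longrightarrow> k < n \<Longrightarrow> c i k \<in> R"
    and a: "isotropic_vector R n c a" and b: "b \<in> vecs_over R n" "b \<noteq> 0\<^sub>v n"
  defines "a' \<equiv> vec n (\<lambda>l. quad_form n c (vec_index b) * a $ l - polar_form n c (vec_index a) (vec_index b) * b $ l)"
  shows "isotropic_vector R n c b \<or> isotropic_vector R n c a'"
proof -
  note closed = subring_class_ring_closed[OF R]
  have a_R: "a \<in> carrier_vec n" "\<And>i. i < n \<Longrightarrow> a $ i \<in> R" and Qa: "quad_form n c (vec_index a) = 0"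
    using a by (auto simp: isotropic_vector_def vecs_over_def form_eval_eq_quad_form)
  have b_R: "\<And>i. i < n \<Longrightarrow> b $ i \<in> R" using b by (auto simp: vecs_over_def)
  obtain i where i: "i < n" "a $ i \<noteq> 0" using isotropic_vector_nonzero_entry[OF a] .
  have "quad_form n c (vec_index b) \<in> R" "polar_form n c (vec_index a) (vec_index b) \<in> R"
    unfolding quad_form_def polar_form_def
    by (rule closed(7), auto simp: form_indices_def intro!: closed c a_R b_R)+
  then have a'_R: "a' \<in> vecs_over R n"
    using a_R b_R unfolding a'_def vecs_over_def by (auto intro!: closed)
  have "form_eval n c a' = quad_form n c (\<lambda>l. quad_form n c (vec_index b) * a $ l - polar_form n c (vec_index a) (vec_index b) * b $ l)"
    unfolding form_eval_eq_quad_form by (rule quad_form_cong) (simp add: a'_def)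
  then have Qa': "form_eval n c a' = 0" using quad_form_reflection[OF Qa] by simp
  show ?thesis
  proof (cases "a' = 0\<^sub>v n")
    case True
    have "quad_form n c (vec_index b) = 0"
    proof (rule isotropic_if_reflection_zero[OF Qa i])
      fix l assume "l < n"
      then show "quad_form n c (vec_index b) * a $ l - polar_form n c (vec_index a) (vec_index b) * b $ l = 0"
        using arg_cong[OF True, of "\<lambda>v. v $ l"] by (simp add: a'_def)
    qed
    then show ?thesis using b by (simp add: isotropic_vector_def form_eval_eq_quad_form)
  next
    case False
    then show ?thesis using a'_R Qa' by (simp add: isotropic_vector_def)
  qed
qed

text \<open>
  The two alternatives for the length come from \<open>b\<close> itself, written as \<open>\<mu>a + (b - \<mu>a)\<close>, and from the
  reflected vector.
\<close>
lemma isotropic_descent_step: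
  assumes R: "subring R (class_ring :: 'k::field ring)" and mm: "multimetric R N m nrm"
    and c: "\<And>i k. i \<le> k \<Longrightarrow> k < n \<Longrightarrow> c i k \<in> R"
    and a: "isotropic_vector R n c a" and b: "b \<in> vecs_over R n" "b \<noteq> 0\<^sub>v n"
    and close: "\<And>j. j < m \<Longrightarrow> \<exists>\<mu>. nrm j \<mu> * nrm j (a $ pivot n (vec_index a) (nrm j)) \<le> \<beta> j \<and>
      (\<forall>i<n. nrm j (b $ i - \<mu> * a $ i) \<le> \<omega> j)"
  shows "\<exists>a'. isotropic_vector R n c a' \<and>
    (vec_size m nrm n a' \<le> (\<Prod>j<m. if archimedean_norm (nrm j) then \<beta> j + \<omega> j else max (\<beta> j) (\<omega> j)) \<or>
     vec_size m nrm n a' \<le> triple_form_size m nrm n c * vec_size m nrm n a * (\<Prod>j<m. \<omega> j)\<^sup>2)"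
proof -
  obtain i0 where "i0 < n" using isotropic_vector_nonzero_entry[OF a] .
  then have n: "0 < n" by simp
  have Qa: "quad_form n c (vec_index a) = 0"
    using a by (auto simp: isotropic_vector_def form_eval_eq_quad_form)
  define a' where "a' = vec n (\<lambda>l. quad_form n c (vec_index b) * a $ l - polar_form n c (vec_index a) (vec_index b) * b $ l)"
  have "vec_size m nrm n b \<le> (\<Prod>j<m. if archimedean_norm (nrm j) then \<beta> j + \<omega> j else max (\<beta> j) (\<omega> j))"
  proof (rule vec_size_le_prod[OF mm n])
    fix j i assume j: "j < m" and i: "i < n"
    have nj: "normalized_norm (nrm j)" using multimetric_norm[OF mm j] .
    obtain \<mu> where \<mu>: "nrm j \<mu> * nrm j (a $ pivot n (vec_index a) (nrm j)) \<le> \<beta> j"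
      "\<And>i. i < n \<Longrightarrow> nrm j (b $ i - \<mu> * a $ i) \<le> \<omega> j" using close[OF j] by blast
    have "nrm j (\<mu> * a $ i) \<le> nrm j \<mu> * nrm j (a $ pivot n (vec_index a) (nrm j))"
      unfolding nrm_mult[OF nj] by (intro mult_left_mono pivot[OF n] i nrm_nonneg[OF nj])
    with \<mu>(1) have 1: "nrm j (\<mu> * a $ i) \<le> \<beta> j" by linarith
    have 2: "b $ i = \<mu> * a $ i + (b $ i - \<mu> * a $ i)" by simp
    show "nrm j (b $ i) \<le> (if archimedean_norm (nrm j) then \<beta> j + \<omega> j else max (\<beta> j) (\<omega> j))"
    proof (cases "archimedean_norm (nrm j)")
      case True
      then show ?thesis using nrm_triangle[OF nj, of "\<mu> * a $ i" "b $ i - \<mu> * a $ i"] 1 \<mu>(2)[OF i] by simp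
    next
      case False
      then show ?thesis using ultrametric_if_not_archimedean[OF nj False, of "\<mu> * a $ i" "b $ i - \<mu> * a $ i"] 1 \<mu>(2)[OF i] by auto
    qed
  qed
  moreover have "vec_size m nrm n a' \<le> triple_form_size m nrm n c * vec_size m nrm n a * (\<Prod>j<m. \<omega> j)\<^sup>2"
  proof -
    have "vec_size m nrm n a' \<le> (\<Prod>j<m. (if archimedean_norm (nrm j) then nrm j 3 else 1) * form_size_at (nrm j) n c
        * nrm j (a $ pivot n (vec_index a) (nrm j)) * (\<omega> j)\<^sup>2)"
    proof (rule vec_size_le_prod[OF mm n])
      fix j l assume j: "j < m" and l: "l < n"
      have nj: "normalized_norm (nrm j)" using multimetric_norm[OF mm j] .
      obtain \<mu> where \<mu>: "\<And>i. i < n \<Longrightarrow> nrm j (b $ i - \<mu> * a $ i) \<le> \<omega> j" using close[OF j] by blast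
      define d where "d i = b $ i - \<mu> * a $ i" for i
      have "a' $ l = quad_form n c (vec_index b) * a $ l - polar_form n c (vec_index a) (vec_index b) * b $ l"
        using l by (simp add: a'_def)
      also have "\<dots> = quad_form n c d * a $ l - polar_form n c (vec_index a) d * d l"
        by (rule reflection_translate[OF Qa _ l, where t = \<mu>]) (simp add: d_def)
      finally show "nrm j (a' $ l) \<le> (if archimedean_norm (nrm j) then nrm j 3 else 1) * form_size_at (nrm j) n c
        * nrm j (a $ pivot n (vec_index a) (nrm j)) * (\<omega> j)\<^sup>2"
        using reflection_bound[where f = "nrm j" and a = "vec_index a" and \<alpha> = "nrm j (a $ pivot n (vec_index a) (nrm j))"
            and d = d and \<omega> = "\<omega> j", OF nj pivot(2)[OF n] _ l] \<mu> by (simp add: d_def)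
    qed
    then show ?thesis
      by (simp add: triple_form_size_eq_prod vec_size_eq_prod_pivot[OF n] prod.distrib prod_power_distrib)
  qed
  ultimately show ?thesis using isotropic_reflection[OF R c a b] unfolding a'_def by blast
qed

lemma ex_slack:
  fixes X Y r :: real
  assumes "X < r" "Y < r"
  shows "\<exists>s>1. s ^ p * X < r \<and> s ^ q * Y < r"
proof -
  have "((\<lambda>s. s ^ p * X) \<longlongrightarrow> 1 ^ p * X) (at_right 1)" "((\<lambda>s. s ^ q * Y) \<longlongrightarrow> 1 ^ q * Y) (at_right 1)"
    by (intro tendsto_intros)+
  then have "\<forall>\<^sub>F s in at_right 1. s ^ p * X < r" "\<forall>\<^sub>F s in at_right 1. s ^ q * Y < r"
    using assms by (auto dest: order_tendstoD(2))
  then have "\<forall>\<^sub>F s in at_right 1. 1 < s \<and> s ^ p * X < r \<and> s ^ q * Y < r"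
    by (intro eventually_conj eventually_at_right_less)
  then show ?thesis using eventually_happens'[OF trivial_limit_at_right_real] by blast
qed

text \<open>
  For the lattice \<open>R\<^sup>n\<close>, which has covolume \<open>1\<close>, and a matrix of determinant \<open>1\<close>, admissibility
  reduces to a condition on the product of the targets.
\<close>
lemma admissible_transvection:
  assumes nd: "normed_dedekind_domain R N" and mm: "multimetric R N m nrm"
    and adm: "admissible R N m nrm qo n C"
    and M: "M \<in> carrier_mat n n" "det M = 1"
    and tv: "\<And>i j. i < n \<Longrightarrow> j < m \<Longrightarrow> \<epsilon> i j \<in> target_values qo (nrm j)"
    and C: "1 \<le> C * (\<Prod>i<n. \<Prod>j<m. \<epsilon> i j)"
  shows "\<exists>x\<in>vecs_over R n. x \<noteq> 0\<^sub>v n \<and> (\<forall>i<n. \<forall>j<m. nrm j ((M *\<^sub>v x) $ i) \<le> \<epsilon> i j)"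
proof -
  have "elem_norm R N 1 = (\<Prod>j<m. nrm j 1)" using mm unfolding multimetric_def by blast
  also have "\<dots> = 1" by (rule prod.neutral) (use nrm_1[OF multimetric_norm[OF mm]] in auto)
  finally have "elem_norm R N (det M) * 1 \<le> C * (\<Prod>i<n. \<Prod>j<m. \<epsilon> i j)" using M C by simp
  moreover have "invertible_mat M" using invertible_mat_if_det_nonzero[OF M(1)] M(2) by simp
  moreover note is_lattice_standard[OF dedekind_subring[OF nd], of n] has_covol_standard_lattice[OF nd, of n]
  ultimately show ?thesis using adm M(1) tv unfolding admissible_def by blast
qed

text \<open>
  In the norm \<open>j\<close> the linear form that belongs to the pivot gets the target \<open>B\<^sub>j\<close> and the other \<open>n - 1\<close> forms
  get \<open>\<epsilon>\<^sub>j\<close>. Then \<open>|\<mu>a|\<^sub>j\<close> is at most about \<open>B\<^sub>j\<close> and \<open>|b - \<mu>a|\<^sub>j\<close> at most about \<open>\<epsilon>\<^sub>j\<close>. The strict inequalities in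
  the assumptions absorb the error of the approximation.
\<close>
lemma isotropic_descent:
  assumes nd: "normed_dedekind_domain R N" and mm: "multimetric R N m nrm"
    and adm: "admissible R N m nrm qo n C"
    and c: "\<And>i k. i \<le> k \<Longrightarrow> k < n \<Longrightarrow> c i k \<in> R"
    and a: "isotropic_vector R n c a"
    and tv: "\<And>j. j < m \<Longrightarrow> B j \<in> target_values qo (nrm j) \<and> \<epsilon> j \<in> target_values qo (nrm j)"
    and pos: "\<And>j. j < m \<Longrightarrow> 0 < B j \<and> 0 < \<epsilon> j"
    and triv: "\<And>j. j < m \<Longrightarrow> trivial_norm (nrm j) \<Longrightarrow> \<epsilon> j = 1"
    and C: "1 \<le> C * (\<Prod>j<m. B j * \<epsilon> j ^ (n - 1))"
    and small1: "(\<Prod>j<m. if archimedean_norm (nrm j) then B j + \<epsilon> j else max (B j) (\<epsilon> j)) < r"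
    and small2: "triple_form_size m nrm n c * vec_size m nrm n a * (\<Prod>j<m. \<epsilon> j)\<^sup>2 < r"
  shows "\<exists>a'. isotropic_vector R n c a' \<and> vec_size m nrm n a' \<le> r"
proof -
  note R = dedekind_subring[OF nd]
  obtain i0 where i0: "i0 < n" "a $ i0 \<noteq> 0" using isotropic_vector_nonzero_entry[OF a] .
  then have n: "0 < n" by simp
  obtain s :: real where s: "1 < s"
    and s1: "s ^ m * (\<Prod>j<m. if archimedean_norm (nrm j) then B j + \<epsilon> j else max (B j) (\<epsilon> j)) < r"
    and s2: "s ^ (2 * m) * (triple_form_size m nrm n c * vec_size m nrm n a * (\<Prod>j<m. \<epsilon> j)\<^sup>2) < r"
    using ex_slack[OF small1 small2] by blast
  define k where "k j = pivot n (vec_index a) (nrm j)" for j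
  have k: "k j < n" for j unfolding k_def by (rule pivot(1)[OF n])
  have "\<exists>M\<in>carrier_mat n n. det M = 1 \<and> (\<forall>j\<in>{j. j < m \<and> \<not> trivial_norm (nrm j)}. \<forall>x\<in>carrier_vec n.
    (\<forall>i<n. nrm j ((M *\<^sub>v x) $ i) \<le> (if i = pivot n (vec_index a) (nrm j) then B j else \<epsilon> j)) \<longrightarrow>
    (\<exists>\<mu>. nrm j \<mu> * nrm j (a $ pivot n (vec_index a) (nrm j)) \<le> s * B j \<and> (\<forall>i<n. nrm j (x $ i - \<mu> * a $ i) \<le> s * \<epsilon> j)))"
    by (rule approximating_transvection[where a = "vec_index a", OF _ _ i0(1)])
      (use i0 s pos multimetric_norm[OF mm] in auto)
  then obtain M where M: "M \<in> carrier_mat n n" "det M = 1"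
    and Mx: "\<And>j x. j < m \<Longrightarrow> \<not> trivial_norm (nrm j) \<Longrightarrow> x \<in> carrier_vec n \<Longrightarrow>
      (\<forall>i<n. nrm j ((M *\<^sub>v x) $ i) \<le> (if i = k j then B j else \<epsilon> j)) \<Longrightarrow>
      (\<exists>\<mu>. nrm j \<mu> * nrm j (a $ k j) \<le> s * B j \<and> (\<forall>i<n. nrm j (x $ i - \<mu> * a $ i) \<le> s * \<epsilon> j))"
    unfolding k_def by blast
  have "(\<Prod>i<n. \<Prod>j<m. if i = k j then B j else \<epsilon> j) = (\<Prod>j<m. \<Prod>i<n. if i = k j then B j else \<epsilon> j)"
    by (rule prod.swap)
  also have "\<dots> = (\<Prod>j<m. B j * \<epsilon> j ^ (n - 1))"
  proof (rule prod.cong[OF refl])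
    fix j
    have "(\<Prod>i<n. if i = k j then B j else \<epsilon> j) = B j * (\<Prod>i\<in>{..<n} - {k j}. if i = k j then B j else \<epsilon> j)"
      using k[of j] by (subst prod.remove[of _ "k j"]) auto
    also have "(\<Prod>i\<in>{..<n} - {k j}. if i = k j then B j else \<epsilon> j) = (\<Prod>i\<in>{..<n} - {k j}. \<epsilon> j)"
      by (intro prod.cong) auto
    also have "\<dots> = \<epsilon> j ^ (n - 1)" using k[of j] by simp
    finally show "(\<Prod>i<n. if i = k j then B j else \<epsilon> j) = B j * \<epsilon> j ^ (n - 1)" .
  qed
  finally have "\<exists>x\<in>vecs_over R n. x \<noteq> 0\<^sub>v n \<and> (\<forall>i<n. \<forall>j<m. nrm j ((M *\<^sub>v x) $ i) \<le> (if i = k j then B j else \<epsilon> j))"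
    using C tv by (intro admissible_transvection[OF nd mm adm M]) auto
  then obtain x where x: "x \<in> vecs_over R n" "x \<noteq> 0\<^sub>v n"
    and xM: "\<And>i j. i < n \<Longrightarrow> j < m \<Longrightarrow> nrm j ((M *\<^sub>v x) $ i) \<le> (if i = k j then B j else \<epsilon> j)" by blast
  have xc: "x \<in> carrier_vec n" using x by (simp add: vecs_over_def)
  have close: "\<exists>\<mu>. nrm j \<mu> * nrm j (a $ pivot n (vec_index a) (nrm j)) \<le> s * B j \<and>
      (\<forall>i<n. nrm j (x $ i - \<mu> * a $ i) \<le> s * \<epsilon> j)" if j: "j < m" for j
  \<comment> \<open>At a trivial norm the multiplier \<open>0\<close> will do, because no element has norm greater than \<open>1\<close>.\<close>
  proof (cases "trivial_norm (nrm j)")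
    case False
    then show ?thesis using Mx[OF j False xc] xM[OF _ j] by (simp add: k_def)
  next
    case True
    have nj: "normalized_norm (nrm j)" using multimetric_norm[OF mm j] .
    have "nrm j y \<le> s * \<epsilon> j" for y
      using True triv[OF j True] s nrm_0[OF nj] by (cases "y = 0") (auto simp: trivial_norm_def)
    then show ?thesis using s pos[OF j] nrm_0[OF nj] by (intro exI[of _ 0]) simp
  qed
  obtain a' where a': "isotropic_vector R n c a'" and
    "vec_size m nrm n a' \<le> (\<Prod>j<m. if archimedean_norm (nrm j) then s * B j + s * \<epsilon> j else max (s * B j) (s * \<epsilon> j)) \<or>
     vec_size m nrm n a' \<le> triple_form_size m nrm n c * vec_size m nrm n a * (\<Prod>j<m. s * \<epsilon> j)\<^sup>2"
    using isotropic_descent_step[OF R mm c a x close] by blast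
  moreover have "(\<Prod>j<m. if archimedean_norm (nrm j) then s * B j + s * \<epsilon> j else max (s * B j) (s * \<epsilon> j))
      = s ^ m * (\<Prod>j<m. if archimedean_norm (nrm j) then B j + \<epsilon> j else max (B j) (\<epsilon> j))"
  proof -
    have "(\<Prod>j<m. if archimedean_norm (nrm j) then s * B j + s * \<epsilon> j else max (s * B j) (s * \<epsilon> j))
      = (\<Prod>j<m. s * (if archimedean_norm (nrm j) then B j + \<epsilon> j else max (B j) (\<epsilon> j)))"
      using s by (intro prod.cong) (auto simp: max_def algebra_simps)
    then show ?thesis by (simp add: prod.distrib)
  qed
  moreover have "triple_form_size m nrm n c * vec_size m nrm n a * (\<Prod>j<m. s * \<epsilon> j)\<^sup>2
      = s ^ (2 * m) * (triple_form_size m nrm n c * vec_size m nrm n a * (\<Prod>j<m. \<epsilon> j)\<^sup>2)"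
    by (simp add: prod.distrib power_mult_distrib mult_ac flip: power_mult)
  ultimately have "vec_size m nrm n a' \<le> r" using s1 s2 by linarith
  with a' show ?thesis by blast
qed

section \<open>Norms of q-type\<close>

text \<open>
  In the presence of Archimedean norms the lengths need not form a discrete set, and a shortest vector
  need not be available. A fixed contraction factor and the lower bound \<open>1\<close> for all lengths take its place.
\<close>
lemma contraction_descent:
  fixes P :: "'a \<Rightarrow> real"
  assumes S: "S a0" and ge1: "\<And>a. S a \<Longrightarrow> 1 \<le> P a" and \<kappa>: "0 < \<kappa>" "\<kappa> < 1"
    and step: "\<And>a. S a \<Longrightarrow> T < P a \<Longrightarrow> \<exists>a'. S a' \<and> P a' \<le> \<kappa> * P a"
  shows "\<exists>a. S a \<and> P a \<le> T"
proof (rule ccontr)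
  assume "\<not> (\<exists>a. S a \<and> P a \<le> T)"
  then have large: "T < P a" if "S a" for a using that by force
  have iter: "\<exists>a. S a \<and> P a \<le> \<kappa> ^ k * P a0" for k
  proof (induction k)
    case (Suc k)
    then obtain a where a: "S a" "P a \<le> \<kappa> ^ k * P a0" by blast
    obtain a' where a': "S a'" "P a' \<le> \<kappa> * P a" using step[OF a(1) large[OF a(1)]] by blast
    have "\<kappa> * P a \<le> \<kappa> * (\<kappa> ^ k * P a0)" using a(2) \<kappa> by (intro mult_left_mono) auto
    then show ?case using a' by (intro exI[of _ a']) (simp add: mult.assoc)
  qed (use S in auto)
  have "(\<lambda>k. \<kappa> ^ k * P a0) \<longlonglongrightarrow> 0 * P a0"
    by (intro tendsto_intros LIMSEQ_power_zero) (use \<kappa> in auto)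
  then have "\<forall>\<^sub>F k in sequentially. \<kappa> ^ k * P a0 < 1"
    by (intro order_tendstoD(2)) auto
  then obtain k where "\<kappa> ^ k * P a0 < 1" by (auto simp: eventually_sequentially)
  moreover obtain a where "S a" "P a \<le> \<kappa> ^ k * P a0" using iter by blast
  ultimately show False using ge1[of a] by linarith
qed

lemma no_short_vector:
  assumes nd: "normed_dedekind_domain R N" and mm: "multimetric R N m nrm"
    and x: "x \<in> vecs_over R n" "x \<noteq> 0\<^sub>v n"
    and small: "\<And>i j. i < n \<Longrightarrow> j < m \<Longrightarrow> nrm j (x $ i) \<le> \<epsilon> j"
  shows "1 \<le> (\<Prod>j<m. \<epsilon> j)"
proof -
  have "x \<in> carrier_vec n" "\<And>i. i < n \<Longrightarrow> x $ i \<in> R" using x by (auto simp: vecs_over_def)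
  moreover from this have "\<exists>i<n. x $ i \<noteq> 0" using x(2) by (metis carrier_vecD eq_vecI index_zero_vec)
  ultimately obtain i where i: "i < n" "x $ i \<noteq> 0" "x $ i \<in> R" by blast
  have "1 \<le> elem_norm R N (x $ i)" by (rule elem_norm_ge_1[OF nd i(3,2)])
  also have "\<dots> = (\<Prod>j<m. nrm j (x $ i))" using mm unfolding multimetric_def by blast
  also have "\<dots> \<le> (\<Prod>j<m. \<epsilon> j)"
    by (rule prod_mono) (use small[OF i(1)] nrm_nonneg[OF multimetric_norm[OF mm]] in auto)
  finally show ?thesis .
qed

text \<open>
  Apply admissibility to the identity matrix with targets whose product over the norms is less than \<open>1\<close>:
  a nonzero entry of the resulting vector would be an element of \<open>R\<close> of norm less than \<open>1\<close>. This makes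
  the supremum \<open>C\<^sub>M\<close> a genuine one.
\<close>
lemma admissible_bound:
  assumes nd: "normed_dedekind_domain R N" and mm: "multimetric R N m nrm"
    and adm: "admissible R N m nrm qo n C"
    and tv: "\<And>j. j < m \<Longrightarrow> \<epsilon> j \<in> target_values qo (nrm j)" and "(\<Prod>j<m. \<epsilon> j) < 1"
  shows "C * (\<Prod>j<m. \<epsilon> j) ^ n < 1"
proof (rule ccontr)
  assume "\<not> C * (\<Prod>j<m. \<epsilon> j) ^ n < 1"
  then have "1 \<le> C * (\<Prod>i<n. \<Prod>j<m. \<epsilon> j)" by simp
  then have "\<exists>x\<in>vecs_over R n. x \<noteq> 0\<^sub>v n \<and> (\<forall>i<n. \<forall>j<m. nrm j ((1\<^sub>m n *\<^sub>v x) $ i) \<le> \<epsilon> j)"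
    using tv by (intro admissible_transvection[OF nd mm adm]) auto
  then obtain x where x: "x \<in> vecs_over R n" "x \<noteq> 0\<^sub>v n" "\<forall>i<n. \<forall>j<m. nrm j ((1\<^sub>m n *\<^sub>v x) $ i) \<le> \<epsilon> j" by blast
  then have "1\<^sub>m n *\<^sub>v x = x" by (simp add: vecs_over_def)
  then show False using no_short_vector[OF nd mm x(1,2), of \<epsilon>] x(3) assms(5) by simp
qed

lemma form_size_ge_1:
  assumes nd: "normed_dedekind_domain R N" and mm: "multimetric R N m nrm"
    and c: "i \<le> k" "k < n" "c i k \<in> R" "c i k \<noteq> 0"
  shows "1 \<le> form_size m nrm n c"
proof -
  have "1 \<le> elem_norm R N (c i k)" by (rule elem_norm_ge_1[OF nd c(3,4)])
  also have "\<dots> = (\<Prod>j<m. nrm j (c i k))" using mm unfolding multimetric_def by blast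
  also have "\<dots> \<le> (\<Prod>j<m. form_size_at (nrm j) n c)"
    using c nrm_nonneg[OF multimetric_norm[OF mm]] form_size_at_bounds(2)[OF multimetric_norm[OF mm]]
    by (intro prod_mono) auto
  finally show ?thesis by (simp add: form_size_def)
qed

lemma multimetric_pos:
  assumes nd: "normed_dedekind_domain R N" and mm: "multimetric R N m nrm"
  shows "0 < m"
proof (rule ccontr)
  assume "\<not> 0 < m"
  then have "elem_norm R N 0 = 1" using mm unfolding multimetric_def by simp
  then show False by (simp add: elem_norm_def)
qed

lemma int_powers_mult: "x \<in> int_powers q \<Longrightarrow> y \<in> int_powers q \<Longrightarrow> q \<noteq> 0 \<Longrightarrow> x * y \<in> int_powers q"
  by (auto simp: int_powers_def power_int_add[symmetric])

lemma int_powers_inverse: "x \<in> int_powers q \<Longrightarrow> inverse x \<in> int_powers q"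
  by (auto simp: int_powers_def power_int_minus[symmetric])

lemma int_powers_1: "1 \<in> int_powers q"
  unfolding int_powers_def by (rule image_eqI[of _ _ 0]) auto

lemma int_powers_prod:
  assumes "q \<noteq> 0" "\<And>i. i \<in> A \<Longrightarrow> g i \<in> int_powers q"
  shows "prod g A \<in> int_powers q"
  using assms(2) by (induction A rule: infinite_finite_induct) (simp_all add: int_powers_mult int_powers_1 assms(1))

lemma int_powers_pos: "x \<in> int_powers q \<Longrightarrow> 0 < q \<Longrightarrow> 0 < x"
  by (auto simp: int_powers_def)

text \<open>
  The admissible constants form a nonempty bounded set of integral powers of \<open>q\<close>, which has a largest
  element.
\<close>
lemma C_M_attained:
  assumes q: "1 < q" and ne: "\<exists>C. admissible R N m nrm (Some q) n C"
    and bdd: "\<And>C. admissible R N m nrm (Some q) n C \<Longrightarrow> C < K"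
  shows "admissible R N m nrm (Some q) n (C_M R N m nrm (Some q) n)"
proof -
  let ?S = "{C. admissible R N m nrm (Some q) n C}"
  have S: "?S \<noteq> {}" "bdd_above ?S" using ne bdd by (auto intro!: bdd_aboveI[of _ K] less_imp_le)
  have pw: "\<exists>z::int. C = q powi z" if "C \<in> ?S" for C
    using that by (auto simp: admissible_def target_values_def int_powers_def)
  have upper: "C \<le> Sup ?S" if "C \<in> ?S" for C using that S by (intro cSup_upper)
  obtain C0 where C0: "C0 \<in> ?S" using S by blast
  then have "0 < C0" using pw q by fastforce
  then have "0 < Sup ?S" using upper[OF C0] by linarith
  then have "Sup ?S / q < Sup ?S" using q by (simp add: divide_less_eq)
  then obtain C where C: "C \<in> ?S" "Sup ?S / q < C" using less_cSupE[OF _ S(1)] by blast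
  obtain z where z: "C = q powi z" using pw[OF C(1)] by blast
  have "C' \<le> C" if "C' \<in> ?S" for C'
  proof (rule ccontr)
    assume "\<not> C' \<le> C"
    obtain z' where z': "C' = q powi z'" using pw[OF \<open>C' \<in> ?S\<close>] by blast
    have "z < z'"
    proof (rule ccontr)
      assume "\<not> z < z'"
      then have "q powi z' \<le> q powi z" using q by (intro power_int_increasing) auto
      then show False using \<open>\<not> C' \<le> C\<close> z z' by simp
    qed
    then have "q powi (z + 1) \<le> q powi z'" using q by (intro power_int_increasing) auto
    then have "C * q \<le> C'" using q z z' by (simp add: power_int_add)
    moreover have "Sup ?S < C * q" using C(2) q by (simp add: divide_less_eq)
    ultimately show False using upper[OF \<open>C' \<in> ?S\<close>] by linarith
  qed
  then have "Sup ?S = C" using C(1) by (intro cSup_eq_maximum)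
  then show ?thesis using C(1) by (simp add: C_M_def)
qed

lemma prod_scaled_at:
  fixes g :: "nat \<Rightarrow> real"
  assumes "j0 < m"
  shows "(\<Prod>j<m. g j * (if j = j0 then x else 1)) = (\<Prod>j<m. g j) * x"
  using assms by (simp add: prod.distrib)

text \<open>
  Let \<open>q\<^sup>d\<close> be the length of \<open>a\<close>. In one nontrivial norm the target for the pivot is taken a factor \<open>q\<close>
  below the size of \<open>a\<close>, and the other targets are distributed so that their product over the norms is
  \<open>q\<^sup>e\<close> with \<open>e\<close> as large as \<open>|f| q\<^bsup>2e\<^esup> \<le> 1/q\<close> permits. Then both \<open>b\<close> and \<open>a*\<close> gain a factor \<open>q\<close>, and the
  condition of admissibility says that the integer \<open>c\<^sub>M + (d - 1) + (n - 1)e\<close> is nonnegative.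
\<close>
lemma small_isotropic_vector_discrete_type:
  fixes R :: "'k::field set"
  assumes nd: "normed_dedekind_domain R N" and mm: "multimetric R N m nrm"
    and vb: "valid_base m nrm (Some q)"
    and lt: "multimetric_linear_type R N m nrm (Some q)"
    and cR: "\<And>i k. i \<le> k \<Longrightarrow> k < n \<Longrightarrow> c i k \<in> R"
    and c0: "i1 \<le> k1" "k1 < n" "c i1 k1 \<noteq> 0"
    and iso: "isotropic_vector R n c a0"
  shows "\<exists>a. isotropic_vector R n c a \<and>
             max_deg R N q n a
               \<le> real m * real n - 1 - log q (C_M R N m nrm (Some q) n)
                 + ((real n - 1) / 2) * log q (form_size m nrm n c)"
proof -
  have q: "1 < q" and vg: "\<And>j. j < m \<Longrightarrow> value_group (nrm j) \<subseteq> int_powers q"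
    using vb by (auto simp: valid_base_def)
  have q0: "q \<noteq> 0" using q by simp
  have m: "0 < m" by (rule multimetric_pos[OF nd mm])
  have n: "0 < n" using c0 by simp
  note nj = multimetric_norm[OF mm]
  have val: "nrm j x \<in> int_powers q" if "j < m" "x \<noteq> 0" for j x
    using vg[OF that(1)] that(2) by (auto simp: value_group_def)
  have nonarch: "\<not> archimedean_norm (nrm j)" if "j < m" for j
    using not_archimedean_if_discrete_values[OF nj[OF that] q vg[OF that]] .
  have tv: "target_values (Some q) f = int_powers q" for f :: "'k \<Rightarrow> real"
    by (simp add: target_values_def)
  define C where "C = C_M R N m nrm (Some q) n"
  have bound: "C < q ^ (m * n)" if "admissible R N m nrm (Some q) n C" for C
  proof -
    have "inverse q \<in> int_powers q"
      unfolding int_powers_def by (rule image_eqI[of _ _ "-1"]) (auto simp: power_int_minus)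
    moreover have "inverse q ^ m < 1" using q m by (simp add: power_less_one_iff inverse_less_1_iff)
    ultimately have "C * (inverse q ^ m) ^ n < 1"
      using admissible_bound[OF nd mm that, of "\<lambda>_. inverse q"] by (simp add: tv)
    then show ?thesis using q by (simp add: power_mult[symmetric] power_inverse field_simps)
  qed
  have adm: "admissible R N m nrm (Some q) n C"
    unfolding C_def using lt n by (intro C_M_attained[OF q _ bound]) (auto simp: multimetric_linear_type_def)
  then obtain cz :: int where cz: "C = q powi cz"
    by (auto simp: admissible_def target_values_def int_powers_def)
  have cz_le: "cz \<le> int (m * n) - 1"
  proof (rule ccontr)
    assume "\<not> cz \<le> int (m * n) - 1"
    then have "q powi int (m * n) \<le> q powi cz" using q by (intro power_int_increasing) auto
    then show False using bound[OF adm] cz by (simp only: power_int_of_nat)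
  qed
  define F where "F = form_size m nrm n c"
  have F1: "1 \<le> F" unfolding F_def using form_size_ge_1[where c = c, OF nd mm c0(1,2) cR[OF c0(1,2)] c0(3)] .
  have triple: "triple_form_size m nrm n c = F"
    using nonarch by (auto simp: triple_form_size_def F_def archimedean_indices_def intro!: prod.neutral)
  have "F \<in> int_powers q"
    unfolding F_def form_size_def
  proof (rule int_powers_prod)
    fix j assume "j \<in> {..<m}"
    then have j: "j < m" by simp
    have ne: "form_indices n \<noteq> {}" using c0 by (auto simp: form_indices_def)
    have "form_size_at (nrm j) n c \<in> (\<lambda>(i, k). nrm j (c i k)) ` form_indices n"
      using nonarch[OF j] ne finite_form_indices by (simp add: form_size_at_def del: Max_in) (rule Max_in, auto)
    then obtain i k where "form_size_at (nrm j) n c = nrm j (c i k)" by auto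
    moreover have "0 < form_size_at (nrm j) n c"
      using form_size_at_bounds(2)[where f = "nrm j" and c = c and n = n, OF nj[OF j] n c0(1,2)] nrm_pos[OF nj[OF j] c0(3)] by linarith
    ultimately show "form_size_at (nrm j) n c \<in> int_powers q"
      using val[OF j, of "c i k"] nrm_0[OF nj[OF j]] by fastforce
  qed (use q in auto)
  then obtain fz :: int where fz: "F = q powi fz" by (auto simp: int_powers_def)
  have fz0: "0 \<le> fz"
  proof (rule ccontr)
    assume "\<not> 0 \<le> fz"
    then have "q powi fz < q powi 0" using q by (intro power_int_strict_increasing) auto
    then show False using F1 fz by simp
  qed
  define \<tau> where "\<tau> = real m * real n - 1 - real_of_int cz + (real n - 1) / 2 * real_of_int fz"
  have "\<exists>a. isotropic_vector R n c a \<and> vec_size m nrm n a \<le> q powr \<tau>"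
  proof (rule contraction_descent[where S = "isotropic_vector R n c" and \<kappa> = "1 / sqrt q", OF iso])
    show "1 \<le> vec_size m nrm n a" if "isotropic_vector R n c a" for a
      by (rule vec_size_isotropic_ge_1[OF nd mm that])
    fix a assume a: "isotropic_vector R n c a" and large: "q powr \<tau> < vec_size m nrm n a"
    define A where "A j = nrm j (a $ pivot n (vec_index a) (nrm j))" for j
    have size: "vec_size m nrm n a = (\<Prod>j<m. A j)"
      unfolding A_def by (rule vec_size_eq_prod_pivot[OF n])
    have A1: "1 \<le> (\<Prod>j<m. A j)" using vec_size_isotropic_ge_1[OF nd mm a] size by simp
    obtain l where l: "l < n" "a $ l \<noteq> 0" using isotropic_vector_nonzero_entry[OF a] .
    have a_pivot: "a $ pivot n (vec_index a) (nrm j) \<noteq> 0" if "j < m" for j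
      using pivot(2)[where f = "nrm j" and a = "vec_index a", OF n l(1)] nrm_pos[OF nj[OF that] l(2)] nrm_0[OF nj[OF that]] by auto
    have A_pow: "A j \<in> int_powers q" if "j < m" for j
      unfolding A_def using val[OF that a_pivot[OF that]] .
    have A_triv: "A j = 1" if "j < m" "trivial_norm (nrm j)" for j
      using that a_pivot unfolding A_def trivial_norm_def by blast
    obtain dz :: int where dz: "(\<Prod>j<m. A j) = q powi dz"
      using int_powers_prod[of q "{..<m}" A] A_pow q by (auto simp: int_powers_def)
    \<comment> \<open>If all norms are trivial, then all lengths are \<open>1\<close>, and \<open>c\<^sub>M \<le> mn - 1\<close> shows \<open>\<tau> \<ge> 0\<close>.\<close>
    have "\<exists>j0<m. \<not> trivial_norm (nrm j0)"
    proof (rule ccontr)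
      assume "\<not> (\<exists>j0<m. \<not> trivial_norm (nrm j0))"
      then have "(\<Prod>j<m. A j) = 1" using A_triv by (intro prod.neutral) auto
      moreover have "0 \<le> \<tau>"
      proof -
        have "real_of_int cz \<le> real_of_int (int (m * n) - 1)" using cz_le by (simp only: of_int_le_iff)
        moreover have "0 \<le> (real n - 1) / 2 * real_of_int fz" using n fz0 by simp
        ultimately show ?thesis by (simp add: \<tau>_def)
      qed
      then have "1 \<le> q powr \<tau>" using q by (simp add: ge_one_powr_ge_zero)
      ultimately show False using large size by simp
    qed
    then obtain j0 where j0: "j0 < m" "\<not> trivial_norm (nrm j0)" by blast
    \<comment> \<open>Each of \<open>n - 1\<close> forms loses at most \<open>1\<close>: one half by rounding down, one half for the factor
      \<open>1/q\<close>. With the \<open>1\<close> for the pivot this is a loss of at most \<open>n \<le> mn\<close>, and since all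
      exponents are integers, a margin of more than \<open>mn - 1\<close> covers it.\<close>
    define e where "e = (- 1 - fz) div 2"
    have e: "2 * e \<le> - 1 - fz" "- 2 - fz \<le> 2 * e" "e \<le> - 1" using fz0 unfolding e_def by linarith+
    define P where "P = (\<Prod>j<m. A j)"
    have P1: "1 \<le> P" using A1 by (simp add: P_def)
    define B where "B j = A j * (if j = j0 then inverse q else 1)" for j
    define \<epsilon> where "\<epsilon> j = A j * (if j = j0 then q powi e * inverse P else 1)" for j
    have prods: "(\<Prod>j<m. B j) = P / q" "(\<Prod>j<m. \<epsilon> j) = q powi e"
      unfolding B_def \<epsilon>_def prod_scaled_at[OF j0(1)] using P1 by (auto simp: P_def[symmetric] field_simps)
    have P_pow: "P \<in> int_powers q" unfolding P_def by (rule int_powers_prod) (use A_pow q in auto)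
    have q_pow: "q \<in> int_powers q" "q powi e \<in> int_powers q"
      unfolding int_powers_def by (auto intro: image_eqI[of _ _ 1])
    have pow: "B j \<in> int_powers q" "\<epsilon> j \<in> int_powers q" if "j < m" for j
      unfolding B_def \<epsilon>_def using q that
      by (auto intro!: int_powers_mult int_powers_inverse A_pow P_pow q_pow int_powers_1)
    have pos: "0 < B j" "0 < \<epsilon> j" "0 < A j" if "j < m" for j
      using pow[OF that] A_pow[OF that] q by (auto intro: int_powers_pos)
    have \<epsilon>B: "\<epsilon> j \<le> B j" if "j < m" for j
    proof (cases "j = j0")
      case True
      have "q powi (e + 1) \<le> q powi 0" using q e by (intro power_int_increasing) auto
      then have "q powi e * q \<le> P" using P1 q by (simp add: power_int_add)
      then have "q powi e * inverse P \<le> inverse q" using P1 q by (simp add: field_simps)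
      then show ?thesis using True pos(3)[OF that] by (simp add: B_def \<epsilon>_def)
    qed (simp add: B_def \<epsilon>_def)
    have P_sqrt: "P / q < P / sqrt q"
    proof -
      have "1 * sqrt q < sqrt q * sqrt q" using q by (intro mult_strict_right_mono) auto
      then have "sqrt q < q" using q by simp
      then show ?thesis using P1 q by (intro divide_strict_left_mono) auto
    qed
    \<comment> \<open>The gain is a factor \<open>q\<close>; settling for its square root provides the strict inequalities.\<close>
    have "\<exists>a'. isotropic_vector R n c a' \<and> vec_size m nrm n a' \<le> P / sqrt q"
    proof (rule isotropic_descent[OF nd mm adm cR a])
      show "B j \<in> target_values (Some q) (nrm j) \<and> \<epsilon> j \<in> target_values (Some q) (nrm j)" if "j < m" for j
        using pow[OF that] by (simp add: tv)
      show "0 < B j \<and> 0 < \<epsilon> j" if "j < m" for j using pos[OF that] by simp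
      show "\<epsilon> j = 1" if "j < m" "trivial_norm (nrm j)" for j
        using A_triv[OF that] that j0 by (auto simp: \<epsilon>_def)
      show "(\<Prod>j<m. if archimedean_norm (nrm j) then B j + \<epsilon> j else max (B j) (\<epsilon> j)) < P / sqrt q"
      proof -
        have "(\<Prod>j<m. if archimedean_norm (nrm j) then B j + \<epsilon> j else max (B j) (\<epsilon> j)) = (\<Prod>j<m. B j)"
          using nonarch \<epsilon>B by (intro prod.cong) auto
        then show ?thesis using prods P_sqrt by simp
      qed
      show "triple_form_size m nrm n c * vec_size m nrm n a * (\<Prod>j<m. \<epsilon> j)\<^sup>2 < P / sqrt q"
      proof -
        have "triple_form_size m nrm n c * vec_size m nrm n a * (\<Prod>j<m. \<epsilon> j)\<^sup>2 = P * (F * (q powi e)\<^sup>2)"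
          by (simp add: triple size prods P_def)
        also have "F * (q powi e)\<^sup>2 = q powi (fz + 2 * e)"
          by (simp only: fz power2_eq_square mult_2 power_int_add[OF disjI1[OF q0]])
        also have "\<dots> \<le> q powi (- 1)" using q e by (intro power_int_increasing) auto
        also have "\<dots> = inverse q" by (simp add: power_int_minus)
        finally have "triple_form_size m nrm n c * vec_size m nrm n a * (\<Prod>j<m. \<epsilon> j)\<^sup>2 \<le> P / q"
          using P1 by (simp add: divide_inverse)
        then show ?thesis using P_sqrt by simp
      qed
      show "1 \<le> C * (\<Prod>j<m. B j * \<epsilon> j ^ (n - 1))"
      proof -
        have "C * (\<Prod>j<m. B j * \<epsilon> j ^ (n - 1)) = C * (P / q * (q powi e) ^ (n - 1))"
          by (simp only: prod.distrib prod_power_distrib[symmetric] prods)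
        also have "P / q = q powi (dz - 1)" using q dz by (simp add: P_def power_int_diff)
        also have "(q powi e) ^ (n - 1) = q powi (e * int (n - 1))" by (simp add: power_int_mult)
        also have "C * (q powi (dz - 1) * q powi (e * int (n - 1))) = q powi (cz + (dz - 1 + e * int (n - 1)))"
          by (simp only: cz power_int_add[OF disjI1[OF q0]])
        also have "\<dots> \<ge> 1"
        proof -
          have "\<tau> < real_of_int dz"
            using large q by (simp add: size dz powr_real_of_int'[symmetric])
          moreover have "(- 2 - real_of_int fz) / 2 * (real n - 1) \<le> real_of_int e * (real n - 1)"
          proof (rule mult_right_mono)
            have "real_of_int (- 2 - fz) \<le> real_of_int (2 * e)" using e(2) by (simp only: of_int_le_iff)
            then show "(- 2 - real_of_int fz) / 2 \<le> real_of_int e" by simp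
          qed (use n in simp)
          moreover have "1 * real n \<le> real m * real n" using m by (intro mult_right_mono) auto
          ultimately have key: "- 1 < real_of_int cz + (real_of_int dz - 1 + real_of_int e * (real n - 1))"
            by (simp add: \<tau>_def field_simps)
          have rn: "real n - 1 = real_of_int (int (n - 1))" using n by simp
          have "real_of_int (- 1) < real_of_int (cz + (dz - 1 + e * int (n - 1)))"
            using key unfolding rn by (simp only: of_int_add of_int_mult of_int_diff of_int_minus of_int_1)
          then have "0 \<le> cz + (dz - 1 + e * int (n - 1))" by (simp only: of_int_less_iff)
          then have "q powi 0 \<le> q powi (cz + (dz - 1 + e * int (n - 1)))"
            using q by (intro power_int_increasing) auto
          then show ?thesis by simp
        qed
        finally show ?thesis .
      qed
    qed
    then show "\<exists>a'. isotropic_vector R n c a' \<and> vec_size m nrm n a' \<le> 1 / sqrt q * vec_size m nrm n a"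
      by (simp add: size P_def)
  qed (use q in auto)
  then obtain a where a: "isotropic_vector R n c a" "vec_size m nrm n a \<le> q powr \<tau>" by blast
  have "max_deg R N q n a \<le> \<tau>"
    unfolding max_deg_def
  proof (rule Max.boundedI)
    obtain l where "l < n" "a $ l \<noteq> 0" using isotropic_vector_nonzero_entry[OF a(1)] .
    then show "(\<lambda>i. log q (elem_norm R N (a $ i))) ` {i. i < n \<and> a $ i \<noteq> 0} \<noteq> {}" by blast
    fix x assume "x \<in> (\<lambda>i. log q (elem_norm R N (a $ i))) ` {i. i < n \<and> a $ i \<noteq> 0}"
    then obtain i where i: "i < n" "a $ i \<noteq> 0" "x = log q (elem_norm R N (a $ i))" by blast
    have "a $ i \<in> R" using a(1) i by (simp add: isotropic_vector_def vecs_over_def)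
    then have "0 < elem_norm R N (a $ i)" using elem_norm_ge_1[OF nd _ i(2)] by fastforce
    moreover have "elem_norm R N (a $ i) \<le> q powr \<tau>" using elem_norm_le_vec_size[OF mm i(1), of a] a(2) by linarith
    ultimately show "x \<le> \<tau>" using q i(3) by (simp add: log_le_iff)
  qed auto
  moreover have "log q C = real_of_int cz" "log q F = real_of_int fz"
    using q by (simp_all add: cz fz powr_real_of_int'[symmetric])
  ultimately show ?thesis using a(1) unfolding C_def[symmetric] F_def[symmetric] \<tau>_def by auto
qed

section \<open>The integers\<close>

text \<open>
  The cubes with side \<open>t + 1\<close> attached to the \<open>A\<close> multiples of \<open>z\<close> modulo \<open>A\<close> cannot be disjoint for
  reasons of volume. The difference of two multiples whose cubes meet is a multiple of \<open>z\<close> that is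
  congruent to a vector \<open>r\<close> with entries at most \<open>t\<close>. The coordinate \<open>k\<close> is left out since \<open>z\<^sub>k\<close> vanishes
  modulo \<open>A\<close>.
\<close>
lemma centred_pigeonhole:
  fixes z :: "nat \<Rightarrow> int"
  assumes k: "k < n" "\<bar>z k\<bar> = int A" and t: "t < A" and big: "A ^ (n - 1) < A * (t + 1) ^ (n - 1)"
  shows "\<exists>v r. v \<noteq> 0 \<and> \<bar>v\<bar> < int A \<and> r k = 0 \<and> (\<forall>i<n. \<bar>r i\<bar> \<le> int t \<and> int A dvd v * z i - r i)"
proof -
  define I where "I = {..<n} - {k}"
  have I: "finite I" "card I = n - 1" using k by (auto simp: I_def)
  define D where "D = {0..<int A} \<times> (I \<rightarrow>\<^sub>E {0..int t})"
  define g where "g = (\<lambda>(u, s). \<lambda>i\<in>I. (s i + u * z i) mod int A)"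
  have A: "0 < A" using t by simp
  have cardD: "card D = A * (t + 1) ^ (n - 1)"
    using I by (simp add: D_def card_cartesian_product card_PiE nat_add_distrib)
  have finD: "finite D" unfolding D_def using I by (intro finite_cartesian_product finite_PiE) auto
  have "g ` D \<subseteq> I \<rightarrow>\<^sub>E {0..<int A}" using A by (auto simp: g_def)
  moreover have "card (I \<rightarrow>\<^sub>E {0..<int A}) = A ^ (n - 1)" using I by (simp add: card_PiE)
  moreover have "finite (I \<rightarrow>\<^sub>E {0..<int A})" using I by (intro finite_PiE) auto
  ultimately have "card (g ` D) \<le> A ^ (n - 1)" by (metis card_mono)
  then have "\<not> inj_on g D" using big cardD card_image[of g D] by auto
  then obtain u s u' s' where D: "(u, s) \<in> D" "(u', s') \<in> D" "g (u, s) = g (u', s')" "(u, s) \<noteq> (u', s')"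
    unfolding inj_on_def by auto
  have dvd: "int A dvd (u - u') * z i - (s' i - s i)" if "i \<in> I" for i
  proof -
    have "(s i + u * z i) mod int A = (s' i + u' * z i) mod int A"
      using fun_cong[OF D(3), of i] that by (simp add: g_def)
    then have "int A dvd (s i + u * z i) - (s' i + u' * z i)" by (simp add: mod_eq_dvd_iff)
    then show ?thesis by (simp add: algebra_simps)
  qed
  have s: "0 \<le> s i" "s i \<le> int t" "0 \<le> s' i" "s' i \<le> int t" if "i \<in> I" for i
    using D that by (auto simp: D_def PiE_iff)
  have u: "0 \<le> u" "u < int A" "0 \<le> u'" "u' < int A" using D by (auto simp: D_def)
  have "u \<noteq> u'"
  proof
    assume eq: "u = u'"
    have "s i = s' i" if "i \<in> I" for i
    proof -
      have "int A dvd s' i - s i" using dvd[OF that] eq by (simp add: dvd_diff_commute)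
      moreover have "\<bar>s' i - s i\<bar> < int A" using s[OF that] t by linarith
      ultimately show ?thesis using dvd_imp_le_int[of "s' i - s i" "int A"] by linarith
    qed
    moreover have "s \<in> I \<rightarrow>\<^sub>E {0..int t}" "s' \<in> I \<rightarrow>\<^sub>E {0..int t}" using D by (auto simp: D_def)
    ultimately have "s = s'" by (intro PiE_ext)
    then show False using D(4) eq by simp
  qed
  moreover have "\<bar>u - u'\<bar> < int A" using u by linarith
  moreover have "int A dvd (u - u') * z k" 
    using dvd_abs_iff[of "int A" "z k"] k(2) by simp
  moreover define r where "r i = (if i = k then 0 else s' i - s i)" for i
  have "\<bar>r i\<bar> \<le> int t \<and> int A dvd (u - u') * z i - r i" if "i < n" for i
  proof (cases "i = k")
    case True
    then show ?thesis using \<open>int A dvd (u - u') * z k\<close> by (simp add: r_def)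
  next
    case False
    then have "i \<in> I" using that by (simp add: I_def)
    from dvd[OF this] s[OF this] show ?thesis using False by (simp add: r_def)
  qed
  ultimately show ?thesis
    by (intro exI[of _ "u - u'"] exI[of _ r]) (auto simp: r_def)
qed

text \<open>
  Here lengths are natural numbers, and a shortest isotropic vector \<open>a\<close> exists. If its length \<open>A\<close>
  exceeded \<open>Y\<^bsup>n-1\<^esup>\<close> with \<open>Y\<^sup>2 = 3|f|\<close>, the pigeonhole principle would give a multiple \<open>va\<close> with
  \<open>0 < |v| < A\<close> and \<open>va \<equiv> r\<close> modulo \<open>A\<close>, and \<open>b = (va - r)/A\<close> would be an integral vector with
  \<open>|b - (v/A)a| \<le> t/A < 1/Y\<close> and \<open>|b| < A\<close>.
\<close>
lemma small_isotropic_vector_int: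
  fixes nrm :: "nat \<Rightarrow> 'k::field \<Rightarrow> real"
  assumes nd: "normed_dedekind_domain \<int> N" and mm: "multimetric \<int> N 1 nrm"
    and nrm: "\<And>z::int. nrm 0 (of_int z) = real_of_int \<bar>z\<bar>"
    and cR: "\<And>i k. i \<le> k \<Longrightarrow> k < n \<Longrightarrow> c i k \<in> \<int>"
    and c0: "i1 \<le> k1" "k1 < n" "c i1 k1 \<noteq> 0"
    and iso: "isotropic_vector \<int> n c a0"
  shows "\<exists>a. isotropic_vector \<int> n c a \<and> vec_size 1 nrm n a \<le> (3 * form_size 1 nrm n c) powr ((real n - 1) / 2)"
proof -
  note R = dedekind_subring[OF nd]
  have n: "0 < n" using c0 by simp
  have n0: "normalized_norm (nrm 0)" using multimetric_norm[OF mm] by simp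
  have arch: "archimedean_norm (nrm 0)"
  proof (rule ccontr)
    assume "\<not> archimedean_norm (nrm 0)"
    from ultrametric_if_not_archimedean[OF n0 this, of 1 1] show False
      using nrm[of 2] nrm_1[OF n0] by simp
  qed
  define F where "F = form_size 1 nrm n c"
  have triple: "triple_form_size 1 nrm n c = 3 * F"
    using arch nrm[of 3] by (simp add: triple_form_size_eq_prod F_def form_size_def)
  obtain w where w: "c i1 k1 = of_int w" using cR[OF c0(1,2)] by (auto elim: Ints_cases)
  then have "w \<noteq> 0" using c0(3) by auto
  then have "1 \<le> nrm 0 (c i1 k1)" using nrm[of w] w by simp
  also have "\<dots> \<le> F"
    using form_size_at_bounds(2)[where f = "nrm 0" and c = c, OF n0 n c0(1,2)] by (simp add: F_def form_size_def)
  finally have F1: "1 \<le> F" .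
  define Y where "Y = sqrt (3 * F)"
  have Y: "1 < Y" "Y\<^sup>2 = 3 * F" "0 < Y" using F1 by (auto simp: Y_def real_less_rsqrt)
  have Ypow: "(3 * F) powr ((real n - 1) / 2) = Y ^ (n - 1)"
  proof -
    have rn: "real n - 1 = real (n - 1)" using n by simp
    have "(3 * F) powr (real (n - 1) / 2) = ((3 * F) powr (1 / 2)) powr real (n - 1)"
      by (simp add: powr_powr)
    also have "(3 * F) powr (1 / 2) = Y" using F1 by (simp add: Y_def powr_half_sqrt)
    also have "Y powr real (n - 1) = Y ^ (n - 1)" by (rule powr_realpow[OF Y(3)])
    finally show ?thesis unfolding rn .
  qed
  obtain a where a: "isotropic_vector \<int> n c a"
    and least: "\<And>a'. isotropic_vector \<int> n c a' \<Longrightarrow> nat \<lfloor>vec_size 1 nrm n a\<rfloor> \<le> nat \<lfloor>vec_size 1 nrm n a'\<rfloor>"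
    using ex_has_least_nat[of "isotropic_vector \<int> n c" a0 "\<lambda>a. nat \<lfloor>vec_size 1 nrm n a\<rfloor>"] iso by blast
  have "\<forall>i. \<exists>z. i < n \<longrightarrow> a $ i = of_int z"
    using a by (auto simp: isotropic_vector_def vecs_over_def elim: Ints_cases)
  then obtain z where z: "\<And>i. i < n \<Longrightarrow> a $ i = of_int (z i)" by metis
  define k where "k = pivot n (vec_index a) (nrm 0)"
  define A where "A = nat \<bar>z k\<bar>"
  have k: "k < n" unfolding k_def by (rule pivot(1)[OF n])
  have size: "vec_size 1 nrm n a = real A"
    using z[OF k] nrm[of "z k"] by (simp add: vec_size_eq_prod_pivot[OF n] k_def[symmetric] A_def)
  have A1: "1 \<le> real A" using vec_size_isotropic_ge_1[OF nd mm a] size by simp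
  have zA: "\<bar>z i\<bar> \<le> int A" if "i < n" for i
    using pivot(2)[where f = "nrm 0" and a = "vec_index a", OF n that] z[OF that] z[OF k] nrm
    by (simp add: k_def[symmetric] A_def)
  have "real A \<le> Y ^ (n - 1)"
  proof (rule ccontr)
    assume "\<not> real A \<le> Y ^ (n - 1)"
    then have large: "Y ^ (n - 1) < real A" by simp
    \<comment> \<open>The largest integer that is strictly less than \<open>A/Y\<close>. The pigeonhole count uses \<open>t + 1 \<ge> A/Y\<close>.\<close>
    define t where "t = nat (\<lceil>real A / Y\<rceil> - 1)"
    have AY: "0 < real A / Y" using A1 Y by simp
    then have "0 \<le> \<lceil>real A / Y\<rceil> - 1" by (simp add: less_ceiling_iff)
    then have "real t = real_of_int \<lceil>real A / Y\<rceil> - 1" unfolding t_def by simp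
    then have t: "real t < real A / Y" "real A / Y \<le> real t + 1" by linarith+
    have "real A / Y < real A" using A1 Y by (simp add: divide_less_eq)
    with t(1) have tA: "t < A" by linarith
    have "real A ^ (n - 1) < real A * (real t + 1) ^ (n - 1)"
    proof -
      have "real A ^ (n - 1) * Y ^ (n - 1) < real A ^ (n - 1) * real A"
        using large A1 by (intro mult_strict_left_mono) auto
      then have "real A ^ (n - 1) < real A * (real A / Y) ^ (n - 1)"
        using Y by (simp add: power_divide field_simps)
      also have "\<dots> \<le> real A * (real t + 1) ^ (n - 1)"
        using t(2) AY A1 by (intro mult_left_mono power_mono) auto
      finally show ?thesis .
    qed
    then have "real (A ^ (n - 1)) < real (A * (t + 1) ^ (n - 1))" by (simp add: add.commute)
    then have "A ^ (n - 1) < A * (t + 1) ^ (n - 1)" by (simp only: of_nat_less_iff)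
    moreover have "\<bar>z k\<bar> = int A" by (simp add: A_def)
    ultimately obtain v r where v: "v \<noteq> 0" "\<bar>v\<bar> < int A" and rk: "r k = 0"
      and r: "\<And>i. i < n \<Longrightarrow> \<bar>r i\<bar> \<le> int t" "\<And>i. i < n \<Longrightarrow> int A dvd v * z i - r i"
      using centred_pigeonhole[OF k _ tA] by blast
    define b where "b = vec n (\<lambda>i. of_int ((v * z i - r i) div int A) :: 'k)"
    have Ab: "int A * ((v * z i - r i) div int A) = v * z i - r i" if "i < n" for i
      using r(2)[OF that] by simp
    have char: "of_int x = (0 :: 'k) \<longleftrightarrow> x = 0" for x
      using nrm[of x] nrm_eq_0_iff[OF n0, of "of_int x"] by simp
    have bR: "b \<in> vecs_over \<int> n" by (simp add: b_def vecs_over_def)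
    have b0: "b \<noteq> 0\<^sub>v n"
    proof
      assume "b = 0\<^sub>v n"
      then have "b $ k = 0" using k by simp
      then have "(v * z k - r k) div int A = 0" using k char by (simp add: b_def)
      then have "v * z k = 0" using Ab[OF k] rk by simp
      then show False using v(1) A1 by (simp add: A_def)
    qed
    define \<mu> where "\<mu> = of_int v / (of_int (int A) :: 'k)"
    have A0: "of_int (int A) \<noteq> (0 :: 'k)" using A1 by (simp only: char)
    have nA: "nrm 0 (of_int (int A)) = real A" using nrm[of "int A"] by simp
    have diff: "b $ i - \<mu> * a $ i = of_int (- r i) / of_int (int A)" if "i < n" for i
    proof -
      have "of_int (int A) * b $ i = of_int (int A * ((v * z i - r i) div int A))"
        using that by (simp add: b_def)
      also have "\<dots> = of_int v * of_int (z i) - of_int (r i)" unfolding Ab[OF that] by simp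
      finally have b: "b $ i = (of_int v * of_int (z i) - of_int (r i)) / of_int (int A)"
        using A0 by (simp add: eq_divide_eq mult.commute)
      show ?thesis unfolding b z[OF that] \<mu>_def by (simp add: diff_divide_distrib)
    qed
    have close: "\<exists>\<mu>. nrm j \<mu> * nrm j (a $ pivot n (vec_index a) (nrm j)) \<le> real A - 1 \<and>
        (\<forall>i<n. nrm j (b $ i - \<mu> * a $ i) \<le> real t / real A)" if "j < 1" for j
    proof (intro exI[of _ \<mu>] conjI allI impI)
      have j: "j = 0" using that by simp
      have "nrm 0 (a $ k) = real A" using z[OF k] nrm[of "z k"] by (simp add: A_def)
      then have "nrm 0 \<mu> * nrm 0 (a $ k) = real_of_int \<bar>v\<bar>"
        unfolding \<mu>_def nrm_divide[OF n0] nA nrm using A1 by simp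
      also have "\<dots> \<le> real A - 1" using v(2) by linarith
      finally show "nrm j \<mu> * nrm j (a $ pivot n (vec_index a) (nrm j)) \<le> real A - 1"
        by (simp add: j k_def)
      fix i assume i: "i < n"
      have "real_of_int \<bar>r i\<bar> \<le> real t" using r(1)[OF i] by linarith
      then show "nrm j (b $ i - \<mu> * a $ i) \<le> real t / real A"
        unfolding diff[OF i] j nrm_divide[OF n0] nA nrm using A1 by (simp add: divide_right_mono)
    qed
    obtain a' where a': "isotropic_vector \<int> n c a'"
      and "vec_size 1 nrm n a' \<le> (\<Prod>j<1. if archimedean_norm (nrm j) then (real A - 1) + real t / real A else max (real A - 1) (real t / real A)) \<or>
       vec_size 1 nrm n a' \<le> triple_form_size 1 nrm n c * vec_size 1 nrm n a * (\<Prod>j<1::nat. real t / real A)\<^sup>2"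
      using isotropic_descent_step[OF R mm cR a bR b0 close] by blast
    moreover have "(real A - 1) + real t / real A < real A"
      using tA by simp
    moreover have "3 * F * real A * (real t / real A)\<^sup>2 < real A"
    proof -
      have "real t * Y < real A" using t(1) Y by (simp add: less_divide_eq)
      then have "(real t * Y)\<^sup>2 < (real A)\<^sup>2" using Y by (intro power_strict_mono) auto
      then have "3 * F * (real t)\<^sup>2 < (real A)\<^sup>2" by (simp add: power_mult_distrib Y(2) mult.commute)
      then show ?thesis using A1 by (simp add: power2_eq_square field_simps)
    qed
    ultimately have "vec_size 1 nrm n a' < real A"
      using arch unfolding triple size by auto
    then have "\<lfloor>vec_size 1 nrm n a'\<rfloor> < int A" by (simp add: floor_less_iff)
    moreover have "0 \<le> \<lfloor>vec_size 1 nrm n a'\<rfloor>" using vec_size_isotropic_ge_1[OF nd mm a'] by simp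
    moreover have "A \<le> nat \<lfloor>vec_size 1 nrm n a'\<rfloor>" using least[OF a'] unfolding size by simp
    ultimately show False by linarith
  qed
  then show ?thesis using a size Ypow unfolding F_def by auto
qed

section \<open>Archimedean norms\<close>

lemma prod_if_card:
  fixes x :: real
  shows "(\<Prod>j<m. if archimedean_norm (nrm j) then x else 1) = x ^ card (archimedean_indices m nrm)"
proof -
  have "(\<Prod>j<m. if archimedean_norm (nrm j) then x else 1) = (\<Prod>j\<in>archimedean_indices m nrm. x)"
    by (simp add: prod.inter_filter[symmetric] archimedean_indices_def)
  then show ?thesis by simp
qed

text \<open>
  Non-Archimedean norms have too few values to allow fine tuning, so there both targets are simply the size of
  \<open>a\<close>; the Archimedean norms, where every positive real is a target, make up for this. At each of them
  the target for the pivot is the fraction \<open>\<zeta> = \<eta>\<^bsup>1/m'\<^esup>\<close> of the size of \<open>a\<close>, and the others are at most the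
  fraction \<open>1 - \<zeta>\<close>, so that the two add up to no more than the size of \<open>a\<close>. The product \<open>E\<close> of these other targets
  over all the norms is limited by \<open>E \<le> (1 - \<zeta>)\<^bsup>m'\<^esup> |a|\<close> and by \<open>|3f| E\<^sup>2 \<le> 1\<close>, and these two restrictions
  correspond to the two terms of the maximum. An extra factor \<open>\<sigma> < 1\<close>, paid for by \<open>\<delta>\<close>, turns this into a contraction.
\<close>
lemma small_isotropic_vector_archimedean:
  fixes R :: "'k::field set" and \<delta> \<eta> :: real
  assumes nd: "normed_dedekind_domain R N" and mm: "multimetric R N m nrm"
    and vb: "valid_base m nrm qo"
    and lt: "multimetric_linear_type R N m nrm qo"
    and cR: "\<And>i k. i \<le> k \<Longrightarrow> k < n \<Longrightarrow> c i k \<in> R"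
    and c0: "i1 \<le> k1" "k1 < n" "c i1 k1 \<noteq> 0"
    and iso: "isotropic_vector R n c a0"
    and m': "m' = card (archimedean_indices m nrm)" "1 \<le> m'"
    and \<delta>: "0 < \<delta>" "\<delta> < C_M R N m nrm qo n" and \<eta>: "0 < \<eta>" "\<eta> < 1"
  shows "\<exists>a. isotropic_vector R n c a \<and>
             max_norm R N n a
               \<le> max ((1 - \<eta> powr (1 / real m')) powr (- (real m' * (real n - 1)))
                        / (\<eta> * (C_M R N m nrm qo n - \<delta>)))
                     (1 / (\<eta> * (C_M R N m nrm qo n - \<delta>))
                        * triple_form_size m nrm n c powr ((real n - 1) / 2))"
proof -
  have n: "0 < n" using c0 by simp
  note nj = multimetric_norm[OF mm]
  have "archimedean_indices m nrm \<noteq> {}" using m' by auto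
  then obtain j0 where j0: "j0 < m" "archimedean_norm (nrm j0)" by (auto simp: archimedean_indices_def)
  have qo: "qo = None"
  proof (cases qo)
    case (Some q)
    then have "1 < q" "value_group (nrm j0) \<subseteq> int_powers q" using vb j0 by (auto simp: valid_base_def)
    then show ?thesis using not_archimedean_if_discrete_values[OF nj[OF j0(1)]] j0(2) by blast
  qed
  have tv_arch: "x \<in> target_values qo (nrm j)" if "j < m" "archimedean_norm (nrm j)" "0 < x" for j x
    using closure_value_group_archimedean[OF nj[OF that(1)] that(2)] that(3) by (auto simp: qo target_values_def)
  have tv_val: "nrm j x \<in> target_values qo (nrm j)" if "j < m" "x \<noteq> 0" for j x
  proof -
    have "nrm j x \<in> value_group (nrm j)" using that by (simp add: value_group_def)
    then show ?thesis using closure_subset[of "value_group (nrm j)"] nrm_pos[OF nj[OF that(1)] that(2)]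
      by (auto simp: qo target_values_def)
  qed
  let ?S = "{C. admissible R N m nrm qo n C}"
  have bound: "C \<le> 2 ^ n" if "C \<in> ?S" for C
  proof -
    define \<epsilon> :: "nat \<Rightarrow> real" where "\<epsilon> j = (if j = j0 then 1 / 2 else 1)" for j
    have prod: "(\<Prod>j<m. \<epsilon> j) = 1 / 2"
      unfolding \<epsilon>_def using j0 by simp
    have "C * (\<Prod>j<m. \<epsilon> j) ^ n < 1"
    proof (rule admissible_bound[OF nd mm])
      show "admissible R N m nrm qo n C" using that by simp
      show "\<epsilon> j \<in> target_values qo (nrm j)" if "j < m" for j
        using tv_arch[OF j0, of "1 / 2"] tv_val[OF that, of 1] nrm_1[OF nj[OF that]] by (simp add: \<epsilon>_def)
    qed (simp add: prod)
    then show ?thesis by (simp add: prod power_divide field_simps)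
  qed
  define C' where "C' = C_M R N m nrm qo n - \<delta>"
  have C'0: "0 < C'" using \<delta> by (simp add: C'_def)
  have "?S \<noteq> {}" using lt n by (auto simp: multimetric_linear_type_def)
  moreover have "C' < Sup ?S" using \<delta> by (simp add: C'_def C_M_def)
  ultimately obtain C where C: "admissible R N m nrm qo n C" "C' < C" using less_cSupE by blast
  define G where "G = triple_form_size m nrm n c"
  have G1: "1 \<le> G"
  proof -
    have "1 \<le> nrm j 3" if "j \<in> archimedean_indices m nrm" for j
    proof -
      have j: "j < m" "archimedean_norm (nrm j)" using that by (auto simp: archimedean_indices_def)
      obtain \<sigma> where \<sigma>: "0 < \<sigma>" "\<forall>n. nrm j (of_nat n) = real n powr \<sigma>"
        using archimedean_powr_on_nat[OF nj[OF j(1)] j(2)] by blast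
      have "nrm j 3 = 3 powr \<sigma>" using \<sigma>(2)[rule_format, of 3] by simp
      then show ?thesis using \<sigma>(1) by (simp add: ge_one_powr_ge_zero)
    qed
    then have "1 \<le> (\<Prod>j\<in>archimedean_indices m nrm. nrm j 3)" by (intro prod_ge_1)
    moreover have "1 \<le> form_size m nrm n c"
      using form_size_ge_1[where c = c, OF nd mm c0(1,2) cR[OF c0(1,2)] c0(3)] .
    ultimately show ?thesis unfolding G_def triple_form_size_def
      by (metis mult_mono' mult_1 zero_le_one)
  qed
  define \<zeta> where "\<zeta> = \<eta> powr (1 / real m')"
  have \<zeta>: "0 < \<zeta>" "\<zeta> < 1" "\<zeta> ^ m' = \<eta>"
  proof -
    show "0 < \<zeta>" using \<eta> by (simp add: \<zeta>_def)
    have "\<eta> powr (1 / real m') < 1 powr (1 / real m')" using \<eta> m' by (intro powr_less_mono2) auto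
    then show "\<zeta> < 1" by (simp add: \<zeta>_def)
    show "\<zeta> ^ m' = \<eta>" using \<eta> m' by (simp add: \<zeta>_def powr_realpow[symmetric] powr_powr)
  qed
  define X where "X = inverse ((1 - \<zeta>) ^ (m' * (n - 1)))"
  have X: "(1 - \<eta> powr (1 / real m')) powr (- (real m' * (real n - 1))) = X" and X0: "0 < X"
  proof -
    have "real m' * (real n - 1) = real (m' * (n - 1))" using n by simp
    then show "(1 - \<eta> powr (1 / real m')) powr (- (real m' * (real n - 1))) = X"
      using powr_realpow[of "1 - \<zeta>" "m' * (n - 1)"] \<zeta> by (simp only: \<zeta>_def[symmetric] powr_minus X_def)
    show "0 < X" using \<zeta> by (simp add: X_def)
  qed
  define Y where "Y = sqrt G ^ (n - 1)"
  have Y: "G powr ((real n - 1) / 2) = Y" and Y0: "0 < Y"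
  proof -
    have rn: "real n - 1 = real (n - 1)" using n by simp
    have "G powr (real (n - 1) / 2) = (G powr (1 / 2)) powr real (n - 1)" by (simp add: powr_powr)
    also have "(G powr (1 / 2)) powr real (n - 1) = Y"
      using G1 by (simp add: powr_half_sqrt powr_realpow Y_def)
    finally show "G powr ((real n - 1) / 2) = Y" unfolding rn .
    show "0 < Y" using G1 by (simp add: Y_def)
  qed
  \<comment> \<open>The exponent \<open>p\<close> exceeds the number of factors \<open>\<sigma>\<close> that are lost in the product of all targets.\<close>
  define p where "p = m' * n + n + m'"
  define \<sigma> where "\<sigma> = root p (C' / C)"
  have "0 < p" using m' by (simp add: p_def)
  then have \<sigma>: "0 < \<sigma>" "\<sigma> < 1" "\<sigma> ^ p * C = C'"
    using C'0 C(2) by (auto simp: \<sigma>_def)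
  define T where "T = max (X / (\<eta> * C')) (1 / (\<eta> * C') * Y)"
  have "\<exists>a. isotropic_vector R n c a \<and> vec_size m nrm n a \<le> T"
  proof (rule contraction_descent[where S = "isotropic_vector R n c" and \<kappa> = "sqrt \<sigma>", OF iso])
    show "1 \<le> vec_size m nrm n a" if "isotropic_vector R n c a" for a
      by (rule vec_size_isotropic_ge_1[OF nd mm that])
    fix a assume a: "isotropic_vector R n c a" and large: "T < vec_size m nrm n a"
    define A where "A j = nrm j (a $ pivot n (vec_index a) (nrm j))" for j
    define P where "P = (\<Prod>j<m. A j)"
    have size: "vec_size m nrm n a = P"
      unfolding A_def P_def by (rule vec_size_eq_prod_pivot[OF n])
    have P1: "1 \<le> P" using vec_size_isotropic_ge_1[OF nd mm a] size by simp
    obtain l where l: "l < n" "a $ l \<noteq> 0" using isotropic_vector_nonzero_entry[OF a] .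
    have a_pivot: "a $ pivot n (vec_index a) (nrm j) \<noteq> 0" if "j < m" for j
      using pivot(2)[where f = "nrm j" and a = "vec_index a", OF n l(1)] nrm_pos[OF nj[OF that] l(2)] nrm_0[OF nj[OF that]] by auto
    have A_pos: "0 < A j" if "j < m" for j
      unfolding A_def using nrm_pos[OF nj[OF that] a_pivot[OF that]] .
    have A_tv: "A j \<in> target_values qo (nrm j)" if "j < m" for j
      unfolding A_def using tv_val[OF that a_pivot[OF that]] .
    define E where "E = min (\<sigma> / sqrt G) (\<sigma> ^ m' * (1 - \<zeta>) ^ m' * P)"
    have E0: "0 < E" using \<sigma> \<zeta> G1 P1 by (simp add: E_def)
    \<comment> \<open>Scaling the \<open>m'\<close> Archimedean targets by \<open>\<gamma> \<le> \<sigma>\<close> gives their product over the norms the value \<open>E\<close>.\<close>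
    define \<gamma> where "\<gamma> = root m' (E / ((1 - \<zeta>) ^ m' * P))"
    have \<gamma>_pow: "\<gamma> ^ m' * ((1 - \<zeta>) ^ m' * P) = E"
      using m' E0 \<zeta> P1 by (simp add: \<gamma>_def)
    have \<gamma>0: "0 < \<gamma>" using m' E0 \<zeta> P1 by (simp add: \<gamma>_def)
    have \<gamma>_le: "\<gamma> \<le> \<sigma>"
    proof (rule power_le_imp_le_base)
      have "E \<le> \<sigma> ^ m' * ((1 - \<zeta>) ^ m' * P)" by (simp add: E_def mult.assoc)
      then have "\<gamma> ^ m' * ((1 - \<zeta>) ^ m' * P) \<le> \<sigma> ^ m' * ((1 - \<zeta>) ^ m' * P)" using \<gamma>_pow by simp
      then have "\<gamma> ^ m' \<le> \<sigma> ^ m'" by (rule mult_right_le_imp_le) (use \<zeta> P1 in auto)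
      then show "\<gamma> ^ Suc (m' - 1) \<le> \<sigma> ^ Suc (m' - 1)" using m' by simp
    qed (use \<sigma> in auto)
    define B where "B j = A j * (if archimedean_norm (nrm j) then \<sigma> * \<zeta> else 1)" for j
    define \<epsilon> where "\<epsilon> j = A j * (if archimedean_norm (nrm j) then \<gamma> * (1 - \<zeta>) else 1)" for j
    have prods: "(\<Prod>j<m. B j) = P * (\<sigma> ^ m' * \<eta>)" "(\<Prod>j<m. \<epsilon> j) = E"
    proof -
      show "(\<Prod>j<m. B j) = P * (\<sigma> ^ m' * \<eta>)"
        unfolding B_def prod.distrib prod_if_card m'(1)[symmetric] P_def[symmetric] by (simp add: power_mult_distrib \<zeta>)
      show "(\<Prod>j<m. \<epsilon> j) = E"
        unfolding \<epsilon>_def prod.distrib prod_if_card m'(1)[symmetric] P_def[symmetric] using \<gamma>_pow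
        by (simp add: power_mult_distrib mult_ac)
    qed
    have \<sigma>_sqrt: "\<sigma> < sqrt \<sigma>"
    proof -
      have "sqrt \<sigma> * sqrt \<sigma> < 1 * sqrt \<sigma>" using \<sigma> by (intro mult_strict_right_mono) auto
      then show ?thesis using \<sigma> by simp
    qed
    have "\<exists>a'. isotropic_vector R n c a' \<and> vec_size m nrm n a' \<le> sqrt \<sigma> * P"
    proof (rule isotropic_descent[OF nd mm C(1) cR a])
      show pos: "0 < B j \<and> 0 < \<epsilon> j" if "j < m" for j
        using A_pos[OF that] \<sigma> \<zeta> \<gamma>0 by (simp add: B_def \<epsilon>_def)
      show "B j \<in> target_values qo (nrm j) \<and> \<epsilon> j \<in> target_values qo (nrm j)" if "j < m" for j
        using tv_arch[OF that _ conjunct1[OF pos[OF that]]] tv_arch[OF that _ conjunct2[OF pos[OF that]]] A_tv[OF that]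
        by (cases "archimedean_norm (nrm j)") (auto simp: B_def \<epsilon>_def)
      show "\<epsilon> j = 1" if "j < m" "trivial_norm (nrm j)" for j
        using trivial_norm_not_archimedean[OF nj[OF that(1)] that(2)] that(2) a_pivot[OF that(1)]
        by (simp add: \<epsilon>_def A_def trivial_norm_def)
      show "(\<Prod>j<m. if archimedean_norm (nrm j) then B j + \<epsilon> j else max (B j) (\<epsilon> j)) < sqrt \<sigma> * P"
      proof -
        have "(\<Prod>j<m. if archimedean_norm (nrm j) then B j + \<epsilon> j else max (B j) (\<epsilon> j))
            \<le> (\<Prod>j<m. A j * (if archimedean_norm (nrm j) then \<sigma> else 1))"
        proof (rule prod_mono, intro conjI)
          fix j assume "j \<in> {..<m}"
          then have j: "j < m" by simp
          show "0 \<le> (if archimedean_norm (nrm j) then B j + \<epsilon> j else max (B j) (\<epsilon> j))"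
            using pos[OF j] by auto
          have "\<sigma> * \<zeta> + \<gamma> * (1 - \<zeta>) \<le> \<sigma> * \<zeta> + \<sigma> * (1 - \<zeta>)"
            using \<gamma>_le \<zeta> by (intro add_left_mono mult_right_mono) auto
          also have "\<dots> = \<sigma>" by (simp add: algebra_simps)
          finally have "A j * (\<sigma> * \<zeta> + \<gamma> * (1 - \<zeta>)) \<le> A j * \<sigma>"
            using A_pos[OF j] by (intro mult_left_mono) auto
          then show "(if archimedean_norm (nrm j) then B j + \<epsilon> j else max (B j) (\<epsilon> j))
              \<le> A j * (if archimedean_norm (nrm j) then \<sigma> else 1)"
            by (simp add: B_def \<epsilon>_def distrib_left)
        qed
        also have "\<dots> = P * \<sigma> ^ m'"
          unfolding prod.distrib prod_if_card m'(1)[symmetric] P_def[symmetric] by simp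
        also have "\<dots> \<le> P * \<sigma> ^ 1"
          using P1 \<sigma> m' by (intro mult_left_mono power_decreasing) auto
        also have "\<dots> < sqrt \<sigma> * P" using \<sigma>_sqrt P1 by (simp add: mult.commute)
        finally show ?thesis .
      qed
      show "triple_form_size m nrm n c * vec_size m nrm n a * (\<Prod>j<m. \<epsilon> j)\<^sup>2 < sqrt \<sigma> * P"
      proof -
        have "E\<^sup>2 \<le> (\<sigma> / sqrt G)\<^sup>2" using E0 by (intro power_mono) (auto simp: E_def)
        also have "\<dots> = \<sigma>\<^sup>2 / G" using G1 by (simp add: power_divide)
        finally have "G * E\<^sup>2 \<le> \<sigma>\<^sup>2" using G1 by (simp add: le_divide_eq mult.commute)
        also have "\<dots> < 1 * \<sigma>" unfolding power2_eq_square using \<sigma> by (intro mult_strict_right_mono) auto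
        finally have "G * E\<^sup>2 < sqrt \<sigma>" using \<sigma>_sqrt by simp
        then have "G * E\<^sup>2 * P < sqrt \<sigma> * P" using P1 by (intro mult_strict_right_mono) auto
        then show ?thesis by (simp add: G_def size prods mult_ac)
      qed
      show "1 \<le> C * (\<Prod>j<m. B j * \<epsilon> j ^ (n - 1))"
      proof -
        have eq: "C * (\<Prod>j<m. B j * \<epsilon> j ^ (n - 1)) = C * (P * (\<sigma> ^ m' * \<eta>) * E ^ (n - 1))"
          by (simp only: prod.distrib prod_power_distrib[symmetric] prods)
        have TX: "X < \<eta> * C' * P" and TY: "Y < \<eta> * C' * P"
          using large \<eta> C'0 by (auto simp: T_def size field_simps)
        have final: "1 \<le> C * (P * (\<sigma> ^ m' * \<eta>) * (\<sigma> ^ r / Z))"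
          if Z: "0 < Z" "Z < \<eta> * C' * P" and r: "m' + r \<le> p" for r Z
        proof -
          have "Z \<le> \<eta> * C' * P" using Z by simp
          also have "\<dots> = \<eta> * P * C * \<sigma> ^ p" by (simp flip: \<sigma>(3))
          also have "\<dots> \<le> \<eta> * P * C * \<sigma> ^ (m' + r)"
            using r \<sigma> \<eta> P1 C C'0 by (intro mult_left_mono power_decreasing) auto
          finally show ?thesis using Z(1) by (simp add: le_divide_eq power_add mult_ac)
        qed
        show ?thesis
        proof (cases "\<sigma> / sqrt G \<le> \<sigma> ^ m' * (1 - \<zeta>) ^ m' * P")
          case True
          then have "E ^ (n - 1) = \<sigma> ^ (n - 1) / Y" by (simp add: E_def Y_def power_divide)
          then show ?thesis unfolding eq using final[OF Y0 TY, of "n - 1"] by (simp add: p_def)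
        next
          case False
          then have "E ^ (n - 1) = \<sigma> ^ (m' * (n - 1)) / X * P ^ (n - 1)"
            by (simp add: E_def X_def power_mult_distrib power_mult divide_inverse mult_ac)
          moreover have "\<sigma> ^ (m' * (n - 1)) / X * 1 \<le> \<sigma> ^ (m' * (n - 1)) / X * P ^ (n - 1)"
            using \<sigma> X0 P1 by (intro mult_left_mono one_le_power) auto
          ultimately have E_ge: "\<sigma> ^ (m' * (n - 1)) / X \<le> E ^ (n - 1)" by simp
          have "m' + m' * (n - 1) \<le> p"
            using n by (cases n) (auto simp: p_def)
          from final[OF X0 TX this]
          have "1 \<le> C * (P * (\<sigma> ^ m' * \<eta>) * (\<sigma> ^ (m' * (n - 1)) / X))" .
          also have "\<dots> \<le> C * (P * (\<sigma> ^ m' * \<eta>) * E ^ (n - 1))"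
            using E_ge C C'0 P1 \<sigma> \<eta> by (intro mult_left_mono) auto
          finally show ?thesis unfolding eq .
        qed
      qed
    qed
    then show "\<exists>a'. isotropic_vector R n c a' \<and> vec_size m nrm n a' \<le> sqrt \<sigma> * vec_size m nrm n a"
      by (simp add: size)
  qed (use \<sigma> in auto)
  then obtain a where a: "isotropic_vector R n c a" "vec_size m nrm n a \<le> T" by blast
  have "max_norm R N n a \<le> T"
    unfolding max_norm_def
  proof (rule Max.boundedI)
    show "(\<lambda>i. elem_norm R N (a $ i)) ` {..<n} \<noteq> {}" using n by auto
    fix x assume "x \<in> (\<lambda>i. elem_norm R N (a $ i)) ` {..<n}"
    then obtain i where "i < n" "x = elem_norm R N (a $ i)" by blast
    then show "x \<le> T" using elem_norm_le_vec_size[OF mm, of i n a] a(2) by linarith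
  qed auto
  then show ?thesis using a(1) unfolding T_def X Y[unfolded G_def] C'_def[symmetric] G_def by blast
qed

section \<open>Small isotropic vectors\<close>

theorem theorem6p1:
  fixes R :: "'k::field set"
    and N :: "'k set \<Rightarrow> real"
    and m n :: nat
    and nrm :: "nat \<Rightarrow> 'k \<Rightarrow> real"
    and qo :: "real option"
    and c :: "nat \<Rightarrow> nat \<Rightarrow> 'k"
  assumes "normed_dedekind_domain R N"
    and "multimetric R N m nrm"
    and "valid_base m nrm qo"
    and "multimetric_linear_type R N m nrm qo"
    and "discrete (elem_norm R N ` R)"
    and "\<forall>i k. i \<le> k \<and> k < n \<longrightarrow> c i k \<in> R"
    and "\<exists>i k. i \<le> k \<and> k < n \<and> c i k \<noteq> 0"
    and "\<exists>v. isotropic_vector R n c v"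
  shows
    "(\<forall>q. qo = Some q \<longrightarrow>
        (\<exists>a. isotropic_vector R n c a \<and>
             max_deg R N q n a
               \<le> real m * real n - 1 - log q (C_M R N m nrm qo n)
                 + ((real n - 1) / 2) * log q (form_size m nrm n c)))
     \<and>
     (\<forall>m' \<delta> \<eta>.
        m' = card (archimedean_indices m nrm) \<and> 1 \<le> m' \<and>
        0 < \<delta> \<and> \<delta> < C_M R N m nrm qo n \<and> 0 < \<eta> \<and> \<eta> < 1 \<longrightarrow>
        (\<exists>a. isotropic_vector R n c a \<and>
             max_norm R N n a
               \<le> max ((1 - \<eta> powr (1 / real m')) powr (- (real m' * (real n - 1)))
                        / (\<eta> * (C_M R N m nrm qo n - \<delta>)))
                     (1 / (\<eta> * (C_M R N m nrm qo n - \<delta>))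
                        * triple_form_size m nrm n c powr ((real n - 1) / 2))))
     \<and>
     (R = \<int> \<and> m = 1 \<and> (\<forall>z::int. nrm 0 (of_int z) = real_of_int \<bar>z\<bar>) \<longrightarrow>
        (\<exists>a. isotropic_vector R n c a \<and>
             vec_size m nrm n a \<le> (3 * form_size m nrm n c) powr ((real n - 1) / 2)))"
proof (intro conjI allI impI)
  have cR: "c i k \<in> R" if "i \<le> k" "k < n" for i k
    using assms(6) that by blast
  obtain i1 k1 where c0: "i1 \<le> k1" "k1 < n" "c i1 k1 \<noteq> 0"
    using assms(7) by blast
  obtain a0 where iso: "isotropic_vector R n c a0"
    using assms(8) by blast
  note nd = assms(1) and mm = assms(2)
  show "\<exists>a. isotropic_vector R n c a \<and>
      max_deg R N q n a
        \<le> real m * real n - 1 - log q (C_M R N m nrm qo n)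
          + ((real n - 1) / 2) * log q (form_size m nrm n c)"
    if "qo = Some q" for q
    using small_isotropic_vector_discrete_type[OF nd mm _ _ cR c0 iso, of q] assms(3,4)
    unfolding that by blast
  show "\<exists>a. isotropic_vector R n c a \<and>
      max_norm R N n a
        \<le> max ((1 - \<eta> powr (1 / real m')) powr (- (real m' * (real n - 1)))
                 / (\<eta> * (C_M R N m nrm qo n - \<delta>)))
              (1 / (\<eta> * (C_M R N m nrm qo n - \<delta>))
                 * triple_form_size m nrm n c powr ((real n - 1) / 2))"
    if "m' = card (archimedean_indices m nrm) \<and> 1 \<le> m' \<and>
      0 < \<delta> \<and> \<delta> < C_M R N m nrm qo n \<and> 0 < \<eta> \<and> \<eta> < 1" for m' \<delta> \<eta>
    using small_isotropic_vector_archimedean[OF nd mm assms(3,4) cR c0 iso, of m' \<delta> \<eta>] that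
    by blast
  show "\<exists>a. isotropic_vector R n c a \<and>
      vec_size m nrm n a \<le> (3 * form_size m nrm n c) powr ((real n - 1) / 2)"
    if "R = \<int> \<and> m = 1 \<and> (\<forall>z::int. nrm 0 (of_int z) = real_of_int \<bar>z\<bar>)"
  proof -
    have R: "R = \<int>" and m: "m = 1" and nrm: "nrm 0 (of_int z) = real_of_int \<bar>z\<bar>" for z
      using that by blast+
    show ?thesis
      using small_isotropic_vector_int[OF nd[unfolded R] mm[unfolded R m] nrm cR[unfolded R] c0 iso[unfolded R]]
      unfolding R m .
  qed
qed

end
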